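(* Let $m$ and $\epsilon$ be positive real numbers with $\epsilon$ sufficiently small, and let $s,k$ be natural numbers with $2 \leq k \leq s \leq k(k+1)/2$. Suppose $A \subseteq \mathbb{R}\setminus\{0\}$ is a finite, well-spaced set such that $|A|$ is large enough and $X_A \leq |A|^m$. Then \[ |A|^{2s-2\epsilon} \ll |s\mathscr{A} + s\mathscr{A}|\, |A/A|^{s-1/2-\epsilon}, \] where $\mathscr{A} = \{(a,a^2,\dots,a^k) : a \in A\}\subseteq \mathbb{R}^k$.
   Context: The diameter of $A$ is $X_A = |\sup A - \inf A|$. A finite set $A\subseteq \mathbb{R}$ is well-spaced if $|A\cap (j,j+1]|\le 1$ for all integers $j\in[\inf A - 1,\sup A]$. For $\mathscr{B}\subseteq\mathbb{R}^k$, $s\mathscr{B}=\{b_1+\dots+b_s: b_i\in\mathscr{B}\}$ and $\mathscr{B}+\mathscr{B}$ is the usual sumset. $A/A=\{a_2/a_1 : a_1,a_2\in A\}$. $X\ll Y$ means $|X|\le C|Y|$ for some constant $C>0$. *)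

theory Defs
  imports "HOL-Analysis.Analysis" "HOL-Library.Set_Algebras" "Jordan_Normal_Form.Matrix"
begin

definition diam :: "real set \<Rightarrow> real" where
  "diam A = \<bar>Sup A - Inf A\<bar>"

definition well_spaced :: "real set \<Rightarrow> bool" where
  "well_spaced A \<longleftrightarrow>
     (\<forall>j::int. Inf A - 1 \<le> of_int j \<and> of_int j \<le> Sup A
        \<longrightarrow> card (A \<inter> {of_int j <.. of_int j + 1}) \<le> 1)"

definition ratio_set :: "real set \<Rightarrow> real set" where
  "ratio_set A = {a\<^sub>2 / a\<^sub>1 | a\<^sub>1 a\<^sub>2. a\<^sub>1 \<in> A \<and> a\<^sub>2 \<in> A}"

text \<open>
  As \<open>k\<close> is a quantified variable, \<open>\<real>\<^sup>k\<close> is represented by \<open>carrier_vec k\<close>.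
  Vector indices start at \<open>0\<close>, hence the exponent \<open>Suc i\<close>.
\<close>

definition moment_curve :: "nat \<Rightarrow> real set \<Rightarrow> real vec set" where
  "moment_curve k A = (\<lambda>a. vec k (\<lambda>i. a ^ Suc i)) ` A"

text \<open>
  The \<open>s\<close>-fold sumset of a set \<open>B \<subseteq> carrier_vec k\<close>; the dimension is a parameter because
  the type of vectors has no zero element of its own. The sum of two sets is \<open>+\<close> on sets.
\<close>

definition nfold_sumset :: "nat \<Rightarrow> nat \<Rightarrow> real vec set \<Rightarrow> real vec set" where
  "nfold_sumset k s B = {finsum_vec TYPE(real) k b {..<s} | b. b \<in> {..<s} \<rightarrow> B}"

end

theory Submission
  imports Defs
begin

text \<open>
  For a ratio \<open>c\<close> let \<open>B\<^sub>c\<close> be the set of \<open>b \<in> B\<close> with \<open>c * b \<in> B\<close>.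
  Solymosi's argument on consecutive slopes \<open>c\<close> with \<open>|B\<^sub>c| \<ge> t\<close>, for a popular level \<open>t\<close>,
  bounds the square of the size of the \<open>2s\<close>-fold sumset below by the number of these slopes
  times the square of the smallest \<open>s\<close>-fold sumset over some \<open>B\<^sub>c\<close>. The latter has at least
  \<open>t^s\<close> elements up to an \<open>\<epsilon>\<close>-loss, by the critical mean value estimate for well-spaced sets.

  The mean value estimate is \<open>\<ell>\<^sup>2\<close> decoupling for the moment curve, proved along the lines of
  Guo, Li, Yung and Zorin-Kranich: mixed moments of two separated pieces are
  decoupled in lower dimension, Hoelder's inequality exchanges the two pieces, and iterating
  this improves any exponent of decoupling that is still positive. All integrals are finite
  weighted sums; instead of a Fourier support condition one asks that correlations of tuples
  vanish unless the tuples nearly solve the system of equations.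
\<close>

section \<open>Systems of exponential sums along a curve\<close>

text \<open>Arbitrary weights are allowed because a mixed moment is a moment of one piece whose
  weight has absorbed a power of the other; decoupling in lower dimension, known by induction with
  an arbitrarily small loss, applies to that weighted system. At the critical exponents the powers
  left over by Hoelder's inequality recombine exactly into mixed moments of the same family. The one
  source of gain is that a cell of length \<open>2 ^ -h\<close> has only \<open>n - h\<close> scales
  left. Each round of the exchange feeds this saving into the bilinear exponents. A bilinear gain
  alone is not enough: the pieces produced by the broad-narrow argument have fixed length, and
  reaching scale \<open>h\<close> from there by the triangle inequality costs a power of
  \<open>2 ^ h\<close>. The rounds are repeated until the gain exceeds this cost. The bound
  \<open>diam A \<le> card A powr m\<close> turns a loss per dyadic scale into a small power of
  \<open>card A\<close>.\<close>

lemma Holder_sum: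
  fixes h u v :: "'a \<Rightarrow> real"
  assumes fin: "finite T" and h: "\<And>t. t \<in> T \<Longrightarrow> 0 \<le> h t" and u: "\<And>t. t \<in> T \<Longrightarrow> 0 \<le> u t"
    and v: "\<And>t. t \<in> T \<Longrightarrow> 0 \<le> v t" and le: "\<And>t. t \<in> T \<Longrightarrow> h t ^ (a + b) \<le> u t ^ a * v t ^ b"
    and a: "0 < a" and b: "0 < b"
  shows "(\<Sum>t\<in>T. h t) ^ (a + b) \<le> (\<Sum>t\<in>T. u t) ^ a * (\<Sum>t\<in>T. v t) ^ b"
proof (cases "(\<Sum>t\<in>T. u t) = 0 \<or> (\<Sum>t\<in>T. v t) = 0")
  case True
  have "h t = 0" if "t \<in> T" for t
  proof -
    have "u t = 0 \<or> v t = 0"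
      using True that sum_nonneg_eq_0_iff[OF fin, of u] sum_nonneg_eq_0_iff[OF fin, of v] u v by auto
    then have "h t ^ (a + b) \<le> 0" using le[OF that] a b by (auto simp: zero_power)
    then show ?thesis using h[OF that] zero_less_power[of "h t" "a + b"] by linarith
  qed
  then have "(\<Sum>t\<in>T. h t) = 0" by simp
  moreover have "0 \<le> (\<Sum>t\<in>T. u t) ^ a * (\<Sum>t\<in>T. v t) ^ b" by (intro mult_nonneg_nonneg zero_le_power sum_nonneg u v)
  ultimately show ?thesis using a by (simp add: zero_power)
next
  case False
  define U where "U = (\<Sum>t\<in>T. u t)"
  define V where "V = (\<Sum>t\<in>T. v t)"
  have U: "U > 0" and V: "V > 0" using False u v by (auto simp: U_def V_def less_le sum_nonneg)
  define \<alpha> where "\<alpha> = real a / real (a + b)"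
  define \<beta> where "\<beta> = real b / real (a + b)"
  have ab: "\<alpha> > 0" "\<beta> > 0" "\<alpha> + \<beta> = 1" using a b by (auto simp: \<alpha>_def \<beta>_def add_divide_distrib[symmetric])
  \<comment> \<open>\<open>G\<close> is the claimed bound after taking the root. Young's inequality
    for \<open>u t / U\<close> and \<open>v t / V\<close> sums over \<open>t\<close> to
    \<open>G * (\<alpha> + \<beta>) = G\<close>.\<close>
  define G where "G = U powr \<alpha> * V powr \<beta>"
  have G: "G > 0" using U V by (simp add: G_def)
  have pw: "(x powr \<alpha> * y powr \<beta>) ^ (a + b) = x ^ a * y ^ b" if "x > 0" "y > 0" for x y :: real
  proof -
    have "(x powr \<alpha>) ^ (a + b) = x powr (\<alpha> * real (a + b))" "(y powr \<beta>) ^ (a + b) = y powr (\<beta> * real (a + b))"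
      using that by (simp_all add: powr_powr flip: powr_realpow)
    moreover have "\<alpha> * real (a + b) = real a" "\<beta> * real (a + b) = real b" using a by (auto simp: \<alpha>_def \<beta>_def)
    ultimately show ?thesis using that by (simp add: power_mult_distrib powr_realpow)
  qed
  have pt: "h t \<le> G * (\<alpha> * (u t / U) + \<beta> * (v t / V))" if t: "t \<in> T" for t
  proof (cases "u t = 0 \<or> v t = 0")
    case True
    then have "h t ^ (a + b) \<le> 0" using le[OF t] a b by (auto simp: zero_power)
    then have "h t = 0" using h[OF t] zero_less_power[of "h t" "a + b"] by linarith
    then show ?thesis using G ab U V u[OF t] v[OF t] by simp
  next
    case False
    then have p: "u t > 0" "v t > 0" using u[OF t] v[OF t] by auto
    have "h t ^ (a + b) \<le> (u t powr \<alpha> * v t powr \<beta>) ^ (a + b)"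
      unfolding pw[OF p] by (rule le[OF t])
    then have "h t \<le> u t powr \<alpha> * v t powr \<beta>"
      using a h[OF t] by (subst (asm) power_mono_iff) auto
    also have "\<dots> = G * ((u t / U) powr \<alpha> * (v t / V) powr \<beta>)"
      using p U V by (simp add: G_def powr_divide)
    also have "\<dots> \<le> G * (\<alpha> * (u t / U) + \<beta> * (v t / V))"
      using Youngs_inequality_0[of \<alpha> \<beta> "u t / U" "v t / V"] ab p U V G by (intro mult_left_mono) auto
    finally show ?thesis .
  qed
  have "(\<Sum>t\<in>T. h t) \<le> (\<Sum>t\<in>T. G * (\<alpha> * (u t / U) + \<beta> * (v t / V)))" by (intro sum_mono pt)
  also have "\<dots> = G * (\<alpha> * (U / U) + \<beta> * (V / V))"
    unfolding U_def V_def sum_distrib_left[symmetric] sum.distrib sum_divide_distrib[symmetric] by (rule refl)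
  also have "\<dots> = G" using U V ab by simp
  finally have "(\<Sum>t\<in>T. h t) ^ (a + b) \<le> G ^ (a + b)" by (intro power_mono sum_nonneg h) auto
  also have "\<dots> = U ^ a * V ^ b" unfolding G_def by (rule pw[OF U V])
  finally show ?thesis by (simp add: U_def V_def)
qed

lemma sum_pow_lists:
  fixes F :: "'a \<Rightarrow> 'b::comm_semiring_1"
  assumes "finite B"
  shows "(\<Sum>x\<in>B. F x) ^ n = (\<Sum>xs | set xs \<subseteq> B \<and> length xs = n. \<Prod>x\<leftarrow>xs. F x)"
proof (induction n)
  case 0
  have "{xs. set xs \<subseteq> B \<and> length xs = 0} = {[]}" by auto
  then show ?case by simp
next
  case (Suc n)
  have inj: "inj_on (\<lambda>(xs, n). n # xs) ({xs. set xs \<subseteq> B \<and> length xs = n} \<times> B)" by (auto simp: inj_on_def)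
  have "(\<Sum>xs | set xs \<subseteq> B \<and> length xs = Suc n. \<Prod>x\<leftarrow>xs. F x)
      = (\<Sum>(xs, x) \<in> {xs. set xs \<subseteq> B \<and> length xs = n} \<times> B. F x * (\<Prod>x\<leftarrow>xs. F x))"
    unfolding lists_length_Suc_eq by (subst sum.reindex[OF inj]) (auto intro!: sum.cong)
  also have "\<dots> = (\<Sum>xs | set xs \<subseteq> B \<and> length xs = n. \<Sum>x\<in>B. F x * (\<Prod>x\<leftarrow>xs. F x))"
    by (rule sum.cartesian_product[symmetric])
  also have "\<dots> = (\<Sum>x\<in>B. F x) * (\<Sum>xs | set xs \<subseteq> B \<and> length xs = n. \<Prod>x\<leftarrow>xs. F x)"
    by (simp add: sum_distrib_left sum_distrib_right)
  finally show ?case using Suc by simp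
qed

lemma sum_pow_le:
  fixes F :: "'a \<Rightarrow> real"
  assumes "finite B" "\<And>x. x \<in> B \<Longrightarrow> 0 \<le> F x" "0 < n"
  shows "(\<Sum>x\<in>B. F x ^ n) \<le> (\<Sum>x\<in>B. F x) ^ n"
proof -
  obtain m where m: "n = Suc m" using \<open>0 < n\<close> gr0_implies_Suc by blast
  have "(\<Sum>x\<in>B. F x ^ n) \<le> (\<Sum>x\<in>B. F x * (\<Sum>x\<in>B. F x) ^ m)"
    unfolding m power_Suc using assms
    by (intro sum_mono mult_left_mono power_mono member_le_sum) auto
  also have "\<dots> = (\<Sum>x\<in>B. F x) ^ n" by (simp add: m sum_distrib_right)
  finally show ?thesis .
qed

lemma norm_sum_pow_le:
  fixes F :: "'a \<Rightarrow> complex"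
  assumes "finite B" "card B \<le> N" "0 < n"
  shows "norm (\<Sum>x\<in>B. F x) ^ n \<le> real N ^ n * (\<Sum>x\<in>B. norm (F x) ^ n)"
proof (cases "B = {}")
  case True
  then show ?thesis using assms by (simp add: zero_power)
next
  case False
  define M where "M = Max ((\<lambda>x. norm (F x)) ` B)"
  obtain z where z: "z \<in> B" "M = norm (F z)"
    using Max_in[of "(\<lambda>x. norm (F x)) ` B"] False assms unfolding M_def by blast
  have le: "norm (F x) \<le> M" if "x \<in> B" for x using that assms by (auto simp: M_def)
  have "norm (\<Sum>x\<in>B. F x) \<le> (\<Sum>x\<in>B. norm (F x))" by (rule norm_sum)
  also have "\<dots> \<le> real (card B) * M" using le by (intro sum_bounded_above) auto
  also have "\<dots> \<le> real N * M" using assms z by (intro mult_right_mono) auto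
  finally have "norm (\<Sum>x\<in>B. F x) ^ n \<le> (real N * M) ^ n" by (intro power_mono) auto
  also have "\<dots> = real N ^ n * norm (F z) ^ n" by (simp add: power_mult_distrib z)
  also have "\<dots> \<le> real N ^ n * (\<Sum>x\<in>B. norm (F x) ^ n)"
    using z assms by (intro mult_left_mono member_le_sum) auto
  finally show ?thesis .
qed

text \<open>The critical number of variables: for \<open>s = tri k\<close> the \<open>N ^ s\<close>
  diagonal solutions of the system of degree \<open>k\<close> match the expected count
  \<open>N ^ (2 * s - tri k)\<close>.\<close>

definition tri :: "nat \<Rightarrow> nat" where "tri k = k * (k + 1) div 2"

definition expsum :: "(real \<Rightarrow> 't \<Rightarrow> complex) \<Rightarrow> real set \<Rightarrow> 't \<Rightarrow> complex" where
  "expsum f B \<theta> = (\<Sum>x\<in>B. f x \<theta>)"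

definition cell :: "(real \<Rightarrow> real) \<Rightarrow> real set \<Rightarrow> nat \<Rightarrow> int \<Rightarrow> real set" where
  "cell p A n i = {x \<in> A. of_int i \<le> p x * 2 ^ n \<and> p x * 2 ^ n < of_int i + 1}"

text \<open>The real interval under a cell. Separation and bounds on densities are imposed on it,
  not just at the points of \<open>A\<close>, so that the mean value theorem and recentring at an
  end point apply.\<close>

definition seg :: "nat \<Rightarrow> int \<Rightarrow> real set" where
  "seg n i = {of_int i / 2 ^ n .. (of_int i + 1) / 2 ^ n}"

definition gap :: "(nat \<Rightarrow> real \<Rightarrow> real) \<Rightarrow> (real \<Rightarrow> real) \<Rightarrow> real list \<Rightarrow> real list \<Rightarrow> nat \<Rightarrow> real" where
  "gap g p xs ys j = (\<Sum>x\<leftarrow>xs. g j (p x)) - (\<Sum>y\<leftarrow>ys. g j (p y))"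

definition corr :: "(real \<Rightarrow> 't \<Rightarrow> complex) \<Rightarrow> 't set \<Rightarrow> ('t \<Rightarrow> real) \<Rightarrow> real list \<Rightarrow> real list \<Rightarrow> complex" where
  "corr f \<Theta> w xs ys = (\<Sum>\<theta>\<in>\<Theta>. of_real (w \<theta>) * ((\<Prod>x\<leftarrow>xs. f x \<theta>) * cnj (\<Prod>y\<leftarrow>ys. f y \<theta>)))"

text \<open>
  The substitute for a Fourier support condition: tuples whose sums along the curve
  \<open>g\<close> differ by more than \<open>T\<close> in some coordinate are uncorrelated.
\<close>

definition orth :: "nat \<Rightarrow> nat \<Rightarrow> real \<Rightarrow> (nat \<Rightarrow> real \<Rightarrow> real) \<Rightarrow> (real \<Rightarrow> real) \<Rightarrow> real set
    \<Rightarrow> (real \<Rightarrow> 't \<Rightarrow> complex) \<Rightarrow> 't set \<Rightarrow> ('t \<Rightarrow> real) \<Rightarrow> bool" where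
  "orth k s T g p A f \<Theta> w \<longleftrightarrow> (\<forall>xs ys. set xs \<subseteq> A \<longrightarrow> set ys \<subseteq> A \<longrightarrow> length xs = s \<longrightarrow> length ys = s
     \<longrightarrow> corr f \<Theta> w xs ys \<noteq> 0 \<longrightarrow> (\<forall>j<k. \<bar>gap g p xs ys j\<bar> \<le> T))"

text \<open>
  The moment curve itself is the case \<open>q = 1\<close>. Densities \<open>q\<close> are
  allowed because the class is then closed under rescaling an interval to \<open>[0, 1]\<close> and under
  projecting away the first \<open>k - l\<close> coordinates at a point \<open>b\<close>, which turns \<open>q\<close> into
  \<open>q x * (x - b) ^ (k - l)\<close>. Indices are shifted: coordinate \<open>j\<close> has degree \<open>j + 1\<close>.
\<close>

definition sys :: "nat \<Rightarrow> real \<Rightarrow> nat \<Rightarrow> (real \<Rightarrow> real) \<Rightarrow> (nat \<Rightarrow> real \<Rightarrow> real) \<Rightarrow> (real \<Rightarrow> real) \<Rightarrow> real set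
    \<Rightarrow> (real \<Rightarrow> 't \<Rightarrow> complex) \<Rightarrow> 't set \<Rightarrow> ('t \<Rightarrow> real) \<Rightarrow> bool" where
  "sys k C n q g p A f \<Theta> w \<longleftrightarrow> finite A \<and> finite \<Theta> \<and> (\<forall>\<theta>. 0 \<le> w \<theta>) \<and> (\<forall>x\<in>A. 0 \<le> p x \<and> p x < 1)
     \<and> (\<forall>x\<in>{0..1}. 1 \<le> C * \<bar>q x\<bar> \<and> \<bar>q x\<bar> \<le> C)
     \<and> (\<forall>j<k. \<forall>x. (g j has_real_derivative q x * x ^ j) (at x))
     \<and> orth k (tri k) (C / 2 ^ (n * k)) g p A f \<Theta> w"

definition mom :: "(real \<Rightarrow> 't \<Rightarrow> complex) \<Rightarrow> 't set \<Rightarrow> ('t \<Rightarrow> real) \<Rightarrow> nat \<Rightarrow> real set \<Rightarrow> real" where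
  "mom f \<Theta> w s B = (\<Sum>\<theta>\<in>\<Theta>. w \<theta> * norm (expsum f B \<theta>) ^ (2 * s))"

definition mix :: "(real \<Rightarrow> 't \<Rightarrow> complex) \<Rightarrow> 't set \<Rightarrow> ('t \<Rightarrow> real) \<Rightarrow> nat \<Rightarrow> real set \<Rightarrow> nat \<Rightarrow> real set \<Rightarrow> real" where
  "mix f \<Theta> w a B b B' = (\<Sum>\<theta>\<in>\<Theta>. w \<theta> * (norm (expsum f B \<theta>) ^ (2 * a) * norm (expsum f B' \<theta>) ^ (2 * b)))"

text \<open>
  The moments of the finest pieces are measured by a weight \<open>\<nu>\<close> on the points, so that the
  \<open>\<ell>\<^sup>2\<close> sum on the right-hand side of decoupling becomes additive over nested cells and no
  roots are needed.
\<close>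

definition cellbd :: "nat \<Rightarrow> nat \<Rightarrow> (real \<Rightarrow> real) \<Rightarrow> real set
    \<Rightarrow> (real \<Rightarrow> 't \<Rightarrow> complex) \<Rightarrow> 't set \<Rightarrow> ('t \<Rightarrow> real) \<Rightarrow> (real \<Rightarrow> real) \<Rightarrow> bool" where
  "cellbd n s p A f \<Theta> w \<nu> \<longleftrightarrow> (\<forall>x. 0 \<le> \<nu> x) \<and> (\<forall>i. mom f \<Theta> w s (cell p A n i) \<le> (\<Sum>x\<in>cell p A n i. \<nu> x) ^ s)"

text \<open>Decoupling down to scale \<open>2 ^ -n\<close> with a loss of
  \<open>2 powr (\<eta> * n)\<close>, where \<open>K\<close> is uniform in the system. The type
  argument fixes the index type of the weighted sums, which survives every rescaling.\<close>

definition decoupled :: "'t itself \<Rightarrow> nat \<Rightarrow> real \<Rightarrow> real \<Rightarrow> real \<Rightarrow> bool" where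
  "decoupled _ k \<eta> C K \<longleftrightarrow> (\<forall>n q g p A f \<Theta> w \<nu>.
     sys k C n q g p A (f :: real \<Rightarrow> 't \<Rightarrow> complex) \<Theta> w \<longrightarrow> cellbd n (tri k) p A f \<Theta> w \<nu> \<longrightarrow>
     mom f \<Theta> w (tri k) A \<le> 2 powr (K + \<eta> * real n) * (\<Sum>x\<in>A. \<nu> x) ^ tri k)"

text \<open>All \<open>C\<close> are included because the arguments leave any fixed class: rescaling
  a cell replaces \<open>C\<close> by \<open>2 ^ k * C\<close>, and lowering the dimension enlarges
  it further.\<close>

definition decoupling :: "'t itself \<Rightarrow> nat \<Rightarrow> real \<Rightarrow> bool" where
  "decoupling T k \<eta> \<longleftrightarrow> (\<forall>C\<ge>1. \<exists>K\<ge>0. decoupled T k \<eta> C K)"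

lemma decoupledD:
  assumes "decoupled TYPE('t) k \<eta> C K" "sys k C n q g p A (f :: real \<Rightarrow> 't \<Rightarrow> complex) \<Theta> w"
    "cellbd n (tri k) p A f \<Theta> w \<nu>"
  shows "mom f \<Theta> w (tri k) A \<le> 2 powr (K + \<eta> * real n) * (\<Sum>x\<in>A. \<nu> x) ^ tri k"
  using assms unfolding decoupled_def by blast

lemma decoupling_mono:
  assumes "decoupling TYPE('t) k \<eta>" "\<eta> \<le> \<eta>'"
  shows "decoupling TYPE('t) k \<eta>'"
proof -
  have "decoupled TYPE('t) k \<eta>' C K" if K: "decoupled TYPE('t) k \<eta> C K" for C K
    unfolding decoupled_def
  proof (intro allI impI)
    fix n q g p A \<Theta> w \<nu> and f :: "real \<Rightarrow> 't \<Rightarrow> complex"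
    assume s: "sys k C n q g p A f \<Theta> w" and f: "cellbd n (tri k) p A f \<Theta> w \<nu>"
    note decoupledD[OF K s f]
    also have "2 powr (K + \<eta> * real n) * (\<Sum>x\<in>A. \<nu> x) ^ tri k \<le> 2 powr (K + \<eta>' * real n) * (\<Sum>x\<in>A. \<nu> x) ^ tri k"
      using f assms(2) by (intro mult_right_mono powr_mono add_left_mono zero_le_power sum_nonneg) (auto simp: cellbd_def)
    finally show "mom f \<Theta> w (tri k) A \<le> 2 powr (K + \<eta>' * real n) * (\<Sum>x\<in>A. \<nu> x) ^ tri k" .
  qed
  then show ?thesis using assms(1) unfolding decoupling_def by blast
qed

section \<open>Dyadic cells and elementary moment bounds\<close>

lemma cell_subset: "cell p A n i \<subseteq> A" by (auto simp: cell_def)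

lemma finite_cell: "finite A \<Longrightarrow> finite (cell p A n i)" by (auto simp: cell_def)

lemma cell_iff: "x \<in> cell p A n i \<longleftrightarrow> x \<in> A \<and> \<lfloor>p x * 2 ^ n\<rfloor> = i"
  by (auto simp: cell_def floor_eq_iff)

lemma cell_seg: "x \<in> cell p A n i \<Longrightarrow> p x \<in> seg n i"
  by (auto simp: cell_def seg_def field_simps)

lemma cell_nested_index:
  assumes "x \<in> cell p A g i" "x \<in> cell p A' n j" "g \<le> n"
  shows "i * 2 ^ (n - g) \<le> j" "j + 1 \<le> (i + 1) * 2 ^ (n - g)"
proof -
  have e: "(2::real) ^ n = 2 ^ g * 2 ^ (n - g)" using assms by (simp flip: power_add)
  have a: "of_int i \<le> p x * 2 ^ g" "p x * 2 ^ g < of_int i + 1" "of_int j \<le> p x * 2 ^ n" "p x * 2 ^ n < of_int j + 1"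
    using assms by (auto simp: cell_def)
  have e': "p x * 2 ^ n = p x * 2 ^ g * 2 ^ (n - g)" by (simp add: e)
  have "real_of_int i * 2 ^ (n - g) \<le> p x * 2 ^ g * 2 ^ (n - g)" using a by (intro mult_right_mono) auto
  then have "real_of_int i * 2 ^ (n - g) < of_int j + 1" using a e' by linarith
  then have "real_of_int (i * 2 ^ (n - g)) < of_int (j + 1)" by simp
  then show "i * 2 ^ (n - g) \<le> j" by linarith
  have "p x * 2 ^ g * 2 ^ (n - g) < (real_of_int i + 1) * 2 ^ (n - g)" using a by (intro mult_strict_right_mono) auto
  then have "of_int j < (real_of_int i + 1) * 2 ^ (n - g)" using a e' by linarith
  then have "real_of_int j < of_int ((i + 1) * 2 ^ (n - g))" by simp
  then show "j + 1 \<le> (i + 1) * 2 ^ (n - g)" by linarith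
qed

lemma cell_nested:
  assumes "g \<le> n" "x \<in> cell p A g i" "x \<in> cell p A' n j"
  shows "cell p A n j \<subseteq> cell p A g i" "seg n j \<subseteq> seg g i"
proof -
  have e: "(2::real) ^ n = 2 ^ g * 2 ^ (n - g)" using assms by (simp flip: power_add)
  have e': "p y * 2 ^ n = p y * 2 ^ g * 2 ^ (n - g)" for y by (simp add: e)
  note c = cell_nested_index[OF assms(2,3,1)]
  have c1: "real_of_int i * 2 ^ (n - g) \<le> of_int j" 
  proof -
    have "real_of_int (i * 2 ^ (n - g)) \<le> of_int j" using c(1) by (simp only: of_int_le_iff)
    then show ?thesis by simp
  qed
  have c2: "of_int j + 1 \<le> (real_of_int i + 1) * 2 ^ (n - g)"
  proof -
    have "real_of_int (j + 1) \<le> of_int ((i + 1) * 2 ^ (n - g))" using c(2) by (simp only: of_int_le_iff)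
    then show ?thesis by simp
  qed
  show "cell p A n j \<subseteq> cell p A g i"
  proof
    fix y assume "y \<in> cell p A n j"
    then have y: "y \<in> A" "of_int j \<le> p y * 2 ^ n" "p y * 2 ^ n < of_int j + 1" by (auto simp: cell_def)
    have "real_of_int i * 2 ^ (n - g) \<le> (p y * 2 ^ g) * 2 ^ (n - g)" using y c1 e'[of y] by linarith
    moreover have "(p y * 2 ^ g) * 2 ^ (n - g) < (real_of_int i + 1) * 2 ^ (n - g)" using y c2 e'[of y] by linarith
    ultimately show "y \<in> cell p A g i" using y by (simp add: cell_def)
  qed
  have "real_of_int i / 2 ^ g = real_of_int i * 2 ^ (n - g) / 2 ^ n" 
    "(real_of_int i + 1) / 2 ^ g = (real_of_int i + 1) * 2 ^ (n - g) / 2 ^ n" by (auto simp: e)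
  then show "seg n j \<subseteq> seg g i"
    using c1 c2 unfolding seg_def by (simp add: divide_right_mono)
qed

text \<open>Dyadic cells are nested or disjoint. Refining a cell therefore yields cells of
  \<open>A\<close> itself, for which bounds such as \<open>cellbd\<close> are already known.\<close>

lemma cell_cell_cases: 
  assumes "g \<le> n"
  shows "cell p (cell p A g i) n j = {} \<or> cell p (cell p A g i) n j = cell p A n j"
proof (cases "cell p (cell p A g i) n j = {}")
  case False
  then obtain x where "x \<in> cell p (cell p A g i) n j" by blast
  then have "x \<in> cell p A g i" "x \<in> cell p A n j" by (auto simp: cell_iff)
  then have "cell p A n j \<subseteq> cell p A g i" using cell_nested assms by blast
  then show ?thesis by (auto simp: cell_iff)
qed auto

lemma cell_decomp:
  fixes F :: "real \<Rightarrow> 'b::comm_monoid_add"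
  assumes "finite A"
  shows "(\<Sum>i\<in>(\<lambda>x. \<lfloor>p x * 2 ^ n\<rfloor>) ` A. \<Sum>x\<in>cell p A n i. F x) = (\<Sum>x\<in>A. F x)"
proof -
  have "cell p A n i = {x \<in> A. \<lfloor>p x * 2 ^ n\<rfloor> = i}" for i by (auto simp: cell_iff)
  then show ?thesis using sum.image_gen[OF assms, of F "\<lambda>x. \<lfloor>p x * 2 ^ n\<rfloor>"] by simp
qed

lemma card_cells:
  fixes p :: "real \<Rightarrow> real"
  assumes "\<And>x. x \<in> A \<Longrightarrow> of_int i \<le> p x * 2 ^ g \<and> p x * 2 ^ g < of_int i + 1" "g \<le> n"
  shows "card ((\<lambda>x. \<lfloor>p x * 2 ^ n\<rfloor>) ` A) \<le> 2 ^ (n - g)"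
proof -
  have "(\<lambda>x. \<lfloor>p x * 2 ^ n\<rfloor>) ` A \<subseteq> {i * 2 ^ (n - g) ..< (i + 1) * 2 ^ (n - g)}"
  proof
    fix j assume "j \<in> (\<lambda>x. \<lfloor>p x * 2 ^ n\<rfloor>) ` A"
    then obtain x where x: "x \<in> A" "j = \<lfloor>p x * 2 ^ n\<rfloor>" by auto
    have "x \<in> cell p A g i" "x \<in> cell p A n j" using assms x by (auto simp: cell_def)
    from cell_nested_index[OF this assms(2)] show "j \<in> {i * 2 ^ (n - g) ..< (i + 1) * 2 ^ (n - g)}" by auto
  qed
  then have "card ((\<lambda>x. \<lfloor>p x * 2 ^ n\<rfloor>) ` A) \<le> card {i * 2 ^ (n - g) ..< (i + 1) * 2 ^ (n - g)}"
    by (intro card_mono) auto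
  also have "\<dots> = 2 ^ (n - g)" by (simp add: algebra_simps nat_power_eq)
  finally show ?thesis .
qed

lemma expsum_empty [simp]: "expsum f {} \<theta> = 0" by (simp add: expsum_def)

lemma mom_empty: "0 < s \<Longrightarrow> mom f \<Theta> w s {} = 0" by (simp add: mom_def zero_power)

lemma mom_nonneg: "(\<And>\<theta>. 0 \<le> w \<theta>) \<Longrightarrow> 0 \<le> mom f \<Theta> w s B"
  by (auto simp: mom_def intro!: sum_nonneg)

lemma mix_nonneg: "(\<And>\<theta>. 0 \<le> w \<theta>) \<Longrightarrow> 0 \<le> mix f \<Theta> w a B b B'"
  by (auto simp: mix_def intro!: sum_nonneg)

lemma mix_mom: "mix f \<Theta> w a B b B' = mom f \<Theta> (\<lambda>\<theta>. w \<theta> * norm (expsum f B' \<theta>) ^ (2 * b)) a B"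
  by (auto simp: mix_def mom_def mult_ac)

lemma mix_zero: "mix f \<Theta> w a B 0 B' = mom f \<Theta> w a B" "mix f \<Theta> w 0 B' b B = mom f \<Theta> w b B"
  by (auto simp: mix_def mom_def)

lemma tri_pos: "0 < k \<Longrightarrow> 0 < tri k"
  by (cases k) (auto simp: tri_def)

lemma cellbd_cell:
  assumes "cellbd n s p A f \<Theta> w \<nu>" "g \<le> n" "0 < s"
  shows "cellbd n s p (cell p A g i) f \<Theta> w \<nu>"
  unfolding cellbd_def
proof (intro conjI allI)
  fix j show "mom f \<Theta> w s (cell p (cell p A g i) n j) \<le> (\<Sum>x\<in>cell p (cell p A g i) n j. \<nu> x) ^ s"
    using cell_cell_cases[OF assms(2), of p A i j] assms by (auto simp: cellbd_def mom_empty)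
qed (use assms in \<open>auto simp: cellbd_def\<close>)

lemma orth_subset: "orth k s T g p A f \<Theta> w \<Longrightarrow> B \<subseteq> A \<Longrightarrow> orth k s T g p B f \<Theta> w"
  unfolding orth_def by (simp add: subset_trans)

lemma sys_subset: "sys k C n q g p A f \<Theta> w \<Longrightarrow> B \<subseteq> A \<Longrightarrow> sys k C n q g p B f \<Theta> w"
  by (auto simp: sys_def intro: finite_subset orth_subset)

lemma expsum_cells:
  assumes "finite A"
  shows "expsum f A \<theta> = (\<Sum>i\<in>(\<lambda>x. \<lfloor>p x * 2 ^ n\<rfloor>) ` A. expsum f (cell p A n i) \<theta>)"
  unfolding expsum_def by (rule cell_decomp[symmetric, OF assms])

lemma norm_expsum_cells:
  assumes "finite A" "\<And>x. x \<in> A \<Longrightarrow> of_int i \<le> p x * 2 ^ g \<and> p x * 2 ^ g < of_int i + 1" "g \<le> n" "0 < s"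
  shows "norm (expsum f A \<theta>) ^ s
    \<le> 2 ^ ((n - g) * s) * (\<Sum>j\<in>(\<lambda>x. \<lfloor>p x * 2 ^ n\<rfloor>) ` A. norm (expsum f (cell p A n j) \<theta>) ^ s)"
proof -
  have "norm (expsum f A \<theta>) ^ s
    \<le> real (2 ^ (n - g)) ^ s * (\<Sum>j\<in>(\<lambda>x. \<lfloor>p x * 2 ^ n\<rfloor>) ` A. norm (expsum f (cell p A n j) \<theta>) ^ s)"
    unfolding expsum_cells[OF assms(1), of f \<theta> p n]
    using assms by (intro norm_sum_pow_le card_cells) auto
  then show ?thesis by (simp add: power_mult)
qed

text \<open>The triangle inequality over at most \<open>2 ^ n\<close> cells costs
  \<open>2 ^ (2 * n * tri k)\<close>. This is the exponent from which the iteration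
  descends.\<close>

lemma decoupling_trivial:
  assumes "0 < k"
  shows "decoupling TYPE('t) k (2 * tri k)"
proof -
  let ?s = "tri k"
  have s: "0 < ?s" using tri_pos assms by auto
  have "decoupled TYPE('t) k (2 * tri k) C 0" for C
    unfolding decoupled_def
  proof (intro allI impI)
    fix n q g p A \<Theta> w \<nu> and f :: "real \<Rightarrow> 't \<Rightarrow> complex"
    assume sy: "sys k C n q g p A f \<Theta> w" and bd: "cellbd n ?s p A f \<Theta> w \<nu>"
    let ?I = "(\<lambda>x. \<lfloor>p x * 2 ^ n\<rfloor>) ` A"
    have A: "finite A" and w: "\<And>\<theta>. 0 \<le> w \<theta>" and p: "\<And>x. x \<in> A \<Longrightarrow> 0 \<le> p x \<and> p x < 1"
      using sy by (auto simp: sys_def)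
    have "mom f \<Theta> w ?s A \<le> (\<Sum>\<theta>\<in>\<Theta>. w \<theta> * (2 ^ (n * (2 * ?s)) * (\<Sum>j\<in>?I. norm (expsum f (cell p A n j) \<theta>) ^ (2 * ?s))))"
      unfolding mom_def using norm_expsum_cells[OF A, of 0 p 0 n "2 * ?s" f] p s w
      by (intro sum_mono mult_left_mono) auto
    also have "\<dots> = 2 ^ (n * (2 * ?s)) * (\<Sum>j\<in>?I. mom f \<Theta> w ?s (cell p A n j))"
      unfolding mom_def sum_distrib_left sum_distrib_right
      by (subst sum.swap) (auto intro!: sum.cong simp: mult_ac)
    also have "\<dots> \<le> 2 ^ (n * (2 * ?s)) * (\<Sum>j\<in>?I. (\<Sum>x\<in>cell p A n j. \<nu> x) ^ ?s)"
      using bd by (intro mult_left_mono sum_mono) (auto simp: cellbd_def)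
    also have "\<dots> \<le> 2 ^ (n * (2 * ?s)) * (\<Sum>j\<in>?I. \<Sum>x\<in>cell p A n j. \<nu> x) ^ ?s"
      using bd A s by (intro mult_left_mono sum_pow_le sum_nonneg) (auto simp: cellbd_def)
    also have "\<dots> = 2 powr (0 + 2 * real ?s * real n) * (\<Sum>x\<in>A. \<nu> x) ^ ?s"
    proof -
      have "(2::real) ^ (n * (2 * ?s)) = 2 powr real (n * (2 * ?s))" by (rule powr_realpow[symmetric]) simp
      then show ?thesis by (simp add: cell_decomp[OF A] mult_ac)
    qed
    finally show "mom f \<Theta> w ?s A \<le> 2 powr (0 + real (2 * ?s) * real n) * (\<Sum>x\<in>A. \<nu> x) ^ ?s" by simp
  qed
  then show ?thesis unfolding decoupling_def by (metis order_refl)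
qed

section \<open>Dimension one: almost orthogonality\<close>

lemma Re_mult_cnj_le: "Re (a * cnj b) \<le> (norm a ^ 2 + norm b ^ 2) / 2"
proof -
  have "0 \<le> (Re a - Re b)\<^sup>2 + (Im a - Im b)\<^sup>2" by simp
  then show ?thesis unfolding cmod_power2 by (simp add: power2_eq_square algebra_simps)
qed

text \<open>Schur's test for a band matrix: each row meets at most \<open>2 * L + 1\<close>
  columns.\<close>

lemma sum_near_le:
  fixes m :: "int \<Rightarrow> real"
  assumes "finite I" "\<And>i. 0 \<le> m i"
  shows "(\<Sum>i\<in>I. \<Sum>j\<in>I. if \<bar>i - j\<bar> \<le> int L then (m i + m j) / 2 else 0) \<le> (2 * real L + 1) * (\<Sum>i\<in>I. m i)"
proof -
  have c: "(\<Sum>j\<in>I. if \<bar>i - j\<bar> \<le> int L then m i else 0) \<le> (2 * real L + 1) * m i" for i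
  proof -
    have "(\<Sum>j\<in>I. if \<bar>i - j\<bar> \<le> int L then m i else 0) = (\<Sum>j\<in>{j\<in>I. \<bar>i - j\<bar> \<le> int L}. m i)"
      using assms by (intro sum.mono_neutral_cong_right) auto
    also have "\<dots> = real (card {j\<in>I. \<bar>i - j\<bar> \<le> int L}) * m i" by simp
    also have "card {j\<in>I. \<bar>i - j\<bar> \<le> int L} \<le> card {i - int L .. i + int L}" by (intro card_mono) auto
    also have "card {i - int L .. i + int L} = 2 * L + 1" by simp
    finally show ?thesis using assms(2)[of i] by (simp add: mult_right_mono add.commute)
  qed
  have "(\<Sum>i\<in>I. \<Sum>j\<in>I. if \<bar>i - j\<bar> \<le> int L then (m i + m j) / 2 else 0)
      = (\<Sum>i\<in>I. \<Sum>j\<in>I. if \<bar>i - j\<bar> \<le> int L then m i else 0) / 2 + (\<Sum>i\<in>I. \<Sum>j\<in>I. if \<bar>i - j\<bar> \<le> int L then m j else 0) / 2"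
    unfolding sum_divide_distrib sum.distrib[symmetric] by (intro sum.cong refl) (auto simp: add_divide_distrib)
  also have "(\<Sum>i\<in>I. \<Sum>j\<in>I. if \<bar>i - j\<bar> \<le> int L then m j else 0) = (\<Sum>i\<in>I. \<Sum>j\<in>I. if \<bar>i - j\<bar> \<le> int L then m i else 0)"
    by (subst sum.swap) (auto intro!: sum.cong)
  also have "(\<Sum>i\<in>I. \<Sum>j\<in>I. if \<bar>i - j\<bar> \<le> int L then m i else 0) / 2 + (\<Sum>i\<in>I. \<Sum>j\<in>I. if \<bar>i - j\<bar> \<le> int L then m i else 0) / 2
      = (\<Sum>i\<in>I. \<Sum>j\<in>I. if \<bar>i - j\<bar> \<le> int L then m i else 0)" by simp
  also have "\<dots> \<le> (\<Sum>i\<in>I. (2 * real L + 1) * m i)" by (intro sum_mono c)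
  finally show ?thesis by (simp add: sum_distrib_left)
qed

text \<open>Since \<open>\<bar>q\<bar>\<close> is at least \<open>1 / C\<close>, the function
  \<open>g 0\<close> separates points, so only cells whose indices differ by a bounded amount are
  correlated. Hence there is no loss in \<open>n\<close>, and the exponent is exactly 0.\<close>

lemma decoupling_1: "decoupling TYPE('t) 1 0"
proof -
  have tri1: "tri (Suc 0) = 1" by (simp add: tri_def)
  have "\<exists>K\<ge>0. decoupled TYPE('t) 1 0 C K" if C: "C \<ge> 1" for C
  proof -
    \<comment> \<open>Correlated points satisfy
      \<open>\<bar>p x - p y\<bar> * 2 ^ n \<le> C * C\<close>, and rounding to cell indices adds
      less than 1.\<close>
    define L where "L = nat \<lceil>C * C\<rceil> + 1"
    have L: "C * C + 1 \<le> real L" by (simp add: L_def)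
    have "decoupled TYPE('t) 1 0 C (log 2 (2 * real L + 1))"
      unfolding decoupled_def
    proof (intro allI impI)
      fix n q g p A \<Theta> w \<nu> and f :: "real \<Rightarrow> 't \<Rightarrow> complex"
      assume sy: "sys 1 C n q g p A f \<Theta> w" and bd: "cellbd n (tri 1) p A f \<Theta> w \<nu>"
      let ?I = "(\<lambda>x. \<lfloor>p x * 2 ^ n\<rfloor>) ` A"
      let ?F = "\<lambda>i \<theta>. expsum f (cell p A n i) \<theta>"
      have A: "finite A" and w: "\<And>\<theta>. 0 \<le> w \<theta>" and p: "\<And>x. x \<in> A \<Longrightarrow> 0 \<le> p x \<and> p x < 1"
        and q: "\<And>x. 0 \<le> x \<Longrightarrow> x \<le> 1 \<Longrightarrow> 1 \<le> C * \<bar>q x\<bar>"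
        and g: "\<And>x. (g 0 has_real_derivative q x) (at x)"
        using sy by (auto simp: sys_def)
      have near: "\<bar>i - j\<bar> \<le> int L"
        if xy: "x \<in> cell p A n i" "y \<in> cell p A n j" and c: "corr f \<Theta> w [x] [y] \<noteq> 0" for i j x y
      proof -
        have xA: "x \<in> A" "y \<in> A" using xy by (auto simp: cell_def)
        have "orth 1 (tri 1) (C / 2 ^ n) g p A f \<Theta> w" using sy by (simp add: sys_def)
        from this[unfolded orth_def, rule_format, of "[x]" "[y]" 0]
        have gp: "\<bar>g 0 (p x) - g 0 (p y)\<bar> \<le> C / 2 ^ n"
          using c xA by (simp add: tri1 gap_def)
        have lb: "\<bar>a - b\<bar> \<le> C * \<bar>g 0 a - g 0 b\<bar>" if ab: "0 \<le> a" "a < b" "b \<le> 1" for a b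
        proof -
          obtain z where z: "a < z" "z < b" "g 0 b - g 0 a = (b - a) * q z"
            using MVT2[of a b "g 0" q] ab g by blast
          have "1 * \<bar>b - a\<bar> \<le> C * \<bar>q z\<bar> * \<bar>b - a\<bar>" using q[of z] z ab by (intro mult_right_mono) auto
          also have "\<dots> = C * \<bar>g 0 b - g 0 a\<bar>" by (simp add: z abs_mult)
          finally show ?thesis by (simp add: abs_minus_commute)
        qed
        have "\<bar>p x - p y\<bar> \<le> C * \<bar>g 0 (p x) - g 0 (p y)\<bar>"
          using lb[of "p x" "p y"] lb[of "p y" "p x"] p[OF xA(1)] p[OF xA(2)] C
          by (cases "p x" "p y" rule: linorder_cases) (auto simp: abs_minus_commute)
        also have "\<dots> \<le> C * (C / 2 ^ n)" using gp C by (intro mult_left_mono) auto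
        finally have "\<bar>p x - p y\<bar> * 2 ^ n \<le> C * C" by (simp add: field_simps)
        then have "\<bar>p x * 2 ^ n - p y * 2 ^ n\<bar> \<le> C * C" by (simp add: abs_mult flip: left_diff_distrib)
        moreover have "of_int i \<le> p x * 2 ^ n" "p x * 2 ^ n < of_int i + 1" "of_int j \<le> p y * 2 ^ n" "p y * 2 ^ n < of_int j + 1"
          using xy by (auto simp: cell_def)
        ultimately have "\<bar>real_of_int (i - j)\<bar> < real L + 1" using L by (auto simp: abs_le_iff)
        then show ?thesis by linarith
      qed
      have zero: "(\<Sum>\<theta>\<in>\<Theta>. of_real (w \<theta>) * (?F i \<theta> * cnj (?F j \<theta>))) = 0" if "\<not> \<bar>i - j\<bar> \<le> int L" for i j
      proof -
        have "(\<Sum>\<theta>\<in>\<Theta>. of_real (w \<theta>) * (?F i \<theta> * cnj (?F j \<theta>)))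
           = (\<Sum>\<theta>\<in>\<Theta>. \<Sum>x\<in>cell p A n i. \<Sum>y\<in>cell p A n j. of_real (w \<theta>) * (f x \<theta> * cnj (f y \<theta>)))"
          unfolding expsum_def cnj_sum sum_product unfolding sum_distrib_left by (rule refl)
        also have "\<dots> = (\<Sum>x\<in>cell p A n i. \<Sum>\<theta>\<in>\<Theta>. \<Sum>y\<in>cell p A n j. of_real (w \<theta>) * (f x \<theta> * cnj (f y \<theta>)))"
          by (rule sum.swap)
        also have "\<dots> = (\<Sum>x\<in>cell p A n i. \<Sum>y\<in>cell p A n j. corr f \<Theta> w [x] [y])"
          by (intro sum.cong refl, subst sum.swap) (simp add: corr_def)
        also have "\<dots> = 0" using near that by (intro sum.neutral ballI) blast
        finally show ?thesis .
      qed
      have sq: "of_real (norm z ^ 2) = z * cnj z" for z by (rule complex_norm_square)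
      have "complex_of_real (mom f \<Theta> w 1 A) = (\<Sum>\<theta>\<in>\<Theta>. of_real (w \<theta>) * (expsum f A \<theta> * cnj (expsum f A \<theta>)))"
        unfolding mom_def sq[symmetric] by simp
      also have "\<dots> = (\<Sum>\<theta>\<in>\<Theta>. \<Sum>i\<in>?I. \<Sum>j\<in>?I. of_real (w \<theta>) * (?F i \<theta> * cnj (?F j \<theta>)))"
        unfolding expsum_cells[OF A, of f _ p n] cnj_sum sum_product unfolding sum_distrib_left by (rule refl)
      also have "\<dots> = (\<Sum>i\<in>?I. \<Sum>\<theta>\<in>\<Theta>. \<Sum>j\<in>?I. of_real (w \<theta>) * (?F i \<theta> * cnj (?F j \<theta>)))"
        by (rule sum.swap)
      also have "\<dots> = (\<Sum>i\<in>?I. \<Sum>j\<in>?I. \<Sum>\<theta>\<in>\<Theta>. of_real (w \<theta>) * (?F i \<theta> * cnj (?F j \<theta>)))"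
        by (intro sum.cong refl, rule sum.swap)
      finally have "mom f \<Theta> w 1 A = Re (\<Sum>i\<in>?I. \<Sum>j\<in>?I. \<Sum>\<theta>\<in>\<Theta>. of_real (w \<theta>) * (?F i \<theta> * cnj (?F j \<theta>)))"
        by (metis Re_complex_of_real)
      also have "\<dots> = (\<Sum>i\<in>?I. \<Sum>j\<in>?I. Re (\<Sum>\<theta>\<in>\<Theta>. of_real (w \<theta>) * (?F i \<theta> * cnj (?F j \<theta>))))" by simp
      also have "\<dots> \<le> (\<Sum>i\<in>?I. \<Sum>j\<in>?I. if \<bar>i - j\<bar> \<le> int L then (mom f \<Theta> w 1 (cell p A n i) + mom f \<Theta> w 1 (cell p A n j)) / 2 else 0)"
      proof (intro sum_mono)
        fix i j
        have "Re (\<Sum>\<theta>\<in>\<Theta>. of_real (w \<theta>) * (?F i \<theta> * cnj (?F j \<theta>))) = (\<Sum>\<theta>\<in>\<Theta>. w \<theta> * Re (?F i \<theta> * cnj (?F j \<theta>)))"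
          by simp
        also have "\<dots> \<le> (\<Sum>\<theta>\<in>\<Theta>. w \<theta> * ((norm (?F i \<theta>) ^ 2 + norm (?F j \<theta>) ^ 2) / 2))"
          using w by (intro sum_mono mult_left_mono Re_mult_cnj_le)
        also have "\<dots> = (mom f \<Theta> w 1 (cell p A n i) + mom f \<Theta> w 1 (cell p A n j)) / 2"
          by (simp add: mom_def sum_divide_distrib distrib_left flip: sum.distrib)
        finally have le: "Re (\<Sum>\<theta>\<in>\<Theta>. of_real (w \<theta>) * (?F i \<theta> * cnj (?F j \<theta>)))
          \<le> (mom f \<Theta> w 1 (cell p A n i) + mom f \<Theta> w 1 (cell p A n j)) / 2" .
        show "Re (\<Sum>\<theta>\<in>\<Theta>. of_real (w \<theta>) * (?F i \<theta> * cnj (?F j \<theta>)))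
          \<le> (if \<bar>i - j\<bar> \<le> int L then (mom f \<Theta> w 1 (cell p A n i) + mom f \<Theta> w 1 (cell p A n j)) / 2 else 0)"
          using le zero[of i j] by (cases "\<bar>i - j\<bar> \<le> int L") (simp_all only: if_True if_False zero_complex.sel not_False_eq_True order_refl)
      qed
      also have "\<dots> \<le> (2 * real L + 1) * (\<Sum>i\<in>?I. mom f \<Theta> w 1 (cell p A n i))"
        using A w by (intro sum_near_le mom_nonneg) auto
      also have "\<dots> \<le> (2 * real L + 1) * (\<Sum>i\<in>?I. \<Sum>x\<in>cell p A n i. \<nu> x)"
        using bd by (intro mult_left_mono sum_mono) (auto simp: cellbd_def tri1)
      also have "\<dots> = (2 * real L + 1) * (\<Sum>x\<in>A. \<nu> x)" by (simp add: cell_decomp[OF A])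
      finally show "mom f \<Theta> w (tri 1) A \<le> 2 powr (log 2 (2 * real L + 1) + 0 * real n) * (\<Sum>x\<in>A. \<nu> x) ^ tri 1"
        by (simp add: tri1)
    qed
    moreover have "0 \<le> log 2 (2 * real L + 1)" by simp
    ultimately show ?thesis by blast
  qed
  then show ?thesis unfolding decoupling_def by blast
qed

section \<open>Rescaling and lower-dimensional decoupling\<close>

text \<open>The binomial combination with derivative \<open>q x * (x - b) ^ j\<close>. Moving the
  base point to \<open>b\<close> is thus a triangular linear change of coordinates, which keeps
  small gaps small.\<close>

definition recentre :: "(nat \<Rightarrow> real \<Rightarrow> real) \<Rightarrow> real \<Rightarrow> nat \<Rightarrow> real \<Rightarrow> real" where
  "recentre g b j x = (\<Sum>i\<le>j. of_nat (j choose i) * (- b) ^ (j - i) * g i x)"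

lemma recentre_deriv:
  assumes "\<And>i. i \<le> j \<Longrightarrow> (g i has_real_derivative q x * x ^ i) (at x)"
  shows "(recentre g b j has_real_derivative q x * (x - b) ^ j) (at x)"
proof -
  have "(recentre g b j has_real_derivative (\<Sum>i\<le>j. of_nat (j choose i) * (- b) ^ (j - i) * (q x * x ^ i))) (at x)"
    unfolding recentre_def using assms by (intro DERIV_sum DERIV_cmult) auto
  also have "(\<Sum>i\<le>j. of_nat (j choose i) * (- b) ^ (j - i) * (q x * x ^ i)) = q x * (x + - b) ^ j"
    unfolding binomial_ring sum_distrib_left by (intro sum.cong) (auto simp: mult_ac)
  finally show ?thesis by simp
qed

lemma sum_list_lincomb:
  fixes g :: "nat \<Rightarrow> real \<Rightarrow> real"
  shows "(\<Sum>x\<leftarrow>xs. \<Sum>i\<in>S. c i * g i (p x)) = (\<Sum>i\<in>S. c i * (\<Sum>x\<leftarrow>xs. g i (p x)))"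
  by (induction xs) (auto simp: sum.distrib distrib_left)

lemma gap_lincomb:
  assumes "\<And>x. G j x = (\<Sum>i\<in>S. c i * g i x)"
  shows "gap G p xs ys j = (\<Sum>i\<in>S. c i * gap g p xs ys i)"
  by (simp add: gap_def assms sum_list_lincomb right_diff_distrib sum_subtractf)

lemma binomial_comb_le:
  fixes t :: "nat \<Rightarrow> real"
  assumes "\<bar>b\<bar> \<le> 1" "\<And>i. i \<le> j \<Longrightarrow> \<bar>t i\<bar> \<le> T"
  shows "\<bar>\<Sum>i\<le>j. of_nat (j choose i) * b ^ (j - i) * t i\<bar> \<le> 2 ^ j * T"
proof -
  have "\<bar>\<Sum>i\<le>j. of_nat (j choose i) * b ^ (j - i) * t i\<bar> \<le> (\<Sum>i\<le>j. \<bar>of_nat (j choose i) * b ^ (j - i) * t i\<bar>)"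
    by (rule sum_abs)
  also have "\<dots> \<le> (\<Sum>i\<le>j. real (j choose i) * T)"
  proof (intro sum_mono)
    fix i assume i: "i \<in> {..j}"
    have "\<bar>b\<bar> ^ (j - i) * \<bar>t i\<bar> \<le> 1 * T"
      using i assms by (intro mult_mono power_le_one) auto
    then have "real (j choose i) * (\<bar>b\<bar> ^ (j - i) * \<bar>t i\<bar>) \<le> real (j choose i) * T" by (intro mult_left_mono) auto
    then show "\<bar>of_nat (j choose i) * b ^ (j - i) * t i\<bar> \<le> real (j choose i) * T"
      by (simp add: abs_mult power_abs mult_ac)
  qed
  also have "\<dots> = real (\<Sum>i\<le>j. j choose i) * T" by (simp add: sum_distrib_right)
  finally show ?thesis by (simp add: choose_row_sum)
qed

lemma gap_recentre_le:
  assumes "\<bar>b\<bar> \<le> 1" "\<And>i. i \<le> j \<Longrightarrow> \<bar>gap g p xs ys i\<bar> \<le> T"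
  shows "\<bar>gap (recentre g b) p xs ys j\<bar> \<le> 2 ^ j * T"
proof -
  have "gap (recentre g b) p xs ys j = (\<Sum>i\<le>j. (of_nat (j choose i) * (- b) ^ (j - i)) * gap g p xs ys i)"
    by (rule gap_lincomb) (simp add: recentre_def)
  then show ?thesis using binomial_comb_le[of "- b" j "gap g p xs ys" T] assms by simp
qed

text \<open>Affine rescaling of the moment curve: once recentred at the left end of a cell of length
  \<open>2 ^ -g\<close>, coordinate \<open>j\<close> scales with degree \<open>j + 1\<close>, and
  the new curve is of the same kind with density \<open>q\<close> read on that cell.\<close>

lemma rescale:
  fixes p :: "real \<Rightarrow> real"
  assumes i: "0 \<le> i" "i + 1 \<le> 2 ^ g" and gn: "g \<le> n" and C: "C \<ge> 1"
    and fin: "finite B" "finite \<Theta>" and w: "\<And>\<theta>. 0 \<le> w \<theta>"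
    and p: "\<And>x. x \<in> B \<Longrightarrow> of_int i \<le> p x * 2 ^ g \<and> p x * 2 ^ g < of_int i + 1"
    and q: "\<And>x. x \<in> seg g i \<Longrightarrow> 1 \<le> C * \<bar>q x\<bar> \<and> \<bar>q x\<bar> \<le> C"
    and G: "\<And>j x. j < k \<Longrightarrow> (G j has_real_derivative q x * x ^ j) (at x)"
    and orth: "orth k (tri k) (C / 2 ^ (n * k)) G p B f \<Theta> w"
  shows "sys k (2 ^ k * C) (n - g) (\<lambda>u. q ((of_int i + u) / 2 ^ g))
      (\<lambda>j u. 2 ^ (g * (j + 1)) * recentre G (of_int i / 2 ^ g) j ((of_int i + u) / 2 ^ g)) (\<lambda>x. p x * 2 ^ g - of_int i) B f \<Theta> w"
  unfolding sys_def
proof (intro conjI ballI allI impI)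
  let ?b = "real_of_int i / 2 ^ g"
  show "finite B" "finite \<Theta>" "\<And>\<theta>. 0 \<le> w \<theta>" by (fact fin w)+
  show "0 \<le> p x * 2 ^ g - of_int i" "p x * 2 ^ g - of_int i < 1" if "x \<in> B" for x using p[OF that] by auto
  have C2: "C \<le> 2 ^ k * C" using C by (simp add: mult_le_cancel_right1)
  fix u :: real assume u: "u \<in> {0..1}"
  then have "(of_int i + u) / 2 ^ g \<in> seg g i" by (auto simp: seg_def divide_right_mono)
  note q[OF this]
  moreover from this have "C * \<bar>q ((of_int i + u) / 2 ^ g)\<bar> \<le> 2 ^ k * C * \<bar>q ((of_int i + u) / 2 ^ g)\<bar>"
    using C2 by (intro mult_right_mono) auto
  ultimately show "1 \<le> 2 ^ k * C * \<bar>q ((of_int i + u) / 2 ^ g)\<bar>" "\<bar>q ((of_int i + u) / 2 ^ g)\<bar> \<le> 2 ^ k * C"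
    using C2 by linarith+
next
  let ?b = "real_of_int i / 2 ^ g"
  fix j x assume j: "j < k"
  have "((\<lambda>u. recentre G ?b j ((of_int i + u) / 2 ^ g)) has_real_derivative
      q ((of_int i + x) / 2 ^ g) * ((of_int i + x) / 2 ^ g - ?b) ^ j * (1 / 2 ^ g)) (at x)"
    using G j by (intro DERIV_chain2[OF recentre_deriv]) (auto intro!: derivative_eq_intros)
  then have "((\<lambda>u. 2 ^ (g * (j + 1)) * recentre G ?b j ((of_int i + u) / 2 ^ g)) has_real_derivative
      2 ^ (g * (j + 1)) * (q ((of_int i + x) / 2 ^ g) * ((of_int i + x) / 2 ^ g - ?b) ^ j * (1 / 2 ^ g))) (at x)"
    by (rule DERIV_cmult)
  also have "2 ^ (g * (j + 1)) * (q ((of_int i + x) / 2 ^ g) * ((of_int i + x) / 2 ^ g - ?b) ^ j * (1 / 2 ^ g))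
     = q ((of_int i + x) / 2 ^ g) * x ^ j"
    by (simp add: add_divide_distrib power_divide power_add flip: power_mult)
  finally show "((\<lambda>u. 2 ^ (g * (j + 1)) * recentre G ?b j ((of_int i + u) / 2 ^ g)) has_real_derivative
      q ((of_int i + x) / 2 ^ g) * x ^ j) (at x)" .
next
  let ?b = "real_of_int i / 2 ^ g"
  have "real_of_int i \<le> 2 ^ g"
  proof -
    have "i \<le> 2 ^ g" using i by linarith
    then have "real_of_int i \<le> of_int (2 ^ g)" by (simp only: of_int_le_iff)
    then show ?thesis by simp
  qed
  then have b: "\<bar>?b\<bar> \<le> 1" using i by (simp add: divide_le_eq_1)
  have eq: "gap (\<lambda>j u. 2 ^ (g * (j + 1)) * recentre G ?b j ((of_int i + u) / 2 ^ g)) (\<lambda>x. p x * 2 ^ g - of_int i) xs ys j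
     = 2 ^ (g * (j + 1)) * gap (recentre G ?b) p xs ys j" for xs ys j
    by (simp add: gap_def sum_list_const_mult right_diff_distrib)
  show "orth k (tri k) (2 ^ k * C / 2 ^ ((n - g) * k))
     (\<lambda>j u. 2 ^ (g * (j + 1)) * recentre G ?b j ((of_int i + u) / 2 ^ g)) (\<lambda>x. p x * 2 ^ g - of_int i) B f \<Theta> w"
    unfolding orth_def eq
  proof (intro allI impI)
    fix xs ys j assume h: "set xs \<subseteq> B" "set ys \<subseteq> B" "length xs = tri k" "length ys = tri k"
      "corr f \<Theta> w xs ys \<noteq> 0" and j: "j < k"
    have "\<bar>gap (recentre G ?b) p xs ys j\<bar> \<le> 2 ^ j * (C / 2 ^ (n * k))"
      using orth h j b unfolding orth_def by (intro gap_recentre_le) auto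
    then have "2 ^ (g * (j + 1)) * \<bar>gap (recentre G ?b) p xs ys j\<bar> \<le> 2 ^ (g * (j + 1)) * (2 ^ j * (C / 2 ^ (n * k)))"
      by (intro mult_left_mono) auto
    then have "\<bar>2 ^ (g * (j + 1)) * gap (recentre G ?b) p xs ys j\<bar> \<le> 2 ^ (g * (j + 1)) * (2 ^ j * (C / 2 ^ (n * k)))"
      by (simp only: abs_mult abs_numeral power_abs)
    \<comment> \<open>The top coordinate is stretched most, by \<open>2 ^ (g * k)\<close>, which
      turns the tolerance of scale \<open>n\<close> into that of scale \<open>n - g\<close>. The
      factor \<open>2 ^ j\<close> is the cost of recentring.\<close>
    also have "\<dots> \<le> 2 ^ (g * k) * (2 ^ k * (C / 2 ^ (n * k)))"
      using j C by (intro mult_mono power_increasing mult_le_mono2) auto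
    also have "\<dots> = 2 ^ k * C / 2 ^ ((n - g) * k)"
    proof -
      have "(2::real) ^ (n * k) = 2 ^ (g * k) * 2 ^ ((n - g) * k)"
        using gn by (simp flip: power_add add: add_mult_distrib[symmetric])
      then show ?thesis by simp
    qed
    finally show "\<bar>2 ^ (g * (j + 1)) * gap (recentre G ?b) p xs ys j\<bar> \<le> 2 ^ k * C / 2 ^ ((n - g) * k)" .
  qed
qed

lemma cell_rescale:
  fixes p :: "real \<Rightarrow> real"
  assumes "g \<le> n"
  shows "cell (\<lambda>x. p x * 2 ^ g - of_int i) B (n - g) j = cell p B n (j + i * 2 ^ (n - g))"
proof -
  have "(2::real) ^ n = 2 ^ g * 2 ^ (n - g)" using assms by (simp flip: power_add)
  then have "(p x * 2 ^ g - of_int i) * 2 ^ (n - g) = p x * 2 ^ n - of_int (i * 2 ^ (n - g))" for x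
    by (simp add: left_diff_distrib)
  then show ?thesis by (auto simp: cell_def)
qed

lemma cellbd_rescale:
  assumes "g \<le> n" "cellbd n s p B f \<Theta> w \<nu>"
  shows "cellbd (n - g) s (\<lambda>x. p x * 2 ^ g - of_int i) B f \<Theta> w \<nu>"
  using assms(2) by (simp add: cellbd_def cell_rescale[OF assms(1)])

lemma nonempty_cell_index:
  assumes "sys k C n q G p A f \<Theta> w" "x \<in> cell p A e m"
  shows "0 \<le> m" "m + 1 \<le> 2 ^ e" "seg e m \<subseteq> {0..1}"
proof -
  have x': "x \<in> cell p A 0 0" using assms by (auto simp: cell_def sys_def)
  from cell_nested_index[OF x' assms(2)] cell_nested(2)[OF _ x' assms(2)]
  show "0 \<le> m" "m + 1 \<le> 2 ^ e" "seg e m \<subseteq> {0..1}" by (auto simp: seg_def)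
qed

lemma sys_cell:
  assumes sy: "sys k C n q G p A f \<Theta> w" and C: "C \<ge> 1" and h: "h \<le> n" and ne: "cell p A h i \<noteq> {}"
  obtains q' G' where "sys k (2 ^ k * C) (n - h) q' G' (\<lambda>x. p x * 2 ^ h - of_int i) (cell p A h i) f \<Theta> w"
proof -
  obtain x where x: "x \<in> cell p A h i" using ne by blast
  note ix = nonempty_cell_index[OF sy x]
  have S: "finite A" "finite \<Theta>" "\<And>\<theta>. 0 \<le> w \<theta>" "\<And>x. x \<in> {0..1} \<Longrightarrow> 1 \<le> C * \<bar>q x\<bar> \<and> \<bar>q x\<bar> \<le> C"
    "\<And>j x. j < k \<Longrightarrow> (G j has_real_derivative q x * x ^ j) (at x)"
    "orth k (tri k) (C / 2 ^ (n * k)) G p A f \<Theta> w"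
    using sy by (auto simp: sys_def)
  show ?thesis
    by (rule that, rule rescale[OF ix(1,2) h C finite_cell[OF S(1)] S(2,3) _ _ S(5) orth_subset[OF S(6) cell_subset]])
      (use S(4) ix(3) in \<open>auto simp: cell_def\<close>)
qed

text \<open>The hypotheses are local to \<open>seg g i\<close> instead of \<open>sys\<close> because
  of the density \<open>q x * (x - b) ^ (k - l)\<close> in \<open>lower_dim\<close>: it vanishes at
  \<open>b\<close>, so it is bounded below on a separated cell but not on all of
  \<open>[0, 1]\<close>.\<close>

lemma decoupled_rescale:
  fixes p :: "real \<Rightarrow> real"
  assumes dec: "decoupled TYPE('t) k \<eta> (2 ^ k * C) K"
    and i: "0 \<le> i" "i + 1 \<le> 2 ^ g" and gn: "g \<le> n" and C: "C \<ge> 1"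
    and fin: "finite B" "finite \<Theta>" and w: "\<And>\<theta>. 0 \<le> w \<theta>"
    and p: "\<And>x. x \<in> B \<Longrightarrow> of_int i \<le> p x * 2 ^ g \<and> p x * 2 ^ g < of_int i + 1"
    and q: "\<And>x. x \<in> seg g i \<Longrightarrow> 1 \<le> C * \<bar>q x\<bar> \<and> \<bar>q x\<bar> \<le> C"
    and G: "\<And>j x. j < k \<Longrightarrow> (G j has_real_derivative q x * x ^ j) (at x)"
    and orth: "orth k (tri k) (C / 2 ^ (n * k)) G p B (f :: real \<Rightarrow> 't \<Rightarrow> complex) \<Theta> w"
    and bd: "cellbd n (tri k) p B f \<Theta> w \<nu>"
  shows "mom f \<Theta> w (tri k) B \<le> 2 powr (K + \<eta> * real (n - g)) * (\<Sum>x\<in>B. \<nu> x) ^ tri k"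
  by (rule decoupledD[OF dec rescale[OF i gn C fin w p q G orth] cellbd_rescale[OF gn bd]])

text \<open>Expanding the \<open>2 * r\<close>-th power turns the weight into additional variables.
  A nonzero weighted correlation therefore forces a nonzero correlation of some extended tuples, to
  which the original \<open>orth\<close> applies.\<close>

lemma corr_weighted:
  assumes "finite J"
  shows "corr f \<Theta> (\<lambda>\<theta>. w \<theta> * norm (expsum f J \<theta>) ^ (2 * r)) xs xs'
    = (\<Sum>ys | set ys \<subseteq> J \<and> length ys = r. \<Sum>ys' | set ys' \<subseteq> J \<and> length ys' = r. corr f \<Theta> w (xs @ ys) (xs' @ ys'))"
proof -
  let ?Y = "{ys. set ys \<subseteq> J \<and> length ys = r}"
  have e: "of_real (norm (expsum f J \<theta>) ^ (2 * r))
      = (\<Sum>ys\<in>?Y. \<Sum>ys'\<in>?Y. (\<Prod>y\<leftarrow>ys. f y \<theta>) * cnj (\<Prod>y\<leftarrow>ys'. f y \<theta>))" for \<theta>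
  proof -
    have "of_real (norm (expsum f J \<theta>) ^ (2 * r)) = (expsum f J \<theta> * cnj (expsum f J \<theta>)) ^ r"
      by (simp add: power_mult flip: complex_norm_square)
    also have "\<dots> = expsum f J \<theta> ^ r * cnj (expsum f J \<theta> ^ r)" by (simp add: power_mult_distrib)
    also have "\<dots> = (\<Sum>ys\<in>?Y. \<Prod>y\<leftarrow>ys. f y \<theta>) * cnj (\<Sum>ys\<in>?Y. \<Prod>y\<leftarrow>ys. f y \<theta>)"
      unfolding expsum_def sum_pow_lists[OF assms] by (rule refl)
    finally show ?thesis unfolding cnj_sum sum_product .
  qed
  have "corr f \<Theta> (\<lambda>\<theta>. w \<theta> * norm (expsum f J \<theta>) ^ (2 * r)) xs xs'
     = (\<Sum>\<theta>\<in>\<Theta>. \<Sum>ys\<in>?Y. \<Sum>ys'\<in>?Y. of_real (w \<theta>) * ((\<Prod>x\<leftarrow>xs@ys. f x \<theta>) * cnj (\<Prod>y\<leftarrow>xs'@ys'. f y \<theta>)))"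
    unfolding corr_def of_real_mult e sum_distrib_left sum_distrib_right
    by (intro sum.cong refl) (simp add: mult_ac)
  also have "\<dots> = (\<Sum>ys\<in>?Y. \<Sum>\<theta>\<in>\<Theta>. \<Sum>ys'\<in>?Y. of_real (w \<theta>) * ((\<Prod>x\<leftarrow>xs@ys. f x \<theta>) * cnj (\<Prod>y\<leftarrow>xs'@ys'. f y \<theta>)))"
    by (rule sum.swap)
  also have "\<dots> = (\<Sum>ys\<in>?Y. \<Sum>ys'\<in>?Y. corr f \<Theta> w (xs @ ys) (xs' @ ys'))"
    unfolding corr_def by (intro sum.cong refl, rule sum.swap)
  finally show ?thesis .
qed

lemma sum_list_abs_le:
  fixes t :: "real \<Rightarrow> real"
  assumes "\<And>y. y \<in> set ys \<Longrightarrow> \<bar>t y - c\<bar> \<le> M"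
  shows "\<bar>(\<Sum>y\<leftarrow>ys. t y) - real (length ys) * c\<bar> \<le> real (length ys) * M"
  using assms
proof (induction ys)
  case (Cons y ys)
  have "\<bar>t y - c\<bar> \<le> M" "\<bar>(\<Sum>y\<leftarrow>ys. t y) - real (length ys) * c\<bar> \<le> real (length ys) * M"
    using Cons by auto
  then show ?case by (simp add: distrib_right)
qed simp

lemma gap_append:
  "gap g p (xs @ ys) (xs' @ ys') j = gap g p xs xs' j + gap g p ys ys' j"
  by (simp add: gap_def)

lemma tri_mono: "l \<le> k \<Longrightarrow> tri l \<le> tri k"
  unfolding tri_def by (intro div_le_mono mult_le_mono) auto

lemma tri_Suc: "tri (Suc k) = tri k + Suc k"
proof -
  have "Suc k * (Suc k + 1) = k * (k + 1) + Suc k * 2" by simp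
  then show ?thesis unfolding tri_def by (metis div_mult_self1 add.commute zero_neq_numeral)
qed

lemma tri_less: "l < k \<Longrightarrow> tri l < tri k"
  using tri_mono[of "Suc l" k] by (simp add: tri_Suc)

text \<open>
  Recentred at \<open>b\<close>, the frequencies from the cell of length \<open>2 ^ -h\<close> lie in a box with sides
  \<open>2 ^ -(h * (j + 1))\<close>. Weighting by its exponential sum therefore leaves a system of the top \<open>l\<close>
  coordinates with tolerance \<open>2 ^ -(h * (k - l + 1)) = 2 ^ -(l * g')\<close>, which is the
  tolerance of \<open>l\<close>-dimensional decoupling down to scale \<open>g'\<close>.
\<close>

lemma lower_dim:
  fixes p :: "real \<Rightarrow> real" and f :: "real \<Rightarrow> 't \<Rightarrow> complex"
  assumes sy: "sys k C n q G p A f \<Theta> w" and C: "C \<ge> 1" and l: "0 < l" "l < k" and \<kappa>: "0 < \<kappa>" "\<kappa> \<le> 1"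
    and D: "D = 2 ^ l * (2 ^ k + 2 * real (tri k)) * C / \<kappa> ^ k"
    and dec: "decoupled TYPE('t) l \<epsilon> (2 ^ l * D) K"
    and g': "l * g' = h * (k - l + 1)" and gg: "g \<le> g'" and hn: "h \<le> n"
    and sep: "\<And>x y. x \<in> seg g i \<Longrightarrow> y \<in> seg h i' \<Longrightarrow> \<kappa> \<le> \<bar>x - y\<bar>"
    and \<nu>: "\<And>x. 0 \<le> \<nu> x"
    and bd: "\<And>j. mix f \<Theta> w (tri l) (cell p (cell p A g i) g' j) (tri k - tri l) (cell p A h i')
      \<le> (\<Sum>x\<in>cell p (cell p A g i) g' j. \<nu> x) ^ tri l"
  shows "mix f \<Theta> w (tri l) (cell p A g i) (tri k - tri l) (cell p A h i')
     \<le> 2 powr (K + \<epsilon> * real (g' - g)) * (\<Sum>x\<in>cell p A g i. \<nu> x) ^ tri l"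
proof (cases "cell p A g i = {} \<or> cell p A h i' = {}")
  case True
  have "0 < tri l" "0 < tri k - tri l" using l tri_pos tri_less by auto
  then have "mix f \<Theta> w (tri l) (cell p A g i) (tri k - tri l) (cell p A h i') = 0"
    using True by (auto simp: mix_def zero_power)
  then show ?thesis using \<nu> by (simp add: sum_nonneg)
next
  case False
  then obtain x0 y0 where x0: "x0 \<in> cell p A g i" and y0: "y0 \<in> cell p A h i'" by blast
  let ?r = "tri k - tri l" and ?b = "real_of_int i' / 2 ^ h" and ?J = "cell p A h i'"
  let ?w = "\<lambda>\<theta>. w \<theta> * norm (expsum f ?J \<theta>) ^ (2 * ?r)"
  let ?q = "\<lambda>x. q x * (x - ?b) ^ (k - l)"
  \<comment> \<open>Coordinates \<open>k - l + m\<close> of the recentred curve,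
    \<open>m < l\<close>, have derivative \<open>?q x * (x - ?b) ^ m\<close>. The inverse binomial
    shift restores \<open>x ^ j\<close>, the form required for the density
    \<open>?q\<close>.\<close>
  let ?G = "\<lambda>j x. \<Sum>m\<le>j. of_nat (j choose m) * ?b ^ (j - m) * recentre G ?b (k - l + m) x"
  have A: "finite A" "finite \<Theta>" and w: "\<And>\<theta>. 0 \<le> w \<theta>" and p: "\<And>x. x \<in> A \<Longrightarrow> 0 \<le> p x \<and> p x < 1"
    and q: "\<And>x. x \<in> {0..1} \<Longrightarrow> 1 \<le> C * \<bar>q x\<bar> \<and> \<bar>q x\<bar> \<le> C"
    and G: "\<And>j x. j < k \<Longrightarrow> (G j has_real_derivative q x * x ^ j) (at x)"
    and ort: "orth k (tri k) (C / 2 ^ (n * k)) G p A f \<Theta> w"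
    using sy by (auto simp: sys_def)
  note i = nonempty_cell_index[OF sy x0] and i' = nonempty_cell_index[OF sy y0]
  have b: "0 \<le> ?b" "?b \<le> 1" "?b \<in> seg h i'"
  proof -
    show bs: "?b \<in> seg h i'" by (simp add: seg_def divide_right_mono)
    then show "0 \<le> ?b" "?b \<le> 1" using i' by auto
  qed
  have babs: "\<bar>?b\<bar> \<le> 1" using b(1,2) by linarith
  have \<kappa>k: "\<kappa> ^ k \<le> \<kappa> ^ (k - l)" using \<kappa> by (intro power_decreasing) auto
  have one: "1 \<le> (2::real) ^ l * (2 ^ k + 2 * real (tri k))"
  proof -
    have "1 * 1 \<le> (2::real) ^ l * (2 ^ k + 2 * real (tri k))"
      by (intro mult_mono) (auto intro: add_increasing2)
    then show ?thesis by simp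
  qed
  \<comment> \<open>In \<open>D\<close>, the division by \<open>\<kappa> ^ k\<close> accounts for
    the lower bound on the new density, \<open>2 ^ k\<close> for recentring,
    \<open>2 * tri k\<close> for the extra variables from the cell at \<open>?b\<close>, and
    \<open>2 ^ l\<close> for shifting back.\<close>
  have D1: "C / \<kappa> ^ k \<le> D"
    using one C \<kappa> by (simp add: D divide_right_mono mult_le_cancel_right1)
  have D2: "C \<le> C / \<kappa> ^ k" using \<kappa> C by (simp add: le_divide_eq power_le_one mult_left_le)
  have D3: "2 ^ l * (2 ^ k + 2 * real (tri k)) * C \<le> D"
  proof -
    have "0 \<le> 2 ^ l * (2 ^ k + 2 * real (tri k)) * C" using one C by simp
    then show ?thesis using \<kappa> by (simp add: D le_divide_eq power_le_one mult_left_le)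
  qed
  have qq: "1 \<le> D * \<bar>?q x\<bar> \<and> \<bar>?q x\<bar> \<le> D" if x: "x \<in> seg g i" for x
  proof
    have x1: "x \<in> {0..1}" using x i by auto
    have xb: "\<kappa> \<le> \<bar>x - ?b\<bar>" "\<bar>x - ?b\<bar> \<le> 1" using sep[OF x b(3)] x1 b(1,2) unfolding atLeastAtMost_iff by linarith+
    have "\<kappa> ^ (k - l) \<le> \<bar>x - ?b\<bar> ^ (k - l)" using xb \<kappa> by (intro power_mono) auto
    then have k1: "\<kappa> ^ k \<le> \<bar>x - ?b\<bar> ^ (k - l)" using \<kappa>k by linarith
    have "1 \<le> C * \<bar>q x\<bar>" using q[OF x1] by simp
    also have "\<dots> \<le> (D * \<kappa> ^ k) * \<bar>q x\<bar>"
      using D1 \<kappa> by (intro mult_right_mono) (auto simp: divide_le_eq)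
    also have "\<dots> \<le> D * \<bar>x - ?b\<bar> ^ (k - l) * \<bar>q x\<bar>"
      using k1 D1 D2 C by (intro mult_right_mono mult_left_mono) auto
    finally show "1 \<le> D * \<bar>?q x\<bar>" by (simp add: abs_mult power_abs mult_ac)
    have "\<bar>q x\<bar> * \<bar>x - ?b\<bar> ^ (k - l) \<le> C * 1"
      using q[OF x1] xb C by (intro mult_mono power_le_one) auto
    then show "\<bar>?q x\<bar> \<le> D" using D1 D2 by (simp add: abs_mult power_abs)
  qed
  have dG: "(?G j has_real_derivative ?q x * x ^ j) (at x)" if j: "j < l" for j x
  proof -
    have "(?G j has_real_derivative (\<Sum>m\<le>j. of_nat (j choose m) * ?b ^ (j - m) * (q x * (x - ?b) ^ (k - l + m)))) (at x)"
      using j l by (intro DERIV_sum DERIV_cmult recentre_deriv G) auto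
    also have "(\<Sum>m\<le>j. of_nat (j choose m) * ?b ^ (j - m) * (q x * (x - ?b) ^ (k - l + m)))
       = ?q x * ((x - ?b) + ?b) ^ j"
      unfolding binomial_ring[of "x - ?b"] sum_distrib_left by (intro sum.cong) (auto simp: mult_ac power_add)
    finally show ?thesis by simp
  qed
  have loc: "\<bar>gap (recentre G ?b) p ys ys' j\<bar> \<le> 2 * real ?r * (C / 2 ^ (h * (j + 1)))"
    if ys: "set ys \<subseteq> ?J" "set ys' \<subseteq> ?J" "length ys = ?r" "length ys' = ?r" and j: "j < k" for ys ys' j
  proof -
    let ?c = "recentre G ?b j ?b" and ?M = "C / 2 ^ (h * (j + 1))"
    have pt: "\<bar>recentre G ?b j (p y) - ?c\<bar> \<le> ?M" if y: "y \<in> ?J" for y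
    proof -
      have py: "p y \<in> seg h i'" by (rule cell_seg[OF y])
      have dist: "\<bar>z - ?b\<bar> \<le> 1 / 2 ^ h" if "z \<in> seg h i'" for z
        using that by (auto simp: seg_def add_divide_distrib)
      have "norm (recentre G ?b j (p y) - recentre G ?b j ?b) \<le> (C * (1 / 2 ^ h) ^ j) * norm (p y - ?b)"
      proof (rule field_differentiable_bound[where S = "seg h i'" and f' = "\<lambda>z. q z * (z - ?b) ^ j"])
        show "convex (seg h i')" by (simp add: seg_def)
        show "(recentre G ?b j has_real_derivative q z * (z - ?b) ^ j) (at z within seg h i')" for z
          by (rule has_field_derivative_at_within, rule recentre_deriv, rule G) (use j in auto)
        show "norm (q z * (z - ?b) ^ j) \<le> C * (1 / 2 ^ h) ^ j" if z: "z \<in> seg h i'" for z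
        proof -
          have "z \<in> {0..1}" using z i' by auto
          then have "\<bar>q z\<bar> * \<bar>z - ?b\<bar> ^ j \<le> C * (1 / 2 ^ h) ^ j"
            using q dist[OF z] C by (intro mult_mono power_mono) auto
          then show ?thesis by (simp add: abs_mult power_abs)
        qed
      qed (fact py b)+
      also have "\<dots> \<le> (C * (1 / 2 ^ h) ^ j) * (1 / 2 ^ h)" using dist[OF py] C by (intro mult_left_mono) auto
      also have "\<dots> = ?M" by (simp add: power_divide power_add flip: power_mult)
      finally show ?thesis by simp
    qed
    have "\<bar>(\<Sum>y\<leftarrow>ys. recentre G ?b j (p y)) - real (length ys) * ?c\<bar> \<le> real (length ys) * ?M"
      using ys pt by (intro sum_list_abs_le) auto
    moreover have "\<bar>(\<Sum>y\<leftarrow>ys'. recentre G ?b j (p y)) - real (length ys') * ?c\<bar> \<le> real (length ys') * ?M"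
      using ys pt by (intro sum_list_abs_le) auto
    ultimately show ?thesis unfolding gap_def ys(3,4) mult.assoc[of 2] by linarith
  qed
  have ort': "orth l (tri l) (D / 2 ^ (g' * l)) ?G p (cell p A g i) f \<Theta> ?w"
    unfolding orth_def
  proof (intro allI impI)
    fix xs xs' j
    assume xs: "set xs \<subseteq> cell p A g i" "set xs' \<subseteq> cell p A g i" "length xs = tri l" "length xs' = tri l"
      and c: "corr f \<Theta> ?w xs xs' \<noteq> 0" and j: "j < l"
    from c[unfolded corr_weighted[OF finite_cell[OF A(1)]]]
    obtain ys where "ys \<in> {ys. set ys \<subseteq> ?J \<and> length ys = ?r}"
      "(\<Sum>ys' | set ys' \<subseteq> ?J \<and> length ys' = ?r. corr f \<Theta> w (xs @ ys) (xs' @ ys')) \<noteq> 0"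
      by (rule sum.not_neutral_contains_not_neutral)
    moreover from this(2) obtain ys' where "ys' \<in> {ys. set ys \<subseteq> ?J \<and> length ys = ?r}"
      "corr f \<Theta> w (xs @ ys) (xs' @ ys') \<noteq> 0"
      by (rule sum.not_neutral_contains_not_neutral)
    ultimately have ys: "set ys \<subseteq> ?J" "set ys' \<subseteq> ?J" "length ys = ?r" "length ys' = ?r"
      and cc: "corr f \<Theta> w (xs @ ys) (xs' @ ys') \<noteq> 0" by auto
    have le: "tri l \<le> tri k" using l tri_mono by simp
    have sub: "set (xs @ ys) \<subseteq> A" "set (xs' @ ys') \<subseteq> A"
      using xs(1,2) ys(1,2) cell_subset[of p A g i] cell_subset[of p A h i'] unfolding set_append by blast+
    have full: "\<bar>gap G p (xs @ ys) (xs' @ ys') m\<bar> \<le> C / 2 ^ (n * k)" if "m < k" for m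
      using ort[unfolded orth_def, rule_format, OF sub _ _ cc that] xs(3,4) ys(3,4) le by simp
    \<comment> \<open>The gap of \<open>xs\<close> and \<open>xs'\<close> is that of the extended
      tuples minus that of the \<open>ys\<close>. The latter is within tolerance because
      \<open>m \<ge> k - l\<close>; this is why only the top \<open>l\<close> coordinates are
      kept.\<close>
    have mid: "\<bar>gap (recentre G ?b) p xs xs' m\<bar> \<le> (2 ^ k + 2 * real (tri k)) * C / 2 ^ (g' * l)"
      if m: "k - l \<le> m" "m < k" for m
    proof -
      have "h * (k - l + 1) \<le> n * k" using hn l by (intro mult_le_mono) auto
      then have n1: "g' * l \<le> n * k" using g' by (simp add: mult.commute)
      have n2: "g' * l \<le> h * (m + 1)" using g' m(1) by (metis mult.commute mult_le_mono2 add_le_mono1)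
      have "\<bar>gap (recentre G ?b) p (xs @ ys) (xs' @ ys') m\<bar> \<le> 2 ^ m * (C / 2 ^ (n * k))"
        by (rule gap_recentre_le[OF babs full]) (use m in auto)
      moreover have "2 ^ m * (C / 2 ^ (n * k)) \<le> 2 ^ k * (C / 2 ^ (g' * l))"
        by (rule mult_mono, rule power_increasing, use m in simp, simp, rule divide_left_mono[OF power_increasing[OF n1]])
          (use C in auto)
      moreover have "2 * real ?r * (C / 2 ^ (h * (m + 1))) \<le> 2 * real (tri k) * (C / 2 ^ (g' * l))"
        by (rule mult_mono, simp, rule divide_left_mono[OF power_increasing[OF n2]]) (use C in auto)
      ultimately have "\<bar>gap (recentre G ?b) p xs xs' m\<bar> \<le> 2 ^ k * (C / 2 ^ (g' * l)) + 2 * real (tri k) * (C / 2 ^ (g' * l))"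
        using loc[OF ys m(2)] unfolding gap_append by linarith
      then show ?thesis by (simp add: distrib_right add_divide_distrib)
    qed
    have "gap ?G p xs xs' j = (\<Sum>m\<le>j. (of_nat (j choose m) * ?b ^ (j - m)) * gap (\<lambda>m. recentre G ?b (k - l + m)) p xs xs' m)"
      by (rule gap_lincomb) simp
    also have "\<bar>\<dots>\<bar> \<le> 2 ^ j * ((2 ^ k + 2 * real (tri k)) * C / 2 ^ (g' * l))"
    proof (rule binomial_comb_le)
      show "\<bar>?b\<bar> \<le> 1" by (rule babs)
      fix m assume "m \<le> j"
      then show "\<bar>gap (\<lambda>m. recentre G ?b (k - l + m)) p xs xs' m\<bar> \<le> (2 ^ k + 2 * real (tri k)) * C / 2 ^ (g' * l)"
        using mid[of "k - l + m"] j l by (simp add: gap_def)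
    qed
    also have "\<dots> \<le> 2 ^ l * ((2 ^ k + 2 * real (tri k)) * C / 2 ^ (g' * l))"
      using j C by (intro mult_right_mono power_increasing) auto
    also have "\<dots> \<le> D / 2 ^ (g' * l)" using D3 by (simp add: divide_right_mono mult_ac)
    finally show "\<bar>gap ?G p xs xs' j\<bar> \<le> D / 2 ^ (g' * l)" .
  qed
  have "D \<ge> 1" using D1 D2 C by linarith
  have "mom f \<Theta> ?w (tri l) (cell p A g i) \<le> 2 powr (K + \<epsilon> * real (g' - g)) * (\<Sum>x\<in>cell p A g i. \<nu> x) ^ tri l"
  proof (rule decoupled_rescale[OF dec _ _ gg \<open>D \<ge> 1\<close> finite_cell[OF A(1)] A(2) _ _ qq dG ort'])
    show "cellbd g' (tri l) p (cell p A g i) f \<Theta> ?w \<nu>"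
      using \<nu> bd by (auto simp: cellbd_def mix_mom)
  qed (use i w in \<open>auto simp: cell_def\<close>)
  then show ?thesis by (simp add: mix_mom)
qed

section \<open>Bilinear estimates\<close>

text \<open>
  \<open>\<alpha>\<close> is the gain over the exponent \<open>\<eta>\<close>, per unit of the scale \<open>h\<close>. The divisibility by \<open>Q\<close> and
  \<open>h * Q \<le> n\<close> leave room for the later refinements \<open>h \<mapsto> h * (k - l + 1) / l\<close> to stay integral and
  below \<open>n\<close>.
\<close>

definition bilinear :: "'t itself \<Rightarrow> nat \<Rightarrow> real \<Rightarrow> nat \<Rightarrow> real \<Rightarrow> nat \<Rightarrow> real \<Rightarrow> real \<Rightarrow> real \<Rightarrow> real \<Rightarrow> bool" where
  "bilinear _ k \<eta> l \<alpha> Q C \<kappa> \<epsilon> K \<longleftrightarrow> (\<forall>n q G p A f \<Theta> w \<nu> g h i i'.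
     sys k C n q G p A (f :: real \<Rightarrow> 't \<Rightarrow> complex) \<Theta> w \<longrightarrow> cellbd n (tri k) p A f \<Theta> w \<nu> \<longrightarrow>
     Q dvd h \<longrightarrow> h * Q \<le> n \<longrightarrow> l * g \<le> h * (k - l + 1) \<longrightarrow>
     (\<forall>x\<in>seg g i. \<forall>y\<in>seg h i'. \<kappa> \<le> \<bar>x - y\<bar>) \<longrightarrow>
     mix f \<Theta> w (tri l) (cell p A g i) (tri k - tri l) (cell p A h i')
       \<le> 2 powr (K + \<eta> * real n - \<alpha> * real h + \<epsilon> * real n)
          * ((\<Sum>x\<in>cell p A g i. \<nu> x) ^ tri l * (\<Sum>x\<in>cell p A h i'. \<nu> x) ^ (tri k - tri l)))"

definition bilin :: "'t itself \<Rightarrow> nat \<Rightarrow> real \<Rightarrow> nat \<Rightarrow> real \<Rightarrow> nat \<Rightarrow> bool" where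
  "bilin T k \<eta> l \<alpha> Q \<longleftrightarrow> (\<forall>C\<ge>1. \<forall>\<kappa>. 0 < \<kappa> \<longrightarrow> \<kappa> \<le> 1 \<longrightarrow> (\<forall>\<epsilon>>0. \<exists>K\<ge>0. bilinear T k \<eta> l \<alpha> Q C \<kappa> \<epsilon> K))"

lemma bilinearD:
  assumes "bilinear TYPE('t) k \<eta> l \<alpha> Q C \<kappa> \<epsilon> K"
    "sys k C n q G p A (f :: real \<Rightarrow> 't \<Rightarrow> complex) \<Theta> w" "cellbd n (tri k) p A f \<Theta> w \<nu>"
    "Q dvd h" "h * Q \<le> n" "l * g \<le> h * (k - l + 1)"
    "\<And>x y. x \<in> seg g i \<Longrightarrow> y \<in> seg h i' \<Longrightarrow> \<kappa> \<le> \<bar>x - y\<bar>"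
  shows "mix f \<Theta> w (tri l) (cell p A g i) (tri k - tri l) (cell p A h i')
       \<le> 2 powr (K + \<eta> * real n - \<alpha> * real h + \<epsilon> * real n)
          * ((\<Sum>x\<in>cell p A g i. \<nu> x) ^ tri l * (\<Sum>x\<in>cell p A h i'. \<nu> x) ^ (tri k - tri l))"
  using assms unfolding bilinear_def by blast

section \<open>Hoelder's inequality and the exchange of the two pieces\<close>

lemma tri_add: "tri (l + m) = tri l + tri m + l * m"
  by (induction m) (auto simp: tri_Suc, simp add: tri_def)

lemma mix_Holder_mom:
  assumes "finite \<Theta>" "\<And>\<theta>. 0 \<le> w \<theta>" "0 < a" "0 < b"
  shows "mix f \<Theta> w a B b B' ^ (a + b) \<le> mom f \<Theta> w (a + b) B ^ a * mom f \<Theta> w (a + b) B' ^ b"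
  unfolding mix_def mom_def
proof (rule Holder_sum)
  fix \<theta>
  have "(w * (x ^ (2 * a) * y ^ (2 * b))) ^ (a + b) = (w * x ^ (2 * (a + b))) ^ a * (w * y ^ (2 * (a + b))) ^ b" for w x y :: real
    unfolding power_mult_distrib power_mult[symmetric] by (simp add: power_add algebra_simps)
  then show "(w \<theta> * (norm (expsum f B \<theta>) ^ (2 * a) * norm (expsum f B' \<theta>) ^ (2 * b))) ^ (a + b)
    \<le> (w \<theta> * norm (expsum f B \<theta>) ^ (2 * (a + b))) ^ a * (w \<theta> * norm (expsum f B' \<theta>) ^ (2 * (a + b))) ^ b"
    by (simp only: order_refl)
qed (use assms in auto)

lemma mix_exponents:
  assumes l: "0 < l" and k: "k = l + m"
  shows "tri l * (m + 1) = (tri k - tri m) + tri (l - 1) * m"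
    "(tri k - tri l) * (m + 1) = tri m + (tri k - tri (l - 1)) * m"
proof -
  obtain l' where l': "l = Suc l'" using l gr0_implies_Suc by blast
  have 1: "tri k = tri l + tri m + l * m" using k tri_add by simp
  have 2: "tri l = tri l' + l" using l' tri_Suc by simp
  have d: "tri k - tri m = tri l + l * m" "tri k - tri l = tri m + l * m" "tri k - tri (l - 1) = tri m + l * m + l"
    using 1 2 l' by auto
  show "tri l * (m + 1) = (tri k - tri m) + tri (l - 1) * m"
    unfolding d using 2 l' by (simp add: algebra_simps)
  show "(tri k - tri l) * (m + 1) = tri m + (tri k - tri (l - 1)) * m"
    unfolding d by (simp add: algebra_simps)
qed

text \<open>By \<open>mix_exponents\<close> the exponents of index \<open>l\<close> are the average,
  with weights \<open>1 / (m + 1)\<close> and \<open>m / (m + 1)\<close>, of those of the swapped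
  moment of index \<open>m = k - l\<close> and those of index \<open>l - 1\<close>. The swap lets
  the scale of \<open>B\<close>, by then refined, measure the gain.\<close>

lemma mix_Holder_step:
  assumes "finite \<Theta>" "\<And>\<theta>. 0 \<le> w \<theta>" "0 < l" "k = l + m" "0 < m"
  shows "mix f \<Theta> w (tri l) B (tri k - tri l) B' ^ (m + 1)
     \<le> mix f \<Theta> w (tri m) B' (tri k - tri m) B * mix f \<Theta> w (tri (l - 1)) B (tri k - tri (l - 1)) B' ^ m"
proof -
  have sp: "(x ^ (2 * a)) ^ (1 + m) = x ^ (2 * c) * (x ^ (2 * e)) ^ m" if "a * (m + 1) = c + e * m"
    for x :: real and a c e
  proof -
    have "2 * a * (1 + m) = 2 * c + 2 * e * m" using that by (simp add: algebra_simps)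
    then show ?thesis by (simp only: power_mult[symmetric] power_add[symmetric])
  qed
  have e: "(w * (x ^ (2 * tri l) * y ^ (2 * (tri k - tri l)))) ^ (1 + m)
     = (w * (y ^ (2 * tri m) * x ^ (2 * (tri k - tri m)))) ^ 1 * (w * (x ^ (2 * tri (l - 1)) * y ^ (2 * (tri k - tri (l - 1))))) ^ m"
    for w x y :: real
    unfolding power_mult_distrib sp[OF mix_exponents(1)[OF assms(3,4)]] sp[OF mix_exponents(2)[OF assms(3,4)]]
    by (simp only: power_add power_one_right mult_ac)
  have "mix f \<Theta> w (tri l) B (tri k - tri l) B' ^ (1 + m)
     \<le> mix f \<Theta> w (tri m) B' (tri k - tri m) B ^ 1 * mix f \<Theta> w (tri (l - 1)) B (tri k - tri (l - 1)) B' ^ m"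
    unfolding mix_def
    by (rule Holder_sum, fact assms(1); (rule eq_refl, rule e)?) (use assms in auto)
  then show ?thesis by simp
qed

lemma mix_pow_bound:
  fixes X :: real
  assumes "X ^ N \<le> 2 powr e' * Y ^ N" "e' \<le> e * real N" "0 < N" "0 \<le> X" "0 \<le> Y"
  shows "X \<le> 2 powr e * Y"
proof -
  have "X ^ N \<le> 2 powr (e * real N) * Y ^ N"
    using assms by (intro order_trans[OF assms(1)] mult_right_mono powr_mono) auto
  also have "\<dots> = (2 powr e * Y) ^ N" by (simp add: power_mult_distrib powr_power mult.commute)
  finally show ?thesis using assms by (subst (asm) power_mono_iff) auto
qed

text \<open>Round zero of the recursion: Hoelder's inequality separates the two pieces and each is
  decoupled on its own. The condition \<open>k \<le> Q\<close> keeps both scales below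
  \<open>n\<close>.\<close>

lemma bilin_trivial:
  assumes dec: "decoupling TYPE('t) k \<eta>" and \<eta>: "0 \<le> \<eta>" and l: "0 < l" "l < k" and Q: "k \<le> Q"
  shows "bilin TYPE('t) k \<eta> l 0 Q"
  unfolding bilin_def
proof (intro allI impI)
  fix C \<kappa> \<epsilon> :: real assume C: "C \<ge> 1" and \<epsilon>: "\<epsilon> > 0"
  obtain K where K: "K \<ge> 0" "decoupled TYPE('t) k \<eta> C K" using dec C unfolding decoupling_def by blast
  have "bilinear TYPE('t) k \<eta> l 0 Q C \<kappa> \<epsilon> K"
    unfolding bilinear_def
  proof (intro allI impI)
    fix n q G p A \<Theta> w \<nu> g h i i' and f :: "real \<Rightarrow> 't \<Rightarrow> complex"
    assume sy: "sys k C n q G p A f \<Theta> w" and bd: "cellbd n (tri k) p A f \<Theta> w \<nu>"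
      and hn: "h * Q \<le> n" and g: "l * g \<le> h * (k - l + 1)"
    have "h * (k - l + 1) \<le> h * Q" using l Q by (intro mult_le_mono2) auto
    moreover have "g \<le> l * g" using l by simp
    ultimately have gn: "g \<le> n" using g hn by linarith
    have "h \<le> h * Q" using Q l by simp
    then have hn': "h \<le> n" using hn by linarith
    have s: "0 < tri k" "tri l < tri k" "0 < tri l" using l tri_pos tri_less by auto
    have \<nu>: "0 \<le> \<nu> x" for x using bd by (simp add: cellbd_def)
    let ?e = "K + \<eta> * real n"
    have mb: "mom f \<Theta> w (tri k) (cell p A e j) \<le> 2 powr ?e * (\<Sum>x\<in>cell p A e j. \<nu> x) ^ tri k" if "e \<le> n" for e j
      by (rule decoupledD[OF K(2) sys_subset[OF sy cell_subset] cellbd_cell[OF bd that s(1)]])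
    have w: "\<And>\<theta>. 0 \<le> w \<theta>" and T: "finite \<Theta>" using sy by (auto simp: sys_def)
    let ?X = "\<Sum>x\<in>cell p A g i. \<nu> x" and ?Y = "\<Sum>x\<in>cell p A h i'. \<nu> x"
    have nn: "0 \<le> ?X" "0 \<le> ?Y" using \<nu> by (auto intro: sum_nonneg)
    have ab: "tri l + (tri k - tri l) = tri k" using s by simp
    have "mix f \<Theta> w (tri l) (cell p A g i) (tri k - tri l) (cell p A h i') ^ tri k
      \<le> mom f \<Theta> w (tri k) (cell p A g i) ^ tri l * mom f \<Theta> w (tri k) (cell p A h i') ^ (tri k - tri l)"
      using mix_Holder_mom[OF T w s(3), where b = "tri k - tri l" and f = f and B = "cell p A g i" and B' = "cell p A h i'"] s unfolding ab by simp
    also have "\<dots> \<le> (2 powr ?e * ?X ^ tri k) ^ tri l * (2 powr ?e * ?Y ^ tri k) ^ (tri k - tri l)"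
      using nn w by (intro mult_mono power_mono mb gn hn' mom_nonneg zero_le_power mult_nonneg_nonneg) auto
    also have "\<dots> = (2 powr ?e) ^ (tri l + (tri k - tri l)) * (?X ^ tri l * ?Y ^ (tri k - tri l)) ^ tri k"
      unfolding power_mult_distrib power_mult[symmetric] power_add by (simp add: mult_ac)
    also have "(2 powr ?e) ^ (tri l + (tri k - tri l)) = 2 powr (?e * real (tri k))"
      unfolding ab by (simp add: powr_power mult.commute)
    finally have "mix f \<Theta> w (tri l) (cell p A g i) (tri k - tri l) (cell p A h i') \<le> 2 powr ?e * (?X ^ tri l * ?Y ^ (tri k - tri l))"
      by (rule mix_pow_bound) (use s nn w in \<open>auto intro: mix_nonneg\<close>)
    also have "\<dots> \<le> 2 powr (K + \<eta> * real n - 0 * real h + \<epsilon> * real n) * (?X ^ tri l * ?Y ^ (tri k - tri l))"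
      using nn \<epsilon> by (intro mult_right_mono powr_mono) auto
    finally show "mix f \<Theta> w (tri l) (cell p A g i) (tri k - tri l) (cell p A h i')
      \<le> 2 powr (K + \<eta> * real n - 0 * real h + \<epsilon> * real n) * (?X ^ tri l * ?Y ^ (tri k - tri l))" .
  qed
  then show "\<exists>K\<ge>0. bilinear TYPE('t) k \<eta> l 0 Q C \<kappa> \<epsilon> K" using K by blast
qed

text \<open>After rescaling, a cell of length \<open>2 ^ -h\<close> has only \<open>n - h\<close>
  scales left. The saving of \<open>\<eta> * h\<close> is the inhomogeneous term of the recursion
  for the bilinear exponents.\<close>

lemma decoupled_cell:
  assumes dec: "decoupled TYPE('t) k \<eta> (2 ^ k * C) K" and C: "C \<ge> 1" and k: "0 < k"
    and sy: "sys k C n q G p A (f :: real \<Rightarrow> 't \<Rightarrow> complex) \<Theta> w" and bd: "cellbd n (tri k) p A f \<Theta> w \<nu>" and h: "h \<le> n"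
  shows "mom f \<Theta> w (tri k) (cell p A h i) \<le> 2 powr (K + \<eta> * real (n - h)) * (\<Sum>x\<in>cell p A h i. \<nu> x) ^ tri k"
proof (cases "cell p A h i = {}")
  case True
  then show ?thesis using tri_pos[OF k] by (simp add: mom_empty zero_power)
next
  case False
  obtain q' G' where "sys k (2 ^ k * C) (n - h) q' G' (\<lambda>x. p x * 2 ^ h - of_int i) (cell p A h i) f \<Theta> w"
    using sys_cell[OF sy C h False] by blast
  then show ?thesis by (rule decoupledD[OF dec _ cellbd_rescale[OF h cellbd_cell[OF bd h tri_pos[OF k]]]])
qed

text \<open>Lower-dimensional decoupling refines the first piece from \<open>g\<close> to
  \<open>gs = h * (k - l + 1) / l\<close> with an arbitrarily small loss, and
  \<open>mix_Holder_step\<close> bounds each refined moment. Its swapped factor gains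
  \<open>a (k - l) * gs\<close>; the other gains \<open>a (l - 1) * h\<close>, or
  \<open>\<eta> * h\<close> if \<open>l = 1\<close>. Averaging gives the new gain per unit of
  \<open>h\<close>.\<close>

lemma bilin_step:
  assumes l: "0 < l" "l < k" and Q: "fact k dvd Q" "0 < Q" and \<eta>: "0 \<le> \<eta>"
    and dec: "decoupling TYPE('t) k \<eta>"
    and low: "\<And>m \<epsilon>. 0 < m \<Longrightarrow> m < k \<Longrightarrow> 0 < \<epsilon> \<Longrightarrow> decoupling TYPE('t) m \<epsilon>"
    and IH: "\<And>m. 0 < m \<Longrightarrow> m < k \<Longrightarrow> bilin TYPE('t) k \<eta> m (a m) Q"
  shows "bilin TYPE('t) k \<eta> l
     (a (k - l) / real l + real (k - l) / real (k - l + 1) * (if l = 1 then \<eta> else a (l - 1))) (Q * fact k)"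
    (is "bilin _ _ _ _ ?\<alpha> _")
  unfolding bilin_def
proof (intro allI impI)
  fix C \<kappa> \<epsilon> :: real assume C: "C \<ge> 1" and \<kappa>: "0 < \<kappa>" "\<kappa> \<le> 1" and \<epsilon>: "\<epsilon> > 0"
  define m where "m = k - l"
  have m: "0 < m" "m < k" "k = l + m" using l by (auto simp: m_def)
  \<comment> \<open>One half of \<open>\<epsilon>\<close> pays for the estimates of the previous
    round, the other for decoupling in dimension \<open>l\<close>.\<close>
  define \<delta> where "\<delta> = \<epsilon> / 2"
  have \<delta>: "\<delta> > 0" using \<epsilon> by (simp add: \<delta>_def)
  define D where "D = 2 ^ l * (2 ^ k + 2 * real (tri k)) * C / \<kappa> ^ k"
  have D1: "1 \<le> 2 ^ l * D"
  proof -
    have "1 * 1 * (1 * 1) \<le> 2 ^ l * 2 ^ l * ((2 ^ k + 2 * real (tri k)) * C)"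
      using C by (intro mult_mono) (auto intro: add_increasing2)
    also have "\<dots> \<le> 2 ^ l * 2 ^ l * ((2 ^ k + 2 * real (tri k)) * C) / \<kappa> ^ k"
      using C \<kappa> by (simp add: le_divide_eq power_le_one mult_left_le)
    finally show ?thesis by (simp add: D_def mult_ac)
  qed
  obtain K1 where K1: "K1 \<ge> 0" "bilinear TYPE('t) k \<eta> m (a m) Q C \<kappa> \<delta> K1"
    using IH[OF m(1,2)] C \<kappa> \<delta> unfolding bilin_def by blast
  obtain K2 where K2: "K2 \<ge> 0" "decoupled TYPE('t) l \<delta> (2 ^ l * D) K2"
    using low[OF l \<delta>] D1 unfolding decoupling_def by blast
  define a' where "a' = (if l = 1 then \<eta> else a (l - 1))"
  have C2: "1 \<le> 2 ^ k * C" using mult_mono[OF one_le_power C, of 2 k] by simp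
  \<comment> \<open>Covers both meanings of index \<open>l - 1\<close>. For \<open>l = 1\<close> the
    first piece drops out, as \<open>tri 0 = 0\<close>, and a plain moment of the second
    remains.\<close>
  obtain K4 where K4: "K4 \<ge> 0"
    "\<And>n q G p A (f :: real \<Rightarrow> 't \<Rightarrow> complex) \<Theta> w \<nu> g h i i'.
     sys k C n q G p A f \<Theta> w \<Longrightarrow> cellbd n (tri k) p A f \<Theta> w \<nu> \<Longrightarrow>
     Q dvd h \<Longrightarrow> h * Q \<le> n \<Longrightarrow> (l - 1) * g \<le> h * (m + 2) \<Longrightarrow>
     (\<And>x y. x \<in> seg g i \<Longrightarrow> y \<in> seg h i' \<Longrightarrow> \<kappa> \<le> \<bar>x - y\<bar>) \<Longrightarrow>
     mix f \<Theta> w (tri (l - 1)) (cell p A g i) (tri k - tri (l - 1)) (cell p A h i')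
       \<le> 2 powr (K4 + \<eta> * real n - a' * real h + \<delta> * real n)
          * ((\<Sum>x\<in>cell p A g i. \<nu> x) ^ tri (l - 1) * (\<Sum>x\<in>cell p A h i'. \<nu> x) ^ (tri k - tri (l - 1)))"
  proof (cases "l = 1")
    case True
    obtain K where K: "K \<ge> 0" "decoupled TYPE('t) k \<eta> (2 ^ k * C) K" using dec C2 unfolding decoupling_def by blast
    have t0: "tri 0 = 0" by (simp add: tri_def)
    show ?thesis
    proof (rule that[OF K(1)])
      fix n q G p A \<Theta> w \<nu> g h i i' and f :: "real \<Rightarrow> 't \<Rightarrow> complex"
      assume sy: "sys k C n q G p A f \<Theta> w" and bd: "cellbd n (tri k) p A f \<Theta> w \<nu>" and hn: "h * Q \<le> n"
      have "h \<le> h * Q" using Q by simp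
      then have hn': "h \<le> n" using hn by linarith
      have \<nu>: "0 \<le> \<nu> x" for x using bd by (simp add: cellbd_def)
      have "mom f \<Theta> w (tri k) (cell p A h i') \<le> 2 powr (K + \<eta> * real (n - h)) * (\<Sum>x\<in>cell p A h i'. \<nu> x) ^ tri k"
        using m by (intro decoupled_cell[OF K(2) C _ sy bd hn']) auto
      also have "\<dots> \<le> 2 powr (K + \<eta> * real n - \<eta> * real h + \<delta> * real n) * (\<Sum>x\<in>cell p A h i'. \<nu> x) ^ tri k"
        using \<nu> \<delta> hn' by (intro mult_right_mono powr_mono zero_le_power sum_nonneg) (auto simp: of_nat_diff right_diff_distrib)
      finally show "mix f \<Theta> w (tri (l - 1)) (cell p A g i) (tri k - tri (l - 1)) (cell p A h i')
       \<le> 2 powr (K + \<eta> * real n - a' * real h + \<delta> * real n)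
          * ((\<Sum>x\<in>cell p A g i. \<nu> x) ^ tri (l - 1) * (\<Sum>x\<in>cell p A h i'. \<nu> x) ^ (tri k - tri (l - 1)))"
        by (simp add: True t0 mix_zero a'_def)
    qed
  next
    case False
    then have l1: "0 < l - 1" "l - 1 < k" "k - (l - 1) + 1 = m + 2" using l m by auto
    obtain K where K: "K \<ge> 0" "bilinear TYPE('t) k \<eta> (l - 1) (a (l - 1)) Q C \<kappa> \<delta> K"
      using IH[OF l1(1,2)] C \<kappa> \<delta> unfolding bilin_def by blast
    show ?thesis
      by (rule that[OF K(1)], unfold a'_def if_not_P[OF False], rule bilinearD[OF K(2), unfolded l1(3)])
  qed
  define K where "K = K1 + K4 + K2"
  have "bilinear TYPE('t) k \<eta> l ?\<alpha> (Q * fact k) C \<kappa> \<epsilon> K"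
    unfolding bilinear_def
  proof (intro allI impI)
    fix n q G p A \<Theta> w \<nu> g h i i' and f :: "real \<Rightarrow> 't \<Rightarrow> complex"
    assume sy: "sys k C n q G p A f \<Theta> w" and bd: "cellbd n (tri k) p A f \<Theta> w \<nu>"
      and Qh: "Q * fact k dvd h" and hn: "h * (Q * fact k) \<le> n" and g: "l * g \<le> h * (k - l + 1)"
      and sep: "\<forall>x\<in>seg g i. \<forall>y\<in>seg h i'. \<kappa> \<le> \<bar>x - y\<bar>"
    have \<nu>: "0 \<le> \<nu> x" for x using bd by (simp add: cellbd_def)
    have w: "\<And>\<theta>. 0 \<le> w \<theta>" and T: "finite \<Theta>" using sy by (auto simp: sys_def)
    have g': "l * g \<le> h * (m + 1)" using g by (simp add: m_def)
    have "l dvd fact k" using l by (intro dvd_fact) auto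
    then have "Q * l dvd h" using Qh by (meson dvd_trans dvd_refl mult_dvd_mono)
    then obtain h1 where h1: "h = Q * l * h1" by blast
    \<comment> \<open>The solution of \<open>l * gs = h * (m + 1)\<close>. Writing
      \<open>h = Q * l * h1\<close> makes it integral and divisible by \<open>Q\<close>, so that it
      is an admissible scale for the previous round.\<close>
    define gs where "gs = Q * h1 * (m + 1)"
    have gs: "l * gs = h * (m + 1)" by (simp only: gs_def h1 mult_ac)
    have Qgs: "Q dvd gs" by (simp add: gs_def)
    have Qh': "Q dvd h" by (simp add: h1)
    have ggs: "g \<le> gs" using g' gs l by (metis mult_le_cancel1)
    have fk: "k \<le> fact k" by (rule fact_ge_self)
    have "gs * Q \<le> n"
    proof -
      have "gs \<le> l * gs" using l by simp
      also have "\<dots> \<le> h * fact k" unfolding gs using fk m l by (intro mult_le_mono2) auto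
      finally have "gs * Q \<le> h * fact k * Q" by (rule mult_le_mono1)
      also have "\<dots> = h * (Q * fact k)" by (simp only: mult_ac)
      finally show ?thesis using hn by linarith
    qed
    have hQ: "h * Q \<le> n"
    proof -
      have "h * Q * 1 \<le> h * Q * fact k" by (intro mult_le_mono2) (simp add: fact_ge_1)
      also have "\<dots> = h * (Q * fact k)" by (simp only: mult_ac)
      finally show ?thesis using hn by linarith
    qed
    have "h \<le> h * Q" using Q by simp
    then have hn': "h \<le> n" using hQ by linarith
    have "gs \<le> gs * Q" using Q by simp
    then have gsn: "gs \<le> n" using \<open>gs * Q \<le> n\<close> by linarith
    define e where "e = K1 + K4 + \<eta> * real n - ?\<alpha> * real h + \<delta> * real n"
    define Y where "Y = (\<Sum>x\<in>cell p A h i'. \<nu> x)"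
    have Y: "0 \<le> Y" using \<nu> by (auto simp: Y_def intro: sum_nonneg)
    have XJ: "mix f \<Theta> w (tri l) (cell p A gs j) (tri k - tri l) (cell p A h i')
        \<le> 2 powr e * ((\<Sum>x\<in>cell p A gs j. \<nu> x) ^ tri l * Y ^ (tri k - tri l))" if j: "seg gs j \<subseteq> seg g i" for j
    proof -
      define X where "X = (\<Sum>x\<in>cell p A gs j. \<nu> x)"
      have X: "0 \<le> X" using \<nu> by (auto simp: X_def intro: sum_nonneg)
      define e1 where "e1 = K1 + \<eta> * real n - a m * real gs + \<delta> * real n"
      define e2 where "e2 = K4 + \<eta> * real n - a' * real h + \<delta> * real n"
      have sep1: "\<kappa> \<le> \<bar>x - y\<bar>" if "x \<in> seg gs j" "y \<in> seg h i'" for x y using sep that j by blast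
      have km: "k - m + 1 = l + 1" using m by simp
      have c1: "m * h \<le> gs * (k - m + 1)"
      proof -
        have "l * (m * h) \<le> (l + 1) * ((m + 1) * h)" by (intro mult_le_mono) auto
        also have "\<dots> = l * gs * (l + 1)" unfolding gs by (simp only: mult_ac)
        also have "\<dots> = l * (gs * (k - m + 1))" by (simp only: km mult.assoc)
        finally show ?thesis using l by (metis mult_le_cancel1)
      qed
      have X1: "mix f \<Theta> w (tri m) (cell p A h i') (tri k - tri m) (cell p A gs j) \<le> 2 powr e1 * (Y ^ tri m * X ^ (tri k - tri m))"
        unfolding e1_def X_def Y_def
      proof (rule bilinearD[OF K1(2) sy bd Qgs \<open>gs * Q \<le> n\<close> c1])
        fix x y assume "x \<in> seg h i'" "y \<in> seg gs j"
        then show "\<kappa> \<le> \<bar>x - y\<bar>" using sep1[of y x] by (simp add: abs_minus_commute)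
      qed
      have c2: "(l - 1) * gs \<le> h * (m + 2)"
      proof -
        have "l * ((l - 1) * gs) = (l - 1) * (h * (m + 1))" using gs by (simp add: mult_ac)
        also have "\<dots> \<le> l * (h * (m + 2))" by (intro mult_le_mono) auto
        finally show ?thesis using l by (metis mult_le_cancel1)
      qed
      have X2: "mix f \<Theta> w (tri (l - 1)) (cell p A gs j) (tri k - tri (l - 1)) (cell p A h i') \<le> 2 powr e2 * (X ^ tri (l - 1) * Y ^ (tri k - tri (l - 1)))"
        unfolding e2_def X_def Y_def by (rule K4(2)[OF sy bd Qh' hQ c2 sep1])
      have "mix f \<Theta> w (tri l) (cell p A gs j) (tri k - tri l) (cell p A h i') ^ (m + 1)
        \<le> (2 powr e1 * (Y ^ tri m * X ^ (tri k - tri m))) * (2 powr e2 * (X ^ tri (l - 1) * Y ^ (tri k - tri (l - 1)))) ^ m"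
        using X Y w T l m by (intro order_trans[OF mix_Holder_step[OF T w l(1) m(3,1)]] mult_mono power_mono X1 X2 mix_nonneg zero_le_power mult_nonneg_nonneg) auto
      also have "\<dots> = (2 powr e1 * (2 powr e2) ^ m) * (X ^ ((tri k - tri m) + tri (l - 1) * m) * Y ^ (tri m + (tri k - tri (l - 1)) * m))"
        unfolding power_mult_distrib power_mult[symmetric] power_add by (simp add: mult_ac)
      also have "\<dots> = 2 powr (e1 + e2 * real m) * (X ^ tri l * Y ^ (tri k - tri l)) ^ (m + 1)"
        unfolding mix_exponents[OF l(1) m(3), symmetric] power_mult_distrib power_mult[symmetric]
        by (simp add: powr_power powr_add mult.commute)
      finally have pw: "mix f \<Theta> w (tri l) (cell p A gs j) (tri k - tri l) (cell p A h i') ^ (m + 1)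
        \<le> 2 powr (e1 + e2 * real m) * (X ^ tri l * Y ^ (tri k - tri l)) ^ (m + 1)" .
      have ee: "e1 + e2 * real m \<le> e * real (m + 1)"
      proof -
        have rgs: "real gs = real h * (real m + 1) / real l"
        proof -
          have "real l * real gs = real h * (real m + 1)" using gs by (metis of_nat_mult of_nat_add of_nat_1)
          then show ?thesis using l by (simp add: field_simps)
        qed
        have \<alpha>: "?\<alpha> * real h * (real m + 1) = a m * real gs + a' * real h * real m"
        proof -
          have "?\<alpha> = a m / real l + real m / (real m + 1) * a'" by (simp add: m_def a'_def add.commute)
          then have "?\<alpha> * real h * (real m + 1) = a m / real l * real h * (real m + 1) + real m / (real m + 1) * (real m + 1) * a' * real h"
            by (simp only: distrib_right) (simp add: mult_ac)
          also have "real m / (real m + 1) * (real m + 1) = real m" by (simp add: nonzero_eq_divide_eq)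
          finally show ?thesis unfolding rgs by (simp add: mult_ac)
        qed
        have "e * real (m + 1) = (K1 + K4) * (real m + 1) + \<eta> * real n * (real m + 1) - ?\<alpha> * real h * (real m + 1) + \<delta> * real n * (real m + 1)"
          by (simp only: e_def of_nat_add of_nat_1 distrib_right left_diff_distrib)
        moreover have "K1 + K4 * real m \<le> (K1 + K4) * (real m + 1)"
          using K1(1) K4(1) by (simp add: algebra_simps)
        ultimately show ?thesis unfolding \<alpha> e1_def e2_def by (simp add: algebra_simps)
      qed
      show ?thesis unfolding X_def[symmetric]
        by (rule mix_pow_bound[OF pw ee]) (use X Y w in \<open>auto intro: mix_nonneg\<close>)
    qed
    have tl: "0 < tri l" using l tri_pos by auto
    \<comment> \<open>\<open>lower_dim\<close> takes bounds that are \<open>tri l\<close>-th powers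
      of sums of a weight. The factor \<open>2 powr e * Y ^ (tri k - tri l)\<close> is the same for
      all refined cells, so its root can be absorbed into the weight.\<close>
    define \<rho> where "\<rho> = root (tri l) (2 powr e * Y ^ (tri k - tri l))"
    have \<rho>: "0 \<le> \<rho>" "\<rho> ^ tri l = 2 powr e * Y ^ (tri k - tri l)" using tl Y by (auto simp: \<rho>_def)
    have "mix f \<Theta> w (tri l) (cell p A g i) (tri k - tri l) (cell p A h i')
      \<le> 2 powr (K2 + \<delta> * real (gs - g)) * (\<Sum>x\<in>cell p A g i. \<rho> * \<nu> x) ^ tri l"
    proof (rule lower_dim[OF sy C l \<kappa> D_def K2(2) _ ggs hn'])
      show "l * gs = h * (k - l + 1)" using gs by (simp add: m_def)
      show "\<kappa> \<le> \<bar>x - y\<bar>" if "x \<in> seg g i" "y \<in> seg h i'" for x y using sep that by blast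
      show "0 \<le> \<rho> * \<nu> x" for x using \<rho> \<nu> by simp
      fix j
      let ?J = "cell p (cell p A g i) gs j"
      show "mix f \<Theta> w (tri l) ?J (tri k - tri l) (cell p A h i') \<le> (\<Sum>x\<in>?J. \<rho> * \<nu> x) ^ tri l"
      proof (cases "?J = {}")
        case True
        then show ?thesis using tl by (simp add: mix_def zero_power)
      next
        case False
        then obtain x where "x \<in> ?J" by blast
        then have "x \<in> cell p A g i" "x \<in> cell p A gs j" by (auto simp: cell_iff)
        then have sg: "seg gs j \<subseteq> seg g i" using cell_nested(2)[OF ggs] by blast
        have "?J = cell p A gs j" using False cell_cell_cases[OF ggs] by metis
        then show ?thesis using XJ[OF sg] by (simp add: power_mult_distrib \<rho> mult_ac flip: sum_distrib_left)
      qed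
    qed
    also have "(\<Sum>x\<in>cell p A g i. \<rho> * \<nu> x) ^ tri l = 2 powr e * (Y ^ (tri k - tri l) * (\<Sum>x\<in>cell p A g i. \<nu> x) ^ tri l)"
      by (simp add: power_mult_distrib \<rho> flip: sum_distrib_left)
    also have "2 powr (K2 + \<delta> * real (gs - g)) * (2 powr e * (Y ^ (tri k - tri l) * (\<Sum>x\<in>cell p A g i. \<nu> x) ^ tri l))
      = 2 powr (K2 + \<delta> * real (gs - g) + e) * ((\<Sum>x\<in>cell p A g i. \<nu> x) ^ tri l * Y ^ (tri k - tri l))"
      by (simp add: powr_add mult_ac)
    also have "\<dots> \<le> 2 powr (K + \<eta> * real n - ?\<alpha> * real h + \<epsilon> * real n) * ((\<Sum>x\<in>cell p A g i. \<nu> x) ^ tri l * Y ^ (tri k - tri l))"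
    proof (intro mult_right_mono powr_mono mult_nonneg_nonneg zero_le_power sum_nonneg Y \<nu>)
      have "\<delta> * real (gs - g) \<le> \<delta> * real n" using \<delta> gsn by (intro mult_left_mono) auto
      moreover have "\<epsilon> * real n = \<delta> * real n + \<delta> * real n" by (simp add: \<delta>_def)
      ultimately show "K2 + \<delta> * real (gs - g) + e \<le> K + \<eta> * real n - ?\<alpha> * real h + \<epsilon> * real n"
        unfolding e_def K_def by linarith
    qed auto
    finally show "mix f \<Theta> w (tri l) (cell p A g i) (tri k - tri l) (cell p A h i')
       \<le> 2 powr (K + \<eta> * real n - ?\<alpha> * real h + \<epsilon> * real n)
          * ((\<Sum>x\<in>cell p A g i. \<nu> x) ^ tri l * (\<Sum>x\<in>cell p A h i'. \<nu> x) ^ (tri k - tri l))"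
      unfolding Y_def .
  qed
  moreover have "K \<ge> 0" using K1(1) K2(1) K4(1) by (simp add: K_def)
  ultimately show "\<exists>K\<ge>0. bilinear TYPE('t) k \<eta> l ?\<alpha> (Q * fact k) C \<kappa> \<epsilon> K" by blast
qed

text \<open>
  The recursion is the one of \<open>bilin_step\<close>. Its coefficients are such that the sum over \<open>l\<close> grows
  by a fixed multiple of \<open>\<eta>\<close> in every round.
\<close>

fun gain :: "nat \<Rightarrow> real \<Rightarrow> nat \<Rightarrow> nat \<Rightarrow> real" where
  "gain k \<eta> 0 l = 0"
| "gain k \<eta> (Suc r) l = gain k \<eta> r (k - l) / real l
     + real (k - l) / real (k - l + 1) * (if l = 1 then \<eta> else gain k \<eta> r (l - 1))"

lemma bilin_gain:
  assumes "0 \<le> \<eta>" "decoupling TYPE('t) k \<eta>"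
    "\<And>m \<epsilon>. 0 < m \<Longrightarrow> m < k \<Longrightarrow> 0 < \<epsilon> \<Longrightarrow> decoupling TYPE('t) m \<epsilon>" "0 < l" "l < k"
  shows "bilin TYPE('t) k \<eta> l (gain k \<eta> r l) (fact k ^ Suc r)"
  using assms(4,5)
proof (induction r arbitrary: l)
  case 0
  then show ?case using bilin_trivial[OF assms(2,1), of l "fact k"] fact_ge_self[of k] by simp
next
  case (Suc r)
  have "bilin TYPE('t) k \<eta> l (gain k \<eta> (Suc r) l) (fact k ^ Suc r * fact k)"
    unfolding gain.simps
    by (rule bilin_step[OF Suc.prems _ _ assms(1,2,3) Suc.IH]) auto
  then show ?case by (simp add: mult_ac)
qed

text \<open>The recursion conserves the total: the gain of index \<open>l\<close> re-enters the next
  round with weight \<open>1 / (k - l)\<close> through index \<open>k - l\<close> and weight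
  \<open>(k - l - 1) / (k - l)\<close> through index \<open>l + 1\<close>. Only the term with
  \<open>\<eta>\<close> is new.\<close>

lemma sum_gain:
  assumes "2 \<le> k"
  shows "(\<Sum>l=1..<k. gain k \<eta> r l) = real r * (real (k - 1) / real k * \<eta>)"
proof (induction r)
  case (Suc r)
  let ?a = "gain k \<eta> r"
  have 1: "(\<Sum>l=1..<k. ?a (k - l) / real l) = (\<Sum>l=1..<k. ?a l / real (k - l))"
    by (rule sum.reindex_bij_witness[of _ "\<lambda>l. k - l" "\<lambda>l. k - l"]) auto
  have "(\<Sum>l=1..<k. real (k - l) / real (k - l + 1) * (if l = 1 then \<eta> else ?a (l - 1)))
     = real (k - 1) / real k * \<eta> + (\<Sum>l=Suc 1..<k. real (k - l) / real (k - l + 1) * (if l = 1 then \<eta> else ?a (l - 1)))"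
    using assms by (subst sum.atLeast_Suc_lessThan) auto
  also have "(\<Sum>l=Suc 1..<k. real (k - l) / real (k - l + 1) * (if l = 1 then \<eta> else ?a (l - 1)))
     = (\<Sum>l=1..<k-1. real (k - Suc l) / real (k - l) * ?a l)"
    using assms by (intro sum.reindex_bij_witness[of _ Suc "\<lambda>l. l - 1"]) (auto simp: Suc_diff_Suc)
  also have "\<dots> = (\<Sum>l=1..<k. real (k - Suc l) / real (k - l) * ?a l)"
    using assms by (intro sum.mono_neutral_left) auto
  finally have 2: "(\<Sum>l=1..<k. real (k - l) / real (k - l + 1) * (if l = 1 then \<eta> else ?a (l - 1)))
     = real (k - 1) / real k * \<eta> + (\<Sum>l=1..<k. real (k - Suc l) / real (k - l) * ?a l)" .
  have 3: "?a l / real (k - l) + real (k - Suc l) / real (k - l) * ?a l = ?a l" if "l \<in> {1..<k}" for l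
  proof -
    have "x / d + (d - 1) / d * x = x" if "0 < d" for x d :: real using that by (simp add: field_simps)
    moreover have "real (k - Suc l) = real (k - l) - 1" "0 < real (k - l)" using that by auto
    ultimately show ?thesis by metis
  qed
  have "(\<Sum>l=1..<k. gain k \<eta> (Suc r) l)
     = (\<Sum>l=1..<k. ?a l / real (k - l) + real (k - Suc l) / real (k - l) * ?a l) + real (k - 1) / real k * \<eta>"
    unfolding gain.simps sum.distrib 1 2 by simp
  also have "(\<Sum>l=1..<k. ?a l / real (k - l) + real (k - Suc l) / real (k - l) * ?a l) = (\<Sum>l=1..<k. ?a l)"
    by (intro sum.cong 3) auto
  finally show ?case unfolding Suc.IH of_nat_Suc distrib_right by simp
qed simp

text \<open>Some summand reaches the average. The number of rounds depends on \<open>\<eta>0\<close>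
  only, so the modulus \<open>Q\<close>, and with it the improvement of the exponent, stays the same
  while \<open>\<eta>\<close> descends.\<close>

lemma gain_large:
  assumes k: "2 \<le> k" and \<eta>0: "0 < \<eta>0"
  obtains r where "\<And>\<eta>. \<eta>0 \<le> \<eta> \<Longrightarrow> \<exists>l\<in>{1..<k}. B \<le> gain k \<eta> r l"
proof -
  obtain r where r: "B < real r * (\<eta>0 / real k)"
    using reals_Archimedean3[of "\<eta>0 / real k"] \<eta>0 k by (auto simp: mult.commute)
  show ?thesis
  proof
    fix \<eta> assume \<eta>: "\<eta>0 \<le> \<eta>"
    show "\<exists>l\<in>{1..<k}. B \<le> gain k \<eta> r l"
    proof (rule ccontr)
      assume "\<not> ?thesis"
      then have "(\<Sum>l=1..<k. gain k \<eta> r l) \<le> (\<Sum>l=1..<k. B)" by (intro sum_mono) (auto simp: not_le intro: less_imp_le)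
      then have "real r * (real (k - 1) / real k * \<eta>) \<le> real (k - 1) * B" unfolding sum_gain[OF k] by simp
      then have "real (k - 1) * (real r * (\<eta> / real k)) \<le> real (k - 1) * B" by (simp add: mult_ac)
      then have "real r * (\<eta> / real k) \<le> B" using k by (subst (asm) mult_le_cancel_left_pos) auto
      moreover have "real r * (\<eta>0 / real k) \<le> real r * (\<eta> / real k)"
        using \<eta> by (intro mult_left_mono divide_right_mono) auto
      ultimately show False using r by linarith
    qed
  qed
qed

section \<open>Decoupling for the moment curve\<close>

lemma sum_cell_le:
  fixes \<nu> :: "real \<Rightarrow> real"
  assumes "finite A" "\<And>x. 0 \<le> \<nu> x"
  shows "(\<Sum>x\<in>cell p A n i. \<nu> x) \<le> (\<Sum>x\<in>A. \<nu> x)"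
  using assms cell_subset by (intro sum_mono2) auto

lemma pow_prod_le:
  fixes x y :: real
  assumes "0 \<le> x" "0 \<le> y"
  shows "x ^ a * y ^ b \<le> x ^ (a + b) + y ^ (a + b)"
proof (cases "x \<le> y")
  case True
  then have "x ^ a * y ^ b \<le> y ^ a * y ^ b" using assms by (intro mult_right_mono power_mono) auto
  then show ?thesis using assms by (simp add: power_add add_increasing)
next
  case False
  then have "x ^ a * y ^ b \<le> x ^ a * x ^ b" using assms by (intro mult_left_mono power_mono) auto
  then show ?thesis using assms by (simp add: power_add add_increasing2)
qed

lemma mix_le_mom:
  assumes "\<And>\<theta>. 0 \<le> w \<theta>"
  shows "mix f \<Theta> w a B b B' \<le> mom f \<Theta> w (a + b) B + mom f \<Theta> w (a + b) B'"
proof -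
  have "x ^ (2 * a) * y ^ (2 * b) \<le> x ^ (2 * (a + b)) + y ^ (2 * (a + b))" if "0 \<le> x" "0 \<le> y" for x y :: real
    using pow_prod_le[OF that, of "2 * a" "2 * b"] by (simp only: add_mult_distrib2)
  then show ?thesis
    unfolding mix_def mom_def sum.distrib[symmetric] distrib_left[symmetric]
    using assms by (intro sum_mono mult_left_mono) auto
qed

text \<open>The second piece is cut from length \<open>2 ^ -\<mu>\<close> to \<open>2 ^ -h\<close>
  by the triangle inequality, at a cost of at most \<open>2 ^ (2 * h * tri k)\<close>. As
  \<open>\<alpha> \<ge> 2 * tri k + 1\<close>, a gain of \<open>h\<close>, about
  \<open>n / Q\<close>, is left; half of it pays for \<open>\<epsilon> * n\<close> and the other
  half is at least \<open>\<beta> * n\<close>, up to constants.\<close>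

lemma bilin_broad:
  assumes bl: "bilin TYPE('t) k \<eta> l \<alpha> Q" and dec: "decoupling TYPE('t) k \<eta>"
    and l: "0 < l" "l < k" and Q: "0 < Q" and \<alpha>: "2 * real (tri k) + 1 \<le> \<alpha>" and \<beta>: "\<beta> \<le> 1 / (2 * real Q)"
    and C: "C \<ge> 1"
  obtains K where "K \<ge> 0" "\<And>n q G p A (f :: real \<Rightarrow> 't \<Rightarrow> complex) \<Theta> w \<nu> i (i' :: int).
     sys k C n q G p A f \<Theta> w \<Longrightarrow> cellbd n (tri k) p A f \<Theta> w \<nu> \<Longrightarrow> 2 \<le> \<bar>i - i'\<bar> \<Longrightarrow> \<mu> \<le> n \<Longrightarrow>
     mix f \<Theta> w (tri l) (cell p A \<mu> i) (tri k - tri l) (cell p A \<mu> i')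
       \<le> 2 powr (K + (\<eta> - \<beta>) * real n) * (\<Sum>x\<in>A. \<nu> x) ^ tri k"
proof -
  let ?s = "tri k" and ?r = "tri k - tri l"
  define \<kappa> :: real where "\<kappa> = 1 / 2 ^ \<mu>"
  define \<epsilon> where "\<epsilon> = 1 / (2 * real Q)"
  have \<kappa>: "0 < \<kappa>" "\<kappa> \<le> 1" and \<epsilon>: "\<epsilon> > 0" using Q by (auto simp: \<kappa>_def \<epsilon>_def)
  obtain K1 where K1: "K1 \<ge> 0" "bilinear TYPE('t) k \<eta> l \<alpha> Q C \<kappa> \<epsilon> K1"
    using bl C \<kappa> \<epsilon> unfolding bilin_def by blast
  obtain K0 where K0: "K0 \<ge> 0" "decoupled TYPE('t) k \<eta> C K0"
    using dec C unfolding decoupling_def by blast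
  \<comment> \<open>If \<open>h < k * \<mu>\<close> then \<open>n < Q * (h + Q) \<le> n0\<close>.
    For these finitely many scales the gain is put into the constant.\<close>
  define n0 where "n0 = Q * (k * \<mu> + Q)"
  define K where "K = K1 + real Q + K0 + 1 + real n0"
  have s: "0 < tri l" "0 < ?r" "tri l + ?r = ?s" using l tri_pos tri_less[of l k] by auto
  show ?thesis
  proof (rule that[of K])
    show "K \<ge> 0" using K1 K0 by (simp add: K_def)
    fix n q G p A \<Theta> w \<nu> and i i' :: int and f :: "real \<Rightarrow> 't \<Rightarrow> complex"
    assume sy: "sys k C n q G p A f \<Theta> w" and bd: "cellbd n ?s p A f \<Theta> w \<nu>" and ii: "2 \<le> \<bar>i - i'\<bar>" and \<mu>n: "\<mu> \<le> n"
    have \<nu>: "0 \<le> \<nu> x" for x using bd by (simp add: cellbd_def)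
    have w: "\<And>\<theta>. 0 \<le> w \<theta>" and T: "finite \<Theta>" and A: "finite A" using sy by (auto simp: sys_def)
    let ?V = "\<Sum>x\<in>A. \<nu> x"
    have V: "0 \<le> ?V" using \<nu> by (auto intro: sum_nonneg)
    have cV: "0 \<le> (\<Sum>x\<in>cell p A e j. \<nu> x)" "(\<Sum>x\<in>cell p A e j. \<nu> x) \<le> ?V" for e j
      using \<nu> sum_cell_le[OF A, of \<nu>] by (auto intro: sum_nonneg)
    \<comment> \<open>The largest multiple of \<open>Q\<close> with \<open>h * Q \<le> n\<close>; it
      falls short of \<open>n / Q\<close> by less than \<open>Q\<close>.\<close>
    define h where "h = Q * (n div (Q * Q))"
    have hQ: "h * Q \<le> n" unfolding h_def by (metis div_times_less_eq_dividend mult.assoc mult.commute)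
    have Qh: "Q dvd h" by (simp add: h_def)
    have "n < (n div (Q * Q) + 1) * (Q * Q)" using Q dividend_less_div_times[of "Q * Q" n] by simp
    also have "\<dots> = Q * (h + Q)" by (simp add: h_def algebra_simps)
    finally have nh: "n < Q * (h + Q)" .
    have "\<beta> * real n \<le> \<epsilon> * real n" using \<beta> by (intro mult_right_mono) (auto simp: \<epsilon>_def)
    show "mix f \<Theta> w (tri l) (cell p A \<mu> i) ?r (cell p A \<mu> i') \<le> 2 powr (K + (\<eta> - \<beta>) * real n) * ?V ^ ?s"
    proof (cases "k * \<mu> \<le> h")
      case False
      then have "Q * (h + Q) \<le> n0" unfolding n0_def by (intro mult_le_mono2) auto
      then have nn0: "real n \<le> real n0" using nh by linarith
      have mb: "mom f \<Theta> w ?s (cell p A \<mu> j) \<le> 2 powr (K0 + \<eta> * real n) * ?V ^ ?s" for j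
      proof -
        have "mom f \<Theta> w ?s (cell p A \<mu> j) \<le> 2 powr (K0 + \<eta> * real n) * (\<Sum>x\<in>cell p A \<mu> j. \<nu> x) ^ ?s"
          using l by (intro decoupledD[OF K0(2) sys_subset[OF sy cell_subset] cellbd_cell[OF bd \<mu>n tri_pos]]) auto
        also have "\<dots> \<le> 2 powr (K0 + \<eta> * real n) * ?V ^ ?s" by (intro mult_left_mono power_mono cV) auto
        finally show ?thesis .
      qed
      have "mix f \<Theta> w (tri l) (cell p A \<mu> i) ?r (cell p A \<mu> i') \<le> mom f \<Theta> w ?s (cell p A \<mu> i) + mom f \<Theta> w ?s (cell p A \<mu> i')"
        using mix_le_mom[OF w, where a = "tri l" and b = ?r and f = f and B = "cell p A \<mu> i" and B' = "cell p A \<mu> i'"]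
        by (simp only: s(3))
      also have "\<dots> \<le> 2 powr (K0 + 1 + \<eta> * real n) * ?V ^ ?s"
        using mb[of i] mb[of i'] by (simp add: powr_add)
      also have "\<dots> \<le> 2 powr (K + (\<eta> - \<beta>) * real n) * ?V ^ ?s"
      proof (intro mult_right_mono powr_mono zero_le_power V)
        have "\<epsilon> \<le> 1" using Q by (simp add: \<epsilon>_def divide_le_eq)
        then have "\<epsilon> * real n \<le> 1 * real n" by (intro mult_right_mono) auto
        then have "\<beta> * real n \<le> real n0" using nn0 \<open>\<beta> * real n \<le> \<epsilon> * real n\<close> by linarith
        then show "K0 + 1 + \<eta> * real n \<le> K + (\<eta> - \<beta>) * real n"
          unfolding K_def left_diff_distrib using K1(1) by linarith
      qed auto
      finally show ?thesis .
    next
      case True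
      have "1 * \<mu> \<le> k * \<mu>" using l by (intro mult_le_mono1) auto
      then have \<mu>h: "\<mu> \<le> h" using True by linarith
      have lg: "l * \<mu> \<le> h * (k - l + 1)"
      proof -
        have "l * \<mu> \<le> k * \<mu>" using l by (intro mult_le_mono1) auto
        also have "\<dots> \<le> h * 1" using True by simp
        also have "\<dots> \<le> h * (k - l + 1)" by (intro mult_le_mono2) auto
        finally show ?thesis .
      qed
      have sep: "\<kappa> \<le> \<bar>x - y\<bar>" if x: "x \<in> seg \<mu> i" and y: "y \<in> seg \<mu> i'" for x y
      proof -
        have "of_int i \<le> x * 2 ^ \<mu>" "x * 2 ^ \<mu> \<le> of_int i + 1" "of_int i' \<le> y * 2 ^ \<mu>" "y * 2 ^ \<mu> \<le> of_int i' + 1"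
          using x y by (auto simp: seg_def field_simps)
        moreover have "real_of_int 2 \<le> of_int \<bar>i - i'\<bar>" using ii by (simp only: of_int_le_iff)
        then have "2 \<le> \<bar>real_of_int i - real_of_int i'\<bar>" by simp
        ultimately have "1 \<le> \<bar>x * 2 ^ \<mu> - y * 2 ^ \<mu>\<bar>" by linarith
        also have "\<dots> = \<bar>x - y\<bar> * 2 ^ \<mu>" by (simp add: abs_mult flip: left_diff_distrib)
        finally show ?thesis by (simp add: \<kappa>_def divide_le_eq)
      qed
      let ?I = "cell p A \<mu> i" and ?J = "cell p A \<mu> i'"
      let ?S = "(\<lambda>x. \<lfloor>p x * 2 ^ h\<rfloor>) ` ?J"
      let ?P = "2 ^ ((h - \<mu>) * (2 * ?r)) :: real"
      define e where "e = K1 + \<eta> * real n - \<alpha> * real h + \<epsilon> * real n"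
      have cb: "mix f \<Theta> w (tri l) ?I ?r (cell p ?J h j) \<le> 2 powr e * (?V ^ tri l * (\<Sum>x\<in>cell p ?J h j. \<nu> x) ^ ?r)"
        if "j \<in> ?S" for j
      proof -
        obtain x where x: "x \<in> ?J" "j = \<lfloor>p x * 2 ^ h\<rfloor>" using \<open>j \<in> ?S\<close> by blast
        have xc: "x \<in> cell p A h j" using x by (auto simp: cell_iff)
        have sub: "seg h j \<subseteq> seg \<mu> i'" "cell p A h j \<subseteq> ?J" using cell_nested[OF \<mu>h x(1) xc] by auto
        have eq: "cell p ?J h j = cell p A h j" using sub(2) by (auto simp: cell_iff)
        have "mix f \<Theta> w (tri l) ?I ?r (cell p A h j) \<le> 2 powr e * ((\<Sum>x\<in>?I. \<nu> x) ^ tri l * (\<Sum>x\<in>cell p A h j. \<nu> x) ^ ?r)"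
          unfolding e_def by (rule bilinearD[OF K1(2) sy bd Qh hQ lg]) (use sep sub(1) in blast)
        also have "\<dots> \<le> 2 powr e * (?V ^ tri l * (\<Sum>x\<in>cell p A h j. \<nu> x) ^ ?r)"
          by (intro mult_left_mono mult_right_mono power_mono cV zero_le_power) auto
        finally show ?thesis unfolding eq .
      qed
      have "mix f \<Theta> w (tri l) ?I ?r ?J
        \<le> (\<Sum>\<theta>\<in>\<Theta>. w \<theta> * (norm (expsum f ?I \<theta>) ^ (2 * tri l) * (?P * (\<Sum>j\<in>?S. norm (expsum f (cell p ?J h j) \<theta>) ^ (2 * ?r)))))"
        unfolding mix_def
        using w s by (intro sum_mono mult_left_mono norm_expsum_cells[OF finite_cell[OF A] _ \<mu>h] mult_nonneg_nonneg zero_le_power)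
          (auto simp: cell_def)
      also have "\<dots> = ?P * (\<Sum>j\<in>?S. mix f \<Theta> w (tri l) ?I ?r (cell p ?J h j))"
        unfolding mix_def sum_distrib_left by (subst sum.swap) (auto intro!: sum.cong simp: mult_ac)
      also have "\<dots> \<le> ?P * (\<Sum>j\<in>?S. 2 powr e * (?V ^ tri l * (\<Sum>x\<in>cell p ?J h j. \<nu> x) ^ ?r))"
        by (intro mult_left_mono sum_mono cb) auto
      also have "\<dots> = ?P * (2 powr e * ?V ^ tri l) * (\<Sum>j\<in>?S. (\<Sum>x\<in>cell p ?J h j. \<nu> x) ^ ?r)"
        by (simp add: sum_distrib_left mult_ac)
      also have "\<dots> \<le> ?P * (2 powr e * ?V ^ tri l) * (\<Sum>j\<in>?S. \<Sum>x\<in>cell p ?J h j. \<nu> x) ^ ?r"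
        using s V \<nu> finite_cell[OF A] by (intro mult_left_mono sum_pow_le) (auto intro: sum_nonneg)
      also have "\<dots> = ?P * (2 powr e * ?V ^ tri l) * (\<Sum>x\<in>?J. \<nu> x) ^ ?r"
        by (simp add: cell_decomp[OF finite_cell[OF A]])
      also have "\<dots> \<le> ?P * (2 powr e * ?V ^ tri l) * ?V ^ ?r"
        using V by (intro mult_left_mono power_mono cV) auto
      also have "\<dots> = ?P * 2 powr e * ?V ^ ?s"
        unfolding s(3)[symmetric, THEN arg_cong[where f = "(^) ?V"]] power_add by (simp only: mult_ac)
      also have "?P = 2 powr real ((h - \<mu>) * (2 * ?r))" by (rule powr_realpow[symmetric]) simp
      also have "2 powr real ((h - \<mu>) * (2 * ?r)) * 2 powr e = 2 powr (real ((h - \<mu>) * (2 * ?r)) + e)" by (rule powr_add[symmetric])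
      also have "2 powr (real ((h - \<mu>) * (2 * ?r)) + e) * ?V ^ ?s \<le> 2 powr (K + (\<eta> - \<beta>) * real n) * ?V ^ ?s"
      proof (intro mult_right_mono powr_mono zero_le_power V)
        have "(h - \<mu>) * (2 * ?r) \<le> h * (2 * ?s)" by (intro mult_le_mono) auto
        then have 1: "real ((h - \<mu>) * (2 * ?r)) \<le> real (h * (2 * ?s))" by (simp only: of_nat_le_iff)
        have "(2 * real ?s + 1) * real h \<le> \<alpha> * real h" using \<alpha> by (intro mult_right_mono) auto
        then have 2: "real (h * (2 * ?s)) - \<alpha> * real h \<le> - real h" by (simp add: algebra_simps)
        have "real n \<le> real Q * (real h + real Q)" using nh by (metis less_imp_le of_nat_add of_nat_le_iff of_nat_mult)
        then have "real n / real Q \<le> real h + real Q" using Q by (simp add: divide_le_eq mult.commute)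
        then have "2 * (\<epsilon> * real n) \<le> real h + real Q" by (simp add: \<epsilon>_def)
        then show "real ((h - \<mu>) * (2 * ?r)) + e \<le> K + (\<eta> - \<beta>) * real n"
          unfolding e_def K_def left_diff_distrib using 1 2 K0(1) \<open>\<beta> * real n \<le> \<epsilon> * real n\<close> by linarith
      qed auto
      finally show ?thesis .
    qed
  qed
qed

text \<open>The dichotomy is taken at the largest term \<open>z\<close>. If a term not adjacent to
  \<open>z\<close> is within a factor \<open>M\<close> of it, their product controls the whole sum.
  Otherwise the far terms together contribute at most one copy of the maximum and the at most three
  near ones at most three, hence the 4.\<close>

lemma broad_narrow:
  fixes F :: "int \<Rightarrow> complex"
  assumes I: "finite I" and card: "real (card I) \<le> M" and M: "1 \<le> M" and a: "0 < a" "0 < b"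
  shows "norm (\<Sum>i\<in>I. F i) ^ (2 * (a + b)) \<le> 4 ^ (2 * (a + b)) * (\<Sum>i\<in>I. norm (F i) ^ (2 * (a + b)))
    + M ^ (4 * (a + b)) * (\<Sum>i\<in>I. \<Sum>j\<in>I. if 2 \<le> \<bar>i - j\<bar> then norm (F i) ^ (2 * a) * norm (F j) ^ (2 * b) else 0)"
    (is "?L \<le> ?N + ?B")
proof (cases "I = {}")
  case True
  then show ?thesis using a by (simp add: zero_power)
next
  case False
  obtain z where z: "z \<in> I" "\<And>i. i \<in> I \<Longrightarrow> norm (F i) \<le> norm (F z)"
  proof -
    have fin: "finite ((\<lambda>i. norm (F i)) ` I)" using I by simp
    have "Max ((\<lambda>i. norm (F i)) ` I) \<in> (\<lambda>i. norm (F i)) ` I" using False I by (intro Max_in) auto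
    then obtain z where "z \<in> I" "Max ((\<lambda>i. norm (F i)) ` I) = norm (F z)" by blast
    with that Max_ge[OF fin] show ?thesis by (metis imageI)
  qed
  define X where "X = norm (F z)"
  have X: "0 \<le> X" by (simp add: X_def)
  have N0: "0 \<le> ?N" and B0: "0 \<le> ?B" using M by (auto intro!: mult_nonneg_nonneg sum_nonneg)
  show ?thesis
  proof (cases "\<exists>j\<in>I. 2 \<le> \<bar>z - j\<bar> \<and> X \<le> M * norm (F j)")
    case True
    then obtain j where j: "j \<in> I" "2 \<le> \<bar>z - j\<bar>" "X \<le> M * norm (F j)" by blast
    have "norm (\<Sum>i\<in>I. F i) \<le> (\<Sum>i\<in>I. norm (F i))" by (rule norm_sum)
    also have "\<dots> \<le> real (card I) * X" using z(2) by (intro sum_bounded_above) (auto simp: X_def)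
    also have "\<dots> \<le> M * X" using card X by (rule mult_right_mono)
    finally have "?L \<le> (M * X) ^ (2 * (a + b))" by (intro power_mono) auto
    also have "\<dots> = M ^ (2 * (a + b)) * (X ^ (2 * a) * X ^ (2 * b))" by (simp add: power_mult_distrib power_add distrib_left)
    also have "\<dots> \<le> M ^ (2 * (a + b)) * (X ^ (2 * a) * (M * norm (F j)) ^ (2 * b))"
      using j X M by (intro mult_left_mono power_mono) auto
    also have "\<dots> = M ^ (2 * (a + b) + 2 * b) * (X ^ (2 * a) * norm (F j) ^ (2 * b))"
      by (simp only: power_mult_distrib power_add[of M] mult_ac)
    also have "\<dots> \<le> M ^ (4 * (a + b)) * (X ^ (2 * a) * norm (F j) ^ (2 * b))"
      using M X by (intro mult_right_mono power_increasing) auto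
    also have "\<dots> \<le> ?B"
    proof (intro mult_left_mono)
      let ?t = "\<lambda>i j. if 2 \<le> \<bar>i - j\<bar> then norm (F i) ^ (2 * a) * norm (F j) ^ (2 * b) else 0"
      have "X ^ (2 * a) * norm (F j) ^ (2 * b) = ?t z j" using j by (simp add: X_def)
      also have "\<dots> \<le> (\<Sum>j\<in>I. ?t z j)" by (rule member_le_sum[OF j(1) _ I]) auto
      also have "\<dots> \<le> (\<Sum>i\<in>I. \<Sum>j\<in>I. ?t i j)" by (rule member_le_sum[OF z(1) _ I]) (auto intro: sum_nonneg)
      finally show "X ^ (2 * a) * norm (F j) ^ (2 * b) \<le> (\<Sum>i\<in>I. \<Sum>j\<in>I. ?t i j)" .
    qed (use M in auto)
    finally show ?thesis using N0 by linarith
  next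
    case False
    let ?n = "{i\<in>I. \<bar>z - i\<bar> < 2}" and ?f = "{i\<in>I. \<not> \<bar>z - i\<bar> < 2}"
    have far: "norm (F i) \<le> X / M" if "i \<in> ?f" for i
    proof -
      have "M * norm (F i) < X" using False that by (auto simp: not_le)
      then show ?thesis using M by (simp add: le_divide_eq mult.commute less_imp_le)
    qed
    have c3: "card ?n \<le> 3"
    proof -
      have "card ?n \<le> card {z - 1 .. z + 1}" by (intro card_mono) auto
      then show ?thesis by simp
    qed
    have "norm (\<Sum>i\<in>I. F i) \<le> (\<Sum>i\<in>I. norm (F i))" by (rule norm_sum)
    also have "\<dots> = (\<Sum>i\<in>?n. norm (F i)) + (\<Sum>i\<in>?f. norm (F i))"
      using I by (subst sum.union_disjoint[symmetric]) (auto intro: sum.cong)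
    also have "(\<Sum>i\<in>?n. norm (F i)) \<le> real (card ?n) * X" using z(2) by (intro sum_bounded_above) (auto simp: X_def)
    also have "real (card ?n) * X \<le> 3 * X" using c3 X by (intro mult_right_mono) auto
    also have "(\<Sum>i\<in>?f. norm (F i)) \<le> real (card ?f) * (X / M)" using far by (intro sum_bounded_above) auto
    also have "\<dots> \<le> M * (X / M)"
    proof (intro mult_right_mono)
      have "card ?f \<le> card I" using I by (intro card_mono) auto
      then show "real (card ?f) \<le> M" using card by linarith
    qed (use X M in auto)
    also have "3 * X + M * (X / M) = 4 * X" using M by simp
    finally have "?L \<le> (4 * X) ^ (2 * (a + b))" by (intro power_mono) auto
    also have "\<dots> = 4 ^ (2 * (a + b)) * norm (F z) ^ (2 * (a + b))" by (simp add: power_mult_distrib X_def)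
    also have "\<dots> \<le> ?N" using z I by (intro mult_left_mono member_le_sum) auto
    finally show ?thesis using B0 by linarith
  qed
qed

text \<open>
  Broad-narrow analysis at the fixed scale \<open>2 ^ -\<mu>\<close>: the constant lost in each narrow step is beaten
  by \<open>2 powr (- \<eta>' * \<mu>)\<close>, and the broad part is bilinear, where \<open>bilin_broad\<close> gains \<open>\<beta>\<close>.
\<close>

lemma decoupling_gain:
  assumes bl: "bilin TYPE('t) k \<eta> l \<alpha> Q" and dec: "decoupling TYPE('t) k \<eta>"
    and l: "0 < l" "l < k" and Q: "0 < Q" and \<alpha>: "2 * real (tri k) + 1 \<le> \<alpha>"
    and \<beta>: "0 < \<beta>" "\<beta> \<le> 1 / (2 * real Q)" "\<beta> < \<eta>"
  shows "decoupling TYPE('t) k (\<eta> - \<beta>)"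
  unfolding decoupling_def
proof (intro allI impI)
  fix C :: real assume C: "C \<ge> 1"
  let ?s = "tri k" and ?r = "tri k - tri l"
  have k: "0 < k" using l by simp
  have s: "0 < tri l" "0 < ?r" "tri l + ?r = ?s" "0 < ?s" using l tri_pos tri_less[of l k] by auto
  have C2: "1 \<le> 2 ^ k * C" using mult_mono[OF one_le_power C, of 2 k] by simp
  define \<eta>' where "\<eta>' = \<eta> - \<beta>"
  have \<eta>': "0 < \<eta>'" using \<beta> by (simp add: \<eta>'_def)
  \<comment> \<open>A narrow step loses \<open>4 ^ (2 * tri k) = 2 ^ (4 * tri k)\<close> and saves
    \<open>2 powr (\<eta>' * \<mu>)\<close>. The extra 1 leaves half of the final bound to the broad
    term.\<close>
  obtain \<mu> :: nat where \<mu>: "(4 * real ?s + 1) / \<eta>' < real \<mu>" using reals_Archimedean2 by blast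
  have \<mu>': "4 * real ?s + 1 \<le> \<eta>' * real \<mu>" using \<mu> \<eta>' by (simp add: divide_less_eq mult.commute)
  obtain K0 where K0: "K0 \<ge> 0" "decoupled TYPE('t) k \<eta> (2 ^ k * C) K0" using dec C2 unfolding decoupling_def by blast
  obtain K2 where K2: "K2 \<ge> 0" "\<And>n q G p A (f :: real \<Rightarrow> 't \<Rightarrow> complex) \<Theta> w \<nu> i (i' :: int).
     sys k (2 ^ k * C) n q G p A f \<Theta> w \<Longrightarrow> cellbd n (tri k) p A f \<Theta> w \<nu> \<Longrightarrow> 2 \<le> \<bar>i - i'\<bar> \<Longrightarrow> \<mu> \<le> n \<Longrightarrow>
     mix f \<Theta> w (tri l) (cell p A \<mu> i) (tri k - tri l) (cell p A \<mu> i')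
       \<le> 2 powr (K2 + \<eta>' * real n) * (\<Sum>x\<in>A. \<nu> x) ^ tri k"
    using bilin_broad[OF bl dec l Q \<alpha> \<beta>(2) C2, of \<mu>] unfolding \<eta>'_def by metis
  \<comment> \<open>The first two terms serve the cells with fewer than \<open>\<mu>\<close> scales
    left, where the old exponent is used. The bracket bounds the broad term summed over all pairs of
    cells, with a factor 2 to spare.\<close>
  define K where "K = K0 + \<eta> * real \<mu> + (4 * real ?s * real \<mu> + 2 * real \<mu> + K2 + 1)"
  have \<eta>0: "0 < \<eta>" using \<beta> by simp
  have K: "0 \<le> K" "K0 + \<eta> * real \<mu> \<le> K" "4 * real ?s * real \<mu> + 2 * real \<mu> + K2 + 1 \<le> K"
    using K0(1) K2(1) \<eta>0 by (auto simp: K_def)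
  have "decoupled TYPE('t) k \<eta>' C K"
    unfolding decoupled_def
  proof (intro allI impI)
    fix n q G p A \<Theta> w \<nu> and f :: "real \<Rightarrow> 't \<Rightarrow> complex"
    assume sy: "sys k C n q G p A f \<Theta> w" and bd: "cellbd n ?s p A f \<Theta> w \<nu>"
    have \<nu>: "0 \<le> \<nu> x" for x using bd by (simp add: cellbd_def)
    have w: "\<And>\<theta>. 0 \<le> w \<theta>" and T: "finite \<Theta>" and A: "finite A" using sy by (auto simp: sys_def)
    \<comment> \<open>The induction runs from short cells to long ones. Its narrow term uses the
      estimate at \<open>e + \<mu>\<close> with the same \<open>K\<close>, so the loss has to be
      beaten without enlarging \<open>K\<close>.\<close>
    have main: "mom f \<Theta> w ?s (cell p A e i) \<le> 2 powr (K + \<eta>' * real (n - e)) * (\<Sum>x\<in>cell p A e i. \<nu> x) ^ ?s" if "e \<le> n" for e i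
      using that
    proof (induction "n - e" arbitrary: e i rule: less_induct)
      case less
      note en = \<open>e \<le> n\<close>
      let ?B = "cell p A e i" and ?V = "\<Sum>x\<in>cell p A e i. \<nu> x"
      have V: "0 \<le> ?V" using \<nu> by (auto intro: sum_nonneg)
      have B: "finite ?B" by (rule finite_cell[OF A])
      show ?case
      proof (cases "n - e < \<mu> \<or> ?B = {}")
        case True
        show ?thesis
        proof (cases "?B = {}")
          case True
          then show ?thesis using s by (simp add: mom_empty zero_power)
        next
          case False
          then have ne: "real (n - e) \<le> real \<mu>" using True by simp
          have "mom f \<Theta> w ?s ?B \<le> 2 powr (K0 + \<eta> * real (n - e)) * ?V ^ ?s"
            by (rule decoupled_cell[OF K0(2) C k sy bd en])
          also have "\<dots> \<le> 2 powr (K + \<eta>' * real (n - e)) * ?V ^ ?s"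
          proof (intro mult_right_mono powr_mono zero_le_power V)
            have "\<eta> * real (n - e) \<le> \<eta> * real \<mu>" using \<eta>0 ne by (intro mult_left_mono) auto
            moreover have "0 \<le> \<eta>' * real (n - e)" using \<eta>' by simp
            ultimately show "K0 + \<eta> * real (n - e) \<le> K + \<eta>' * real (n - e)" using K(2) by linarith
          qed auto
          finally show ?thesis .
        qed
      next
        case False
        then have ne: "?B \<noteq> {}" and \<mu>n: "e + \<mu> \<le> n" "\<mu> \<le> n - e" using en by auto
        have "0 < \<mu>"
        proof (rule ccontr)
          assume "\<not> 0 < \<mu>" then show False using \<mu>' by simp
        qed
        let ?S = "(\<lambda>x. \<lfloor>p x * 2 ^ (e + \<mu>)\<rfloor>) ` ?B"
        let ?c = "cell p ?B (e + \<mu>)"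
        let ?D = "2 powr (\<eta>' * real (n - e)) * ?V ^ ?s"
        have D: "0 \<le> ?D" using V by simp
        have card: "card ?S \<le> 2 ^ \<mu>"
          using card_cells[of ?B i p e "e + \<mu>"] by (auto simp: cell_def)
        have rcard: "real (card ?S) \<le> 2 ^ \<mu>"
        proof -
          have "real (card ?S) \<le> real (2 ^ \<mu>)" using card by (simp only: of_nat_le_iff)
          then show ?thesis by simp
        qed
        obtain q' G' where sy': "sys k (2 ^ k * C) (n - e) q' G' (\<lambda>x. p x * 2 ^ e - of_int i) ?B f \<Theta> w"
          using sys_cell[OF sy C en ne] by blast
        have bd': "cellbd (n - e) ?s (\<lambda>x. p x * 2 ^ e - of_int i) ?B f \<Theta> w \<nu>"
          by (rule cellbd_rescale[OF en cellbd_cell[OF bd en s(4)]])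
        have cr: "?c j = cell (\<lambda>x. p x * 2 ^ e - of_int i) ?B \<mu> (j - i * 2 ^ \<mu>)" for j
          using cell_rescale[of e "e + \<mu>" p i ?B "j - i * 2 ^ \<mu>"] by simp
        have broad: "mix f \<Theta> w (tri l) (?c j) ?r (?c j') \<le> 2 powr K2 * ?D" if "2 \<le> \<bar>j - j'\<bar>" for j j'
        proof -
          have jj: "2 \<le> \<bar>(j - i * 2 ^ \<mu>) - (j' - i * 2 ^ \<mu>)\<bar>" using that by simp
          show ?thesis using K2(2)[OF sy' bd' jj \<mu>n(2)] unfolding cr by (simp add: powr_add mult.assoc)
        qed
        have narrow: "mom f \<Theta> w ?s (?c j) \<le> 2 powr (K + \<eta>' * real (n - e) - \<eta>' * real \<mu>) * (\<Sum>x\<in>?c j. \<nu> x) ^ ?s" for j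
        proof (cases "?c j = {}")
          case True
          then show ?thesis using s by (simp add: mom_empty zero_power)
        next
          case False
          then have eq: "?c j = cell p A (e + \<mu>) j" using cell_cell_cases[of e "e + \<mu>"] by (metis le_add1)
          have "n - (e + \<mu>) < n - e" using \<mu>n \<open>0 < \<mu>\<close> by linarith
          from less.hyps[OF this \<mu>n(1), of j]
          have "mom f \<Theta> w ?s (?c j) \<le> 2 powr (K + \<eta>' * real (n - (e + \<mu>))) * (\<Sum>x\<in>?c j. \<nu> x) ^ ?s" unfolding eq .
          also have "real (n - (e + \<mu>)) = real (n - e) - real \<mu>" using \<mu>n by simp
          finally show ?thesis by (simp add: right_diff_distrib add_diff_eq)
        qed
        have pw: "norm (expsum f ?B \<theta>) ^ (2 * ?s) \<le> 4 ^ (2 * ?s) * (\<Sum>j\<in>?S. norm (expsum f (?c j) \<theta>) ^ (2 * ?s))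
           + (2 ^ \<mu>) ^ (4 * ?s) * (\<Sum>j\<in>?S. \<Sum>j'\<in>?S. if 2 \<le> \<bar>j - j'\<bar> then norm (expsum f (?c j) \<theta>) ^ (2 * tri l) * norm (expsum f (?c j') \<theta>) ^ (2 * ?r) else 0)" for \<theta>
          unfolding expsum_cells[OF B, of f \<theta> p "e + \<mu>"]
          using broad_narrow[OF finite_imageI[OF B] rcard _ s(1,2), of "\<lambda>j. expsum f (?c j) \<theta>"] unfolding s(3) by simp
        have "mom f \<Theta> w ?s ?B \<le> (\<Sum>\<theta>\<in>\<Theta>. w \<theta> * (4 ^ (2 * ?s) * (\<Sum>j\<in>?S. norm (expsum f (?c j) \<theta>) ^ (2 * ?s))
           + (2 ^ \<mu>) ^ (4 * ?s) * (\<Sum>j\<in>?S. \<Sum>j'\<in>?S. if 2 \<le> \<bar>j - j'\<bar> then norm (expsum f (?c j) \<theta>) ^ (2 * tri l) * norm (expsum f (?c j') \<theta>) ^ (2 * ?r) else 0)))"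
          unfolding mom_def using w by (intro sum_mono mult_left_mono pw)
        also have "\<dots> = 4 ^ (2 * ?s) * (\<Sum>j\<in>?S. mom f \<Theta> w ?s (?c j))
           + (2 ^ \<mu>) ^ (4 * ?s) * (\<Sum>j\<in>?S. \<Sum>j'\<in>?S. if 2 \<le> \<bar>j - j'\<bar> then mix f \<Theta> w (tri l) (?c j) ?r (?c j') else 0)"
        proof -
          have 1: "(\<Sum>\<theta>\<in>\<Theta>. w \<theta> * (\<Sum>j\<in>?S. norm (expsum f (?c j) \<theta>) ^ (2 * ?s))) = (\<Sum>j\<in>?S. mom f \<Theta> w ?s (?c j))"
            unfolding mom_def sum_distrib_left by (rule sum.swap)
          have "(\<Sum>\<theta>\<in>\<Theta>. w \<theta> * (\<Sum>j\<in>?S. \<Sum>j'\<in>?S. if 2 \<le> \<bar>j - j'\<bar> then norm (expsum f (?c j) \<theta>) ^ (2 * tri l) * norm (expsum f (?c j') \<theta>) ^ (2 * ?r) else 0))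
            = (\<Sum>j\<in>?S. \<Sum>\<theta>\<in>\<Theta>. \<Sum>j'\<in>?S. w \<theta> * (if 2 \<le> \<bar>j - j'\<bar> then norm (expsum f (?c j) \<theta>) ^ (2 * tri l) * norm (expsum f (?c j') \<theta>) ^ (2 * ?r) else 0))"
            unfolding sum_distrib_left by (rule sum.swap)
          also have "\<dots> = (\<Sum>j\<in>?S. \<Sum>j'\<in>?S. if 2 \<le> \<bar>j - j'\<bar> then mix f \<Theta> w (tri l) (?c j) ?r (?c j') else 0)"
            unfolding mix_def by (intro sum.cong refl, subst sum.swap) (auto intro!: sum.cong)
          finally have 2: "(\<Sum>\<theta>\<in>\<Theta>. w \<theta> * (\<Sum>j\<in>?S. \<Sum>j'\<in>?S. if 2 \<le> \<bar>j - j'\<bar> then norm (expsum f (?c j) \<theta>) ^ (2 * tri l) * norm (expsum f (?c j') \<theta>) ^ (2 * ?r) else 0))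
             = (\<Sum>j\<in>?S. \<Sum>j'\<in>?S. if 2 \<le> \<bar>j - j'\<bar> then mix f \<Theta> w (tri l) (?c j) ?r (?c j') else 0)" .
          show ?thesis unfolding 1[symmetric] 2[symmetric] sum_distrib_left[of "4 ^ (2 * ?s)" _ \<Theta>] sum_distrib_left[of "(2 ^ \<mu>) ^ (4 * ?s)" _ \<Theta>] sum.distrib[symmetric]
            by (intro sum.cong refl) (simp only: distrib_left mult.left_commute)
        qed
        also have "\<dots> \<le> 4 ^ (2 * ?s) * (2 powr (K - \<eta>' * real \<mu>) * ?D) + (2 ^ \<mu>) ^ (4 * ?s) * ((2 ^ \<mu> * 2 ^ \<mu>) * (2 powr K2 * ?D))"
        proof (intro add_mono mult_left_mono)
          have "(\<Sum>j\<in>?S. mom f \<Theta> w ?s (?c j)) \<le> (\<Sum>j\<in>?S. 2 powr (K + \<eta>' * real (n - e) - \<eta>' * real \<mu>) * (\<Sum>x\<in>?c j. \<nu> x) ^ ?s)"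
            by (intro sum_mono narrow)
          also have "\<dots> = 2 powr (K + \<eta>' * real (n - e) - \<eta>' * real \<mu>) * (\<Sum>j\<in>?S. (\<Sum>x\<in>?c j. \<nu> x) ^ ?s)"
            by (rule sum_distrib_left[symmetric])
          also have "\<dots> \<le> 2 powr (K + \<eta>' * real (n - e) - \<eta>' * real \<mu>) * (\<Sum>j\<in>?S. \<Sum>x\<in>?c j. \<nu> x) ^ ?s"
            using s \<nu> B by (intro mult_left_mono sum_pow_le) (auto intro: sum_nonneg)
          also have "\<dots> = 2 powr (K - \<eta>' * real \<mu>) * ?D"
            unfolding cell_decomp[OF B] by (simp add: algebra_simps flip: powr_add)
          finally show "(\<Sum>j\<in>?S. mom f \<Theta> w ?s (?c j)) \<le> 2 powr (K - \<eta>' * real \<mu>) * ?D" .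
          have "(\<Sum>j\<in>?S. \<Sum>j'\<in>?S. if 2 \<le> \<bar>j - j'\<bar> then mix f \<Theta> w (tri l) (?c j) ?r (?c j') else 0) \<le> (\<Sum>j\<in>?S. \<Sum>j'\<in>?S. 2 powr K2 * ?D)"
            using broad D by (intro sum_mono) auto
          also have "\<dots> = real (card ?S) * (real (card ?S) * (2 powr K2 * ?D))" by simp
          also have "\<dots> \<le> 2 ^ \<mu> * (2 ^ \<mu> * (2 powr K2 * ?D))"
            using rcard D V by (intro mult_mono mult_right_mono mult_nonneg_nonneg) auto
          finally show "(\<Sum>j\<in>?S. \<Sum>j'\<in>?S. if 2 \<le> \<bar>j - j'\<bar> then mix f \<Theta> w (tri l) (?c j) ?r (?c j') else 0) \<le> (2 ^ \<mu> * 2 ^ \<mu>) * (2 powr K2 * ?D)"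
            by (simp only: mult.assoc)
        qed auto
        also have "\<dots> = (2 powr (4 * real ?s + (K - \<eta>' * real \<mu>)) + 2 powr (4 * real ?s * real \<mu> + 2 * real \<mu> + K2)) * ?D"
        proof -
          have 1: "(4::real) ^ (2 * ?s) = 2 powr (4 * real ?s)"
          proof -
            have "(4::real) ^ (2 * ?s) = (2 ^ 2) ^ (2 * ?s)" by simp
            also have "\<dots> = 2 ^ (4 * ?s)" unfolding power_mult[symmetric] by simp
            also have "\<dots> = 2 powr real (4 * ?s)" by (rule powr_realpow[symmetric]) simp
            finally show ?thesis by simp
          qed
          have 2: "((2::real) ^ \<mu>) ^ (4 * ?s) * (2 ^ \<mu> * 2 ^ \<mu>) = 2 powr (4 * real ?s * real \<mu> + 2 * real \<mu>)"
          proof -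
            have "((2::real) ^ \<mu>) ^ (4 * ?s) * (2 ^ \<mu> * 2 ^ \<mu>) = 2 ^ (\<mu> * (4 * ?s) + (\<mu> + \<mu>))"
              unfolding power_mult[symmetric] power_add ..
            also have "\<dots> = 2 powr real (\<mu> * (4 * ?s) + (\<mu> + \<mu>))" by (rule powr_realpow[symmetric]) simp
            finally show ?thesis by (simp add: mult_ac add.commute)
          qed
          have "(2 ^ \<mu>) ^ (4 * ?s) * ((2 ^ \<mu> * 2 ^ \<mu>) * (2 powr K2 * ?D)) = 2 powr (4 * real ?s * real \<mu> + 2 * real \<mu> + K2) * ?D"
            unfolding powr_add[of 2 _ K2] 2[symmetric] by (simp only: mult_ac)
          then show ?thesis unfolding 1 distrib_right powr_add[of 2 "4 * real ?s" "K - \<eta>' * real \<mu>"] by (simp only: mult.assoc)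
        qed
        also have "\<dots> \<le> (2 powr (K - 1) + 2 powr (K - 1)) * ?D"
          using \<mu>' K(3) by (intro mult_right_mono[OF _ D] add_mono powr_mono) auto
        also have "\<dots> = 2 powr K * ?D" by (simp add: powr_diff)
        also have "\<dots> = 2 powr (K + \<eta>' * real (n - e)) * ?V ^ ?s" by (simp add: powr_add)
        finally show ?thesis .
      qed
    qed
    have "cell p A 0 0 = A" using sy by (auto simp: cell_def sys_def)
    then show "mom f \<Theta> w ?s A \<le> 2 powr (K + \<eta>' * real n) * (\<Sum>x\<in>A. \<nu> x) ^ ?s"
      using main[of 0 0] by simp
  qed
  then show "\<exists>K\<ge>0. decoupled TYPE('t) k (\<eta> - \<beta>) C K" using K(1) unfolding \<eta>'_def by blast
qed

text \<open>By induction on \<open>k\<close>. For fixed \<open>k\<close> the exponent descends from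
  the trivial one in steps of a constant \<open>\<beta>\<close>; the steps do not shrink because
  \<open>gain_large\<close> is uniform for all exponents from \<open>\<epsilon> / 2\<close>
  on.\<close>

theorem decoupling_moment_curve:
  assumes "0 < k" "0 < \<epsilon>"
  shows "decoupling TYPE('t) k \<epsilon>"
  using assms
proof (induction k arbitrary: \<epsilon> rule: less_induct)
  case (less k)
  show ?case
  proof (cases "k = 1")
    case True
    then show ?thesis using decoupling_mono[OF decoupling_1, of \<epsilon>, where 't = 't] less.prems by auto
  next
    case False
    then have k: "2 \<le> k" using less.prems by simp
    have low: "\<And>m \<epsilon>. 0 < m \<Longrightarrow> m < k \<Longrightarrow> 0 < \<epsilon> \<Longrightarrow> decoupling TYPE('t) m \<epsilon>" using less.IH by blast
    obtain r where r: "\<And>\<eta>. \<epsilon> / 2 \<le> \<eta> \<Longrightarrow> \<exists>l\<in>{1..<k}. 2 * real (tri k) + 1 \<le> gain k \<eta> r l"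
      using gain_large[OF k, of "\<epsilon> / 2"] less.prems by auto
    define Q :: nat where "Q = fact k ^ Suc r"
    have Q: "0 < Q" by (simp add: Q_def)
    \<comment> \<open>The first bound is the one \<open>bilin_broad\<close> can deliver; the second
      keeps \<open>\<eta> - \<beta>\<close> positive.\<close>
    define \<beta> where "\<beta> = min (1 / (2 * real Q)) (\<epsilon> / 4)"
    have \<beta>: "0 < \<beta>" "\<beta> \<le> 1 / (2 * real Q)" "\<beta> \<le> \<epsilon> / 4" using Q less.prems by (auto simp: \<beta>_def)
    have step: "decoupling TYPE('t) k (\<eta> - \<beta>)" if \<eta>: "\<epsilon> / 2 \<le> \<eta>" and d: "decoupling TYPE('t) k \<eta>" for \<eta>
    proof -
      obtain l where "l \<in> {1..<k}" and lg: "2 * real (tri k) + 1 \<le> gain k \<eta> r l" using r[OF \<eta>] by blast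
      then have l: "0 < l" "l < k" by auto
      have \<eta>0: "0 \<le> \<eta>" "\<beta> < \<eta>" using \<eta> \<beta> less.prems by auto
      show ?thesis
        by (rule decoupling_gain[OF bilin_gain[OF \<eta>0(1) d low l(1,2)] d l(1,2) _ lg \<beta>(1) _ \<eta>0(2)])
          (use Q \<beta> in \<open>auto simp: Q_def\<close>)
    qed
    have it: "decoupling TYPE('t) k (max \<epsilon> (real (2 * tri k) - real N * \<beta>))" for N
    proof (induction N)
      case 0
      show ?case by (rule decoupling_mono[OF decoupling_trivial[OF less.prems(1)]]) simp
    next
      case (Suc N)
      let ?\<eta> = "max \<epsilon> (real (2 * tri k) - real N * \<beta>)"
      have "\<epsilon> / 2 \<le> ?\<eta>" using less.prems by (intro max.coboundedI1) auto
      then have "decoupling TYPE('t) k (?\<eta> - \<beta>)" by (rule step[OF _ Suc])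
      then show ?case by (rule decoupling_mono) (use \<beta> in \<open>auto simp: max_def algebra_simps\<close>)
    qed
    obtain N where "real (2 * tri k) < real N * \<beta>" using reals_Archimedean3[OF \<beta>(1)] by blast
    then have "max \<epsilon> (real (2 * tri k) - real N * \<beta>) = \<epsilon>" using less.prems by (auto simp: max_def)
    then show ?thesis using it[of N] by simp
  qed
qed

section \<open>Sumsets of well-spaced points on the moment curve\<close>

definition tuples :: "nat \<Rightarrow> real set \<Rightarrow> real list set" where
  "tuples s A = {xs. set xs \<subseteq> A \<and> length xs = s}"

definition power_sums :: "nat \<Rightarrow> real list \<Rightarrow> real vec" where
  "power_sums k xs = Matrix.vec k (\<lambda>j. \<Sum>x\<leftarrow>xs. x ^ Suc j)"

lemma finite_tuples: "finite A \<Longrightarrow> finite (tuples s A)"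
  unfolding tuples_def by (rule finite_lists_length_eq)

lemma card_tuples: "finite A \<Longrightarrow> card (tuples s A) = card A ^ s"
  unfolding tuples_def by (rule card_lists_length_eq)

lemma tuples_mono: "A \<subseteq> B \<Longrightarrow> tuples s A \<subseteq> tuples s B"
  by (auto simp: tuples_def)

lemma power_sums_carrier: "power_sums k xs \<in> carrier_vec k"
  by (simp add: power_sums_def)

lemma power_sums_index: "j < k \<Longrightarrow> vec_index (power_sums k xs) j = (\<Sum>x\<leftarrow>xs. x ^ Suc j)"
  by (simp add: power_sums_def)

lemma power_sums_append: "power_sums k (xs @ ys) = power_sums k xs + power_sums k ys"
  by (intro eq_vecI) (auto simp: power_sums_def)

text \<open>From here on tuples are lists, which can be split and concatenated.\<close>

lemma nfold_sumset_power_sums: "nfold_sumset k s (moment_curve k A) = power_sums k ` tuples s A"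
proof (intro equalityI subsetI)
  have main: "finsum_vec TYPE(real) k (\<lambda>i. Matrix.vec k (\<lambda>j. a i ^ Suc j)) {..<s} = power_sums k (map a [0..<s])" for a :: "nat \<Rightarrow> real"
  proof (rule eq_vecI)
    have c: "(\<lambda>i. Matrix.vec k (\<lambda>j. a i ^ Suc j)) \<in> {..<s} \<rightarrow> carrier_vec k" by auto
    show "dim_vec (finsum_vec TYPE(real) k (\<lambda>i. Matrix.vec k (\<lambda>j. a i ^ Suc j)) {..<s}) = dim_vec (power_sums k (map a [0..<s]))"
      using finsum_vec_closed[OF c] by (simp add: power_sums_def)
    fix j assume "j < dim_vec (power_sums k (map a [0..<s]))"
    then have j: "j < k" by (simp add: power_sums_def)
    show "vec_index (finsum_vec TYPE(real) k (\<lambda>i. Matrix.vec k (\<lambda>j. a i ^ Suc j)) {..<s}) j = vec_index (power_sums k (map a [0..<s])) j"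
      using j by (subst index_finsum_vec[OF _ j c]) (auto simp: power_sums_def sum_list_distinct_conv_sum_set comp_def atLeast0LessThan)
  qed
  {
    fix v assume "v \<in> nfold_sumset k s (moment_curve k A)"
    then obtain b where b: "v = finsum_vec TYPE(real) k b {..<s}" "b \<in> {..<s} \<rightarrow> moment_curve k A"
      by (auto simp: nfold_sumset_def)
    then have "\<forall>i\<in>{..<s}. \<exists>a\<in>A. b i = Matrix.vec k (\<lambda>j. a ^ Suc j)" by (auto simp: moment_curve_def Pi_def image_iff)
    then obtain a where a: "\<And>i. i < s \<Longrightarrow> a i \<in> A \<and> b i = Matrix.vec k (\<lambda>j. a i ^ Suc j)" by (metis lessThan_iff)
    have "v = finsum_vec TYPE(real) k (\<lambda>i. Matrix.vec k (\<lambda>j. a i ^ Suc j)) {..<s}"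
      unfolding b(1) finsum_vec_def by (rule comm_monoid.finprod_cong'[OF comm_monoid_vec]) (use a in \<open>auto simp: monoid_vec_simps\<close>)
    also have "\<dots> = power_sums k (map a [0..<s])" by (rule main)
    finally show "v \<in> power_sums k ` tuples s A" by (rule image_eqI) (use a in \<open>auto simp: tuples_def\<close>)
  }
  fix v assume "v \<in> power_sums k ` tuples s A"
  then obtain xs where xs: "v = power_sums k xs" "set xs \<subseteq> A" "length xs = s" by (auto simp: tuples_def)
  have "xs = map ((!) xs) [0..<s]" unfolding xs(3)[symmetric] by (rule map_nth[symmetric])
  then have "v = finsum_vec TYPE(real) k (\<lambda>i. Matrix.vec k (\<lambda>j. (xs ! i) ^ Suc j)) {..<s}"
    using main[of "(!) xs"] xs(1) by metis
  moreover have "(\<lambda>i. Matrix.vec k (\<lambda>j. (xs ! i) ^ Suc j)) \<in> {..<s} \<rightarrow> moment_curve k A"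
    using xs(2,3) nth_mem by (auto simp: moment_curve_def)
  ultimately show "v \<in> nfold_sumset k s (moment_curve k A)" by (auto simp: nfold_sumset_def)
qed

section \<open>Counting solutions by finite characters; the mean value estimate\<close>

lemma prod_list_cis: "(\<Prod>x\<leftarrow>xs. cis (h x)) = cis (\<Sum>x\<leftarrow>xs. h x)"
  by (induction xs) (auto simp: cis_mult)

lemma cis_sum: "cis (\<Sum>u\<in>S. h u) = (\<Prod>u\<in>S. cis (h u))"
  by (induction S rule: infinite_finite_induct) (auto simp flip: cis_mult)

lemma sum_list_sum_swap:
  fixes h :: "'a \<Rightarrow> 'b \<Rightarrow> real"
  shows "(\<Sum>x\<leftarrow>xs. \<Sum>u\<in>S. h x u) = (\<Sum>u\<in>S. \<Sum>x\<leftarrow>xs. h x u)"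
  by (induction xs) (auto simp: sum.distrib)

text \<open>
  Averaging over the subset sums of suitable frequencies kills every nonzero frequency
  \<open>v\<close> of a finite set: the factor belonging to \<open>v\<close> itself is \<open>1 + cis pi = 0\<close>. This replaces
  integration over a torus by a finite sum.
\<close>

lemma character_system:
  fixes g :: "nat \<Rightarrow> real \<Rightarrow> real"
  assumes A: "finite A"
  obtains f :: "real \<Rightarrow> (nat \<Rightarrow> real) set \<Rightarrow> complex" and \<Theta> and w
  where "finite \<Theta>" "\<And>\<theta>. 0 \<le> w \<theta>" "(\<Sum>\<theta>\<in>\<Theta>. w \<theta>) = 1" "\<And>x \<theta>. norm (f x \<theta>) = 1"
    "\<And>xs ys. xs \<in> tuples s A \<Longrightarrow> ys \<in> tuples s A \<Longrightarrow>
      corr f \<Theta> w xs ys = (if \<forall>j<k. gap g p xs ys j = 0 then 1 else 0)"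
proof -
  define V where "V = (\<lambda>(xs, ys). gap g p xs ys) ` (tuples s A \<times> tuples s A) \<inter> {v. \<exists>j<k. v j \<noteq> 0}"
  define J where "J u = (SOME j. j < k \<and> u j \<noteq> 0)" for u :: "nat \<Rightarrow> real"
  have V: "finite V" using finite_tuples[OF A] by (auto simp: V_def)
  have J: "J u < k" "u (J u) \<noteq> 0" if "u \<in> V" for u
  proof -
    have "\<exists>j. j < k \<and> u j \<noteq> 0" using that by (auto simp: V_def)
    from someI_ex[OF this] show "J u < k" "u (J u) \<noteq> 0" by (auto simp: J_def)
  qed
  \<comment> \<open>The frequency belonging to \<open>u\<close> sits in a coordinate
    \<open>J u\<close> where \<open>u\<close> does not vanish. Against the gap \<open>u\<close>
    itself it has phase \<open>pi\<close>, against a zero gap phase 0; for zero gaps every factor is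
    2, which the weight normalises.\<close>
  define f where "f x \<theta> = cis (\<Sum>u\<in>\<theta>. pi / u (J u) * g (J u) (p x))" for x :: real and \<theta> :: "(nat \<Rightarrow> real) set"
  define w :: "(nat \<Rightarrow> real) set \<Rightarrow> real" where "w \<theta> = 1 / 2 ^ card V" for \<theta>
  have cp: "card (Pow V) = 2 ^ card V" by (rule card_Pow[OF V])
  have main: "corr f (Pow V) w xs ys = (\<Prod>u\<in>V. cis (pi / u (J u) * gap g p xs ys (J u)) + 1) / 2 ^ card V" for xs ys
  proof -
    have "(\<Prod>x\<leftarrow>xs. f x \<theta>) * cnj (\<Prod>y\<leftarrow>ys. f y \<theta>) = (\<Prod>u\<in>\<theta>. cis (pi / u (J u) * gap g p xs ys (J u)))" for \<theta>
    proof -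
      have e: "(\<Sum>x\<leftarrow>zs. \<Sum>u\<in>\<theta>. pi / u (J u) * g (J u) (p x)) = (\<Sum>u\<in>\<theta>. pi / u (J u) * (\<Sum>x\<leftarrow>zs. g (J u) (p x)))" for zs
        unfolding sum_list_sum_swap
        by (simp only: sum_list_const_mult)
      have "(\<Prod>x\<leftarrow>xs. f x \<theta>) * cnj (\<Prod>y\<leftarrow>ys. f y \<theta>)
          = cis ((\<Sum>u\<in>\<theta>. pi / u (J u) * (\<Sum>x\<leftarrow>xs. g (J u) (p x))) - (\<Sum>u\<in>\<theta>. pi / u (J u) * (\<Sum>x\<leftarrow>ys. g (J u) (p x))))"
        unfolding f_def prod_list_cis e by (simp add: cis_cnj cis_mult)
      also have "\<dots> = cis (\<Sum>u\<in>\<theta>. pi / u (J u) * gap g p xs ys (J u))"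
        unfolding gap_def sum_subtractf[symmetric] right_diff_distrib ..
      finally show ?thesis unfolding cis_sum .
    qed
    then have "corr f (Pow V) w xs ys = (\<Sum>\<theta>\<in>Pow V. (\<Prod>u\<in>\<theta>. cis (pi / u (J u) * gap g p xs ys (J u)))) / 2 ^ card V"
      by (simp add: corr_def w_def sum_divide_distrib)
    then show ?thesis by (simp add: prod_add[OF V])
  qed
  show ?thesis
  proof (rule that)
    show "finite (Pow V)" using V by simp
    show "0 \<le> w \<theta>" for \<theta> by (simp add: w_def)
    show "(\<Sum>\<theta>\<in>Pow V. w \<theta>) = 1" by (simp add: w_def cp)
    show "norm (f x \<theta>) = 1" for x \<theta> by (simp add: f_def)
    fix xs ys assume t: "xs \<in> tuples s A" "ys \<in> tuples s A"
    show "corr f (Pow V) w xs ys = (if \<forall>j<k. gap g p xs ys j = 0 then 1 else 0)"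
    proof (cases "\<forall>j<k. gap g p xs ys j = 0")
      case True
      then have "(\<Prod>u\<in>V. cis (pi / u (J u) * gap g p xs ys (J u)) + 1) = (\<Prod>u\<in>V. 2)"
        using J(1) by (intro prod.cong) auto
      then show ?thesis using True by (simp add: main)
    next
      case False
      then have v: "gap g p xs ys \<in> V" using t by (auto simp: V_def)
      have "cis (pi / gap g p xs ys (J (gap g p xs ys)) * gap g p xs ys (J (gap g p xs ys))) + 1 = 0"
        using J(2)[OF v] by (simp add: cis_pi)
      then have "(\<Prod>u\<in>V. cis (pi / u (J u) * gap g p xs ys (J u)) + 1) = 0"
        using V v by (intro prod_zero) blast+
      then show ?thesis using False by (simp add: main)
    qed
  qed
qed

lemma mom_corr:
  assumes "finite A"
  shows "of_real (mom f \<Theta> w s A) = (\<Sum>xs\<in>tuples s A. \<Sum>ys\<in>tuples s A. corr f \<Theta> w xs ys)"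
proof -
  have "of_real (mom f \<Theta> w s A) = corr f \<Theta> (\<lambda>\<theta>. w \<theta> * norm (expsum f A \<theta>) ^ (2 * s)) [] []"
    by (simp add: mom_def corr_def)
  then show ?thesis unfolding corr_weighted[OF assms] tuples_def by simp
qed

text \<open>Translation invariance of the Vinogradov system, by binomial expansion. Equal lengths
  supply the missing equation of degree 0.\<close>

lemma power_sums_shift:
  assumes "power_sums k xs = power_sums k ys" "length xs = length ys" "j \<le> k"
  shows "(\<Sum>x\<leftarrow>xs. (x - a) ^ j) = (\<Sum>y\<leftarrow>ys. (y - a) ^ j)"
proof -
  have e: "(\<Sum>x\<leftarrow>zs. (x - a) ^ j) = (\<Sum>i\<le>j. (of_nat (j choose i) * (- a) ^ (j - i)) * (\<Sum>x\<leftarrow>zs. x ^ i))" for zs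
  proof -
    have "(x - a) ^ j = (\<Sum>i\<le>j. (of_nat (j choose i) * (- a) ^ (j - i)) * x ^ i)" for x
      using binomial_ring[of x "- a" j] by (simp add: mult_ac)
    then show ?thesis using sum_list_lincomb[where c = "\<lambda>i. of_nat (j choose i) * (- a) ^ (j - i)" and g = "\<lambda>i x. x ^ i" and S = "{..j}" and p = "\<lambda>x. x" and xs = zs] by simp
  qed
  have "(\<Sum>x\<leftarrow>xs. x ^ i) = (\<Sum>y\<leftarrow>ys. y ^ i)" if "i \<le> j" for i
  proof (cases i)
    case 0
    then show ?thesis using assms(2) by (simp add: sum_list_triv)
  next
    case (Suc i')
    then have "i' < k" using that assms(3) by simp
    then show ?thesis using arg_cong[OF assms(1), of "\<lambda>v. vec_index v i'"] Suc by (simp add: power_sums_index)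
  qed
  then show ?thesis unfolding e by (intro sum.cong) auto
qed

text \<open>Cauchy-Schwarz over the fibres of \<open>h\<close>: few coincidences force a large
  image.\<close>

lemma card_image_square_le:
  assumes "finite X"
  shows "card X ^ 2 \<le> card (h ` X) * card {(x, y) \<in> X \<times> X. h x = h y}"
proof -
  let ?F = "\<lambda>v. {x \<in> X. h x = v}"
  have 1: "real (card X) = (\<Sum>v\<in>h ` X. real (card (?F v)))"
    using sum.image_gen[OF assms, of "\<lambda>_. 1::real" h] by simp
  have "{(x, y) \<in> X \<times> X. h x = h y} = (\<Union>v\<in>h ` X. ?F v \<times> ?F v)" by auto
  then have "card {(x, y) \<in> X \<times> X. h x = h y} = (\<Sum>v\<in>h ` X. card (?F v \<times> ?F v))"
    using assms by (simp only:) (intro card_UN_disjoint, auto)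
  then have 2: "real (card {(x, y) \<in> X \<times> X. h x = h y}) = (\<Sum>v\<in>h ` X. (real (card (?F v)))\<^sup>2)"
    by (simp add: card_cartesian_product power2_eq_square)
  have "real (card X) ^ 2 \<le> real (card {(x, y) \<in> X \<times> X. h x = h y}) * real (card (h ` X))"
    unfolding 1 2 by (rule sum_squared_le_sum_of_squares)
  then have "real (card X ^ 2) \<le> real (card (h ` X) * card {(x, y) \<in> X \<times> X. h x = h y})" by (simp add: mult.commute)
  then show ?thesis by (simp only: of_nat_le_iff)
qed

text \<open>In the application \<open>a\<close> is \<open>Inf A\<close>, whereas
  \<open>well_spaced\<close> refers to intervals \<open>(j, j + 1]\<close> with integer ends. A unit
  cell starting at \<open>a\<close> can meet two of these, hence the bound 2.\<close>

definition spread :: "real set \<Rightarrow> real \<Rightarrow> nat \<Rightarrow> bool" where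
  "spread A a n \<longleftrightarrow> finite A \<and> (\<forall>x\<in>A. a \<le> x \<and> x < a + 2 ^ n) \<and> (\<forall>i::int. card {x \<in> A. \<lfloor>x - a\<rfloor> = i} \<le> 2)"

text \<open>Division by \<open>2 ^ n\<close> makes the unit cells of \<open>spread\<close> the cells
  of scale \<open>n\<close>, and translation invariance moves the origin to \<open>a\<close>. For
  the characters of \<open>character_system\<close> the moment is the number of exact
  solutions.\<close>

lemma mean_value:
  assumes k: "0 < k" and \<epsilon>: "0 < \<epsilon>"
  obtains K where "\<And>A a n. spread A a n \<Longrightarrow> real (card {(xs, ys) \<in> tuples (tri k) A \<times> tuples (tri k) A. power_sums k xs = power_sums k ys})
        \<le> 2 powr (K + \<epsilon> * real n) * (2 * real (card A)) ^ tri k"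
proof -
  have "decoupling TYPE((nat \<Rightarrow> real) set) k \<epsilon>" by (rule decoupling_moment_curve[OF k \<epsilon>])
  then obtain K where K: "decoupled TYPE((nat \<Rightarrow> real) set) k \<epsilon> 1 K" unfolding decoupling_def by force
  let ?s = "tri k"
  have s: "0 < ?s" by (rule tri_pos[OF k])
  show ?thesis
  proof (rule that)
    fix A :: "real set" and a n
    assume "spread A a n"
    then have A: "finite A" and rng: "\<And>x. x \<in> A \<Longrightarrow> a \<le> x \<and> x < a + 2 ^ n"
      and two: "\<And>i::int. card {x \<in> A. \<lfloor>x - a\<rfloor> = i} \<le> 2" by (auto simp: spread_def)
    define p where "p x = (x - a) / 2 ^ n" for x
    define g :: "nat \<Rightarrow> real \<Rightarrow> real" where "g j x = x ^ Suc j / real (Suc j)" for j x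
    obtain f :: "real \<Rightarrow> (nat \<Rightarrow> real) set \<Rightarrow> complex" and \<Theta> w where
      T: "finite \<Theta>" and w: "\<And>\<theta>. 0 \<le> w \<theta>" "(\<Sum>\<theta>\<in>\<Theta>. w \<theta>) = 1" and f: "\<And>x \<theta>. norm (f x \<theta>) = 1"
      and corr: "\<And>xs ys. xs \<in> tuples ?s A \<Longrightarrow> ys \<in> tuples ?s A \<Longrightarrow>
        corr f \<Theta> w xs ys = (if \<forall>j<k. gap g p xs ys j = 0 then 1 else 0)"
      using character_system[OF A, of ?s k g p] by metis
    have sy: "sys k 1 n (\<lambda>_. 1) g p A f \<Theta> w"
      unfolding sys_def orth_def
    proof (intro conjI allI impI ballI)
      show "finite A" "finite \<Theta>" by fact+
      show "0 \<le> w \<theta>" for \<theta> by (rule w)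
      show "0 \<le> p x" "p x < 1" if "x \<in> A" for x using rng[OF that] by (auto simp: p_def)
      show "(g j has_real_derivative 1 * x ^ j) (at x)" for j x
        using DERIV_cdivide[OF DERIV_pow[of "Suc j" x UNIV], of "real (Suc j)"] unfolding g_def by (simp del: of_nat_Suc power_Suc)
      fix xs ys j assume "set xs \<subseteq> A" "set ys \<subseteq> A" "length xs = ?s" "length ys = ?s" "corr f \<Theta> w xs ys \<noteq> 0" "j < k"
      then have "gap g p xs ys j = 0" using corr[of xs ys] by (auto simp: tuples_def split: if_splits)
      then show "\<bar>gap g p xs ys j\<bar> \<le> 1 / 2 ^ (n * k)" by simp
    qed auto
    \<comment> \<open>The characters have norm 1, so the sum over a cell is at most its cardinality.
      With at most two points, \<open>card ^ 2 \<le> 2 * card\<close>, which makes the constant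
      weight 2 admissible.\<close>
    have bd: "cellbd n ?s p A f \<Theta> w (\<lambda>_. 2)"
      unfolding cellbd_def
    proof (intro conjI allI)
      fix i
      let ?c = "cell p A n i"
      have "?c = {x \<in> A. \<lfloor>x - a\<rfloor> = i}" by (auto simp: cell_iff p_def)
      then have c2: "card ?c \<le> 2" using two[of i] by simp
      have "norm (expsum f ?c \<theta>) \<le> real (card ?c)" for \<theta>
        unfolding expsum_def using sum_norm_bound[of ?c "\<lambda>x. f x \<theta>" 1] f by simp
      then have "mom f \<Theta> w ?s ?c \<le> (\<Sum>\<theta>\<in>\<Theta>. w \<theta> * real (card ?c) ^ (2 * ?s))"
        unfolding mom_def using w by (intro sum_mono mult_left_mono power_mono) auto
      also have "\<dots> = (real (card ?c) ^ 2) ^ ?s" by (simp add: w(2) flip: sum_distrib_right power_mult)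
      also have "\<dots> \<le> (\<Sum>x\<in>?c. 2) ^ ?s"
      proof (intro power_mono)
        have "real (card ?c) * real (card ?c) \<le> real (card ?c) * 2" using c2 by (intro mult_left_mono) auto
        then show "real (card ?c) ^ 2 \<le> (\<Sum>x\<in>?c. 2)" by (simp add: power2_eq_square)
      qed auto
      finally show "mom f \<Theta> w ?s ?c \<le> (\<Sum>x\<in>?c. 2) ^ ?s" .
    qed auto
    let ?T = "tuples ?s A"
    have "real (card {(xs, ys) \<in> ?T \<times> ?T. power_sums k xs = power_sums k ys})
      \<le> real (card {(xs, ys) \<in> ?T \<times> ?T. \<forall>j<k. gap g p xs ys j = 0})"
    proof (intro of_nat_mono card_mono)
      have "{(xs, ys) \<in> ?T \<times> ?T. \<forall>j<k. gap g p xs ys j = 0} \<subseteq> ?T \<times> ?T" by auto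
      then show "finite {(xs, ys) \<in> ?T \<times> ?T. \<forall>j<k. gap g p xs ys j = 0}"
        by (rule finite_subset) (use finite_tuples[OF A] in auto)
      have "gap g p xs ys j = 0" if t: "xs \<in> ?T" "ys \<in> ?T" and e: "power_sums k xs = power_sums k ys" and j: "j < k" for xs ys j
      proof -
        have "g j (p x) = (1 / (real (Suc j) * (2 ^ n) ^ Suc j)) * (x - a) ^ Suc j" for x
          unfolding g_def p_def power_divide by simp
        moreover have "(\<Sum>x\<leftarrow>xs. (x - a) ^ Suc j) = (\<Sum>y\<leftarrow>ys. (y - a) ^ Suc j)"
          using t j by (intro power_sums_shift[OF e]) (auto simp: tuples_def)
        ultimately show ?thesis unfolding gap_def by (simp only: sum_list_const_mult diff_self)
      qed
      then show "{(xs, ys) \<in> ?T \<times> ?T. power_sums k xs = power_sums k ys} \<subseteq> {(xs, ys) \<in> ?T \<times> ?T. \<forall>j<k. gap g p xs ys j = 0}"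
        by blast
    qed
    also have "\<dots> = mom f \<Theta> w ?s A"
    proof -
      have "complex_of_real (mom f \<Theta> w ?s A) = (\<Sum>xs\<in>?T. \<Sum>ys\<in>?T. if \<forall>j<k. gap g p xs ys j = 0 then 1 else 0)"
        unfolding mom_corr[OF A] using corr by (intro sum.cong refl) auto
      also have "\<dots> = (\<Sum>z\<in>?T \<times> ?T. if \<forall>j<k. gap g p (fst z) (snd z) j = 0 then 1 else 0)"
        by (simp add: sum.cartesian_product case_prod_beta)
      also have "\<dots> = (\<Sum>z\<in>{(xs, ys) \<in> ?T \<times> ?T. \<forall>j<k. gap g p xs ys j = 0}. 1)"
        using finite_tuples[OF A] by (intro sum.mono_neutral_cong_right) auto
      finally have "complex_of_real (mom f \<Theta> w ?s A) = of_real (real (card {(xs, ys) \<in> ?T \<times> ?T. \<forall>j<k. gap g p xs ys j = 0}))" by simp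
      then show ?thesis unfolding of_real_eq_iff by simp
    qed
    also have "\<dots> \<le> 2 powr (K + \<epsilon> * real n) * (\<Sum>x\<in>A. 2) ^ ?s" by (rule decoupledD[OF K sy bd])
    finally show "real (card {(xs, ys) \<in> ?T \<times> ?T. power_sums k xs = power_sums k ys}) \<le> 2 powr (K + \<epsilon> * real n) * (2 * real (card A)) ^ ?s"
      by (simp add: mult.commute)
  qed
qed

text \<open>Cauchy-Schwarz and \<open>mean_value\<close> settle the critical case of
  \<open>tri k\<close> summands. Fewer summands follow by splitting: each \<open>s\<close>-fold sum
  extends to at most \<open>card A ^ (tri k - s)\<close> sums of critical length.\<close>

lemma sumset_lower_bound:
  assumes k: "0 < k" and \<epsilon>: "0 < \<epsilon>" and s: "s \<le> tri k"
  obtains c where "0 < c" "\<And>A a n. spread A a n \<Longrightarrow> A \<noteq> {} \<Longrightarrow> c * 2 powr (- \<epsilon> * real n) * real (card A) ^ s \<le> real (card (power_sums k ` tuples s A))"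
proof -
  obtain K where K: "\<And>A a n. spread A a n \<Longrightarrow> real (card {(xs, ys) \<in> tuples (tri k) A \<times> tuples (tri k) A. power_sums k xs = power_sums k ys})
        \<le> 2 powr (K + \<epsilon> * real n) * (2 * real (card A)) ^ tri k"
    using mean_value[OF k \<epsilon>] by blast
  let ?t = "tri k"
  define c where "c = 2 powr (- K) / 2 ^ ?t"
  show ?thesis
  proof (rule that[of c])
    show "0 < c" by (simp add: c_def)
    fix A :: "real set" and a n
    assume sp: "spread A a n" and ne: "A \<noteq> {}"
    then have A: "finite A" by (simp add: spread_def)
    let ?N = "real (card A)" and ?P = "power_sums k"
    show "c * 2 powr (- \<epsilon> * real n) * ?N ^ s \<le> real (card (?P ` tuples s A))"
    proof -
      have N: "0 < ?N" using ne A by (simp add: card_gt_0_iff)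
      have "card (tuples ?t A) ^ 2 \<le> card (?P ` tuples ?t A) * card {(xs, ys) \<in> tuples ?t A \<times> tuples ?t A. ?P xs = ?P ys}"
        by (rule card_image_square_le[OF finite_tuples[OF A]])
      then have "real (card (tuples ?t A) ^ 2) \<le> real (card (?P ` tuples ?t A) * card {(xs, ys) \<in> tuples ?t A \<times> tuples ?t A. ?P xs = ?P ys})"
        by (simp only: of_nat_le_iff)
      then have "?N ^ ?t * ?N ^ ?t \<le> real (card (?P ` tuples ?t A)) * real (card {(xs, ys) \<in> tuples ?t A \<times> tuples ?t A. ?P xs = ?P ys})"
        by (simp add: card_tuples[OF A] power2_eq_square)
      also have "\<dots> \<le> real (card (?P ` tuples ?t A)) * (2 powr (K + \<epsilon> * real n) * (2 * ?N) ^ ?t)"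
        by (intro mult_left_mono K[OF sp]) auto
      also have "real (card (?P ` tuples ?t A)) \<le> real (card (?P ` tuples s A)) * ?N ^ (?t - s)"
      proof -
        have "?P ` tuples ?t A \<subseteq> (\<lambda>(v, ys). v + ?P ys) ` (?P ` tuples s A \<times> tuples (?t - s) A)"
        proof
          fix v assume "v \<in> ?P ` tuples ?t A"
          then obtain zs where zs: "v = ?P zs" "set zs \<subseteq> A" "length zs = ?t" by (auto simp: tuples_def)
          have "v = ?P (take s zs) + ?P (drop s zs)" unfolding zs(1) power_sums_append[symmetric] by simp
          moreover have "take s zs \<in> tuples s A" "drop s zs \<in> tuples (?t - s) A"
            using zs s set_take_subset[of s zs] set_drop_subset[of s zs] by (auto simp: tuples_def)
          ultimately show "v \<in> (\<lambda>(v, ys). v + ?P ys) ` (?P ` tuples s A \<times> tuples (?t - s) A)" by force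
        qed
        then have "card (?P ` tuples ?t A) \<le> card ((\<lambda>(v, ys). v + ?P ys) ` (?P ` tuples s A \<times> tuples (?t - s) A))"
          using finite_tuples[OF A] by (intro card_mono) auto
        also have "\<dots> \<le> card (?P ` tuples s A \<times> tuples (?t - s) A)"
          using finite_tuples[OF A] by (intro card_image_le) auto
        also have "\<dots> = card (?P ` tuples s A) * card A ^ (?t - s)" by (simp add: card_cartesian_product card_tuples[OF A])
        finally have "real (card (?P ` tuples ?t A)) \<le> real (card (?P ` tuples s A) * card A ^ (?t - s))" by (simp only: of_nat_le_iff)
        then show ?thesis by simp
      qed
      finally have "?N ^ ?t * ?N ^ ?t \<le> real (card (?P ` tuples s A)) * ?N ^ (?t - s) * (2 powr (K + \<epsilon> * real n) * (2 * ?N) ^ ?t)"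
        using N by (simp add: mult_right_mono)
      moreover have "?N ^ ?t = ?N ^ s * ?N ^ (?t - s)" using s by (simp flip: power_add)
      ultimately have "?N ^ s * (?N ^ (?t - s) * ?N ^ ?t)
         \<le> (real (card (?P ` tuples s A)) * (2 powr (K + \<epsilon> * real n) * 2 ^ ?t)) * (?N ^ (?t - s) * ?N ^ ?t)"
        by (simp add: power_mult_distrib mult_ac)
      then have "?N ^ s \<le> real (card (?P ` tuples s A)) * (2 powr (K + \<epsilon> * real n) * 2 ^ ?t)"
        using N by (subst (asm) mult_le_cancel_right_pos) auto
      then have "?N ^ s / (2 powr (K + \<epsilon> * real n) * 2 ^ ?t) \<le> real (card (?P ` tuples s A))"
        by (simp add: divide_le_eq)
      moreover have "c * 2 powr (- \<epsilon> * real n) * ?N ^ s = ?N ^ s / (2 powr (K + \<epsilon> * real n) * 2 ^ ?t)"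
        by (simp add: c_def powr_add powr_minus field_simps)
      ultimately show ?thesis by simp
    qed
  qed
qed

text \<open>The intervals \<open>(j, j + 1]\<close> are the fibres of \<open>ceiling\<close>, and
  the range of \<open>j\<close> in \<open>well_spaced\<close> contains
  \<open>\<lceil>x\<rceil> - 1\<close> for every point \<open>x\<close>.\<close>

lemma well_spaced_ceiling_inj:
  assumes A: "finite A" and ws: "well_spaced A"
  shows "inj_on ceiling A"
proof (rule inj_onI)
  fix x y assume xy: "x \<in> A" "y \<in> A" "\<lceil>x\<rceil> = \<lceil>y\<rceil>"
  define j where "j = \<lceil>x\<rceil> - 1"
  have "Inf A \<le> x" "x \<le> Sup A" using xy A by (auto intro!: cInf_lower cSup_upper)
  moreover have jx: "of_int j < x" "x \<le> of_int j + 1" and jy: "of_int j < y" "y \<le> of_int j + 1"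
    using xy(3) unfolding j_def by linarith+
  ultimately have "Inf A - 1 \<le> of_int j" "of_int j \<le> Sup A" by linarith+
  then have "card (A \<inter> {of_int j <.. of_int j + 1}) \<le> 1"
    using ws unfolding well_spaced_def by blast
  moreover have "x \<in> A \<inter> {of_int j <.. of_int j + 1}" "y \<in> A \<inter> {of_int j <.. of_int j + 1}"
    using xy jx jy by auto
  moreover have "finite (A \<inter> {of_int j <.. of_int j + 1})" using A by simp
  ultimately show "x = y" by (metis One_nat_def card_le_Suc0_iff_eq)
qed

lemma well_spaced_spread:
  assumes A: "finite A" and ws: "well_spaced A" and d: "diam A < 2 ^ n" and B: "B \<subseteq> A"
  shows "spread B (Inf A) n"
  unfolding spread_def
proof (intro conjI ballI allI)
  show "finite B" using A B finite_subset by blast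
  show "Inf A \<le> x" "x < Inf A + 2 ^ n" if "x \<in> B" for x
  proof -
    have "x \<in> A" using that B by blast
    then have "Inf A \<le> x" "x \<le> Sup A" using A by (auto intro!: cInf_lower cSup_upper)
    then show "Inf A \<le> x" "x < Inf A + 2 ^ n" using d by (auto simp: diam_def)
  qed
  fix i :: int
  let ?S = "{x \<in> B. \<lfloor>x - Inf A\<rfloor> = i}" and ?c = "\<lceil>Inf A + of_int i\<rceil>"
  have "ceiling ` ?S \<subseteq> {?c, ?c + 1}"
  proof
    fix z assume "z \<in> ceiling ` ?S"
    then obtain x where x: "z = \<lceil>x\<rceil>" "\<lfloor>x - Inf A\<rfloor> = i" by auto
    then have "Inf A + of_int i \<le> x" "x < Inf A + of_int i + 1" by linarith+
    then have "?c \<le> z" "z \<le> ?c + 1" unfolding x(1) by linarith+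
    then show "z \<in> {?c, ?c + 1}" by auto
  qed
  then have "card (ceiling ` ?S) \<le> card {?c, ?c + 1}" by (intro card_mono) auto
  moreover have "card (ceiling ` ?S) = card ?S"
    by (rule card_image[OF inj_on_subset[OF well_spaced_ceiling_inj[OF A ws]]]) (use B in auto)
  ultimately show "card ?S \<le> 2" by simp
qed

lemma dyadic_scale:
  fixes X :: real
  assumes "0 \<le> X"
  obtains n where "X < 2 ^ n" "2 ^ n \<le> 2 * (X + 1)"
proof -
  define n where "n = (LEAST n. X < 2 ^ n)"
  have "\<exists>n. X < 2 ^ n" using real_arch_pow[of 2 X] by simp
  then have n: "X < 2 ^ n" unfolding n_def by (rule LeastI_ex)
  have "2 ^ n \<le> 2 * (X + 1)"
  proof (cases n)
    case 0
    then show ?thesis using assms by simp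
  next
    case (Suc n')
    then have "\<not> X < 2 ^ n'" using not_less_Least[of n' "\<lambda>n. X < 2 ^ n"] by (simp add: n_def)
    then show ?thesis using Suc by simp
  qed
  then show ?thesis by (rule that[OF n])
qed

section \<open>Slopes and the final estimate\<close>

definition dilate :: "nat \<Rightarrow> real \<Rightarrow> real vec \<Rightarrow> real vec" where
  "dilate k c v = Matrix.vec k (\<lambda>j. c ^ Suc j * vec_index v j)"

lemma dilate_power_sums: "dilate k c (power_sums k xs) = power_sums k (map ((*) c) xs)"
proof (rule eq_vecI)
  fix j assume "j < dim_vec (power_sums k (map ((*) c) xs))"
  then have "j < k" by (simp add: power_sums_def)
  then show "vec_index (dilate k c (power_sums k xs)) j = vec_index (power_sums k (map ((*) c) xs)) j"
    by (simp only: dilate_def index_vec power_sums_index map_map comp_def power_mult_distrib sum_list_const_mult)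
qed (simp add: dilate_def power_sums_def)

lemma sum_list_sgn_pos:
  fixes \<sigma> :: real
  assumes "\<And>x. x \<in> set xs \<Longrightarrow> 0 < \<sigma> * x" "xs \<noteq> []"
  shows "0 < \<sigma> * (\<Sum>x\<leftarrow>xs. x)"
  using assms
proof (induction xs)
  case (Cons x xs)
  show ?case
  proof (cases "xs = []")
    case True
    then show ?thesis using Cons.prems by simp
  next
    case False
    then have "0 < \<sigma> * (\<Sum>x\<leftarrow>xs. x)" using Cons by auto
    moreover have "0 < \<sigma> * x" using Cons.prems by simp
    ultimately show ?thesis by (simp add: distrib_left)
  qed
qed simp

lemma vec_plus_left_inj: "u \<in> carrier_vec k \<Longrightarrow> inj_on (\<lambda>v. v + u) (carrier_vec k :: real vec set)"
proof (rule inj_onI)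
  fix v v' :: "real vec" assume u: "u \<in> carrier_vec k" and v: "v \<in> carrier_vec k" "v' \<in> carrier_vec k" and e: "v + u = v' + u"
  show "v = v'"
  proof (rule eq_vecI)
    show "dim_vec v = dim_vec v'" using v by auto
    fix j assume "j < dim_vec v'"
    then have "j < dim_vec u" using u v by auto
    then show "vec_index v j = vec_index v' j" using arg_cong[OF e, of "\<lambda>w. vec_index w j"] by simp
  qed
qed

text \<open>
  Solymosi's argument: for consecutive slopes \<open>\<lambda> < \<lambda>'\<close> the sums of points on the two rays
  \<open>(v, dilate \<lambda> v)\<close> and \<open>(u, dilate \<lambda>' u)\<close> are distinct, and the slope of the
  first coordinates of each sum lies strictly between \<open>\<lambda>\<close> and \<open>\<lambda>'\<close>.
\<close>

lemma consecutive_slopes: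
  fixes B :: "real set" and \<sigma> m :: real and k s :: nat
  defines "S \<equiv> \<lambda>c. power_sums k ` tuples s {b \<in> B. c * b \<in> B}"
  assumes B: "finite B" and sgn: "\<And>x. x \<in> B \<Longrightarrow> 0 < \<sigma> * x" and k: "0 < k" and s: "0 < s"
    and L: "finite L" "\<And>c. c \<in> L \<Longrightarrow> 0 < c"
    and m: "0 \<le> m" "\<And>c. c \<in> L \<Longrightarrow> m \<le> real (card (S c))"
  shows "real (card L - 1) * m\<^sup>2 \<le> (real (card (power_sums k ` tuples s B + power_sums k ` tuples s B)))\<^sup>2"
proof (cases "L = {}")
  case False
  let ?P = "power_sums k ` tuples s B"
  let ?W = "?P + ?P"
  \<comment> \<open>The largest slope has no successor, which costs one slope in the count.\<close>
  define L' where "L' = L - {Max L}"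
  define nx where "nx c = Min {c' \<in> L. c < c'}" for c
  have nx: "nx c \<in> L" "c < nx c" "\<And>d. d \<in> L \<Longrightarrow> c < d \<Longrightarrow> nx c \<le> d" if c: "c \<in> L'" for c
  proof -
    have "c \<in> L" "c \<noteq> Max L" using c by (auto simp: L'_def)
    then have "c < Max L" using Max_ge[OF L(1)] by (simp add: less_le)
    then have ne: "{c' \<in> L. c < c'} \<noteq> {}" using Max_in[OF L(1) False] by blast
    have fin: "finite {c' \<in> L. c < c'}" using L by simp
    show "nx c \<in> L" "c < nx c" using Min_in[OF fin ne] by (auto simp: nx_def)
    show "nx c \<le> d" if "d \<in> L" "c < d" for d unfolding nx_def using that fin by (intro Min_le) auto
  qed
  have L'L: "c \<in> L" "0 < c" if "c \<in> L'" for c using that L by (auto simp: L'_def)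
  have finS: "finite (S c)" for c unfolding S_def using B by (intro finite_imageI finite_tuples) auto
  have SP: "S c \<subseteq> ?P" for c unfolding S_def by (intro image_mono tuples_mono) auto
  have dilP: "dilate k c v \<in> ?P" if v: "v \<in> S c" for c v
  proof -
    obtain xs where xs: "v = power_sums k xs" "set xs \<subseteq> {b \<in> B. c * b \<in> B}" "length xs = s"
      using v by (auto simp: S_def tuples_def)
    then have "map ((*) c) xs \<in> tuples s B" by (auto simp: tuples_def)
    then show ?thesis unfolding xs(1) dilate_power_sums by (rule imageI)
  qed
  have carr: "v \<in> carrier_vec k" if "v \<in> S c" for c v using that power_sums_carrier by (auto simp: S_def)
  \<comment> \<open>A common sign excludes cancellation: the slope of a sum is then a weighted mean,
    with positive weights, of the two slopes.\<close>
  have pos: "0 < \<sigma> * vec_index v 0" if v: "v \<in> S c" for c v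
  proof -
    obtain xs where xs: "v = power_sums k xs" "set xs \<subseteq> B" "length xs = s" using v by (auto simp: S_def tuples_def)
    have "xs \<noteq> []" using xs(3) s by auto
    then have "0 < \<sigma> * (\<Sum>x\<leftarrow>xs. x)" using xs(2) sgn by (intro sum_list_sgn_pos) auto
    then show ?thesis using k by (simp add: xs(1) power_sums_index)
  qed
  define D where "D = (SIGMA c:L'. S c \<times> S (nx c))"
  define \<Phi> where "\<Phi> = (\<lambda>(c, v, u). (v + u, dilate k c v + dilate k (nx c) u))"
  have between: "x * (a + b) < x * a + y * b \<and> x * a + y * b < y * (a + b)"
    if "x < y" "0 < a" "0 < b" for x y a b :: real
    using mult_strict_right_mono[OF that(1,2)] mult_strict_right_mono[OF that(1,3)] by (simp add: distrib_left)
  have "inj_on \<Phi> D"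
  proof (rule inj_onI)
    fix x y assume "x \<in> D" "y \<in> D" and e: "\<Phi> x = \<Phi> y"
    then obtain c v u d v' u' where xy: "x = (c, v, u)" "y = (d, v', u')" and c: "c \<in> L'" "v \<in> S c" "u \<in> S (nx c)"
      and d: "d \<in> L'" "v' \<in> S d" "u' \<in> S (nx d)" by (auto simp: D_def)
    have e1: "v + u = v' + u'" and e2: "dilate k c v + dilate k (nx c) u = dilate k d v' + dilate k (nx d) u'"
      using e by (auto simp: \<Phi>_def xy)
    have i1: "vec_index v j + vec_index u j = vec_index v' j + vec_index u' j" if "j < k" for j
      using arg_cong[OF e1, of "\<lambda>w. vec_index w j"] that carr[OF c(3)] carr[OF d(3)] by auto
    have i2: "c ^ Suc j * vec_index v j + nx c ^ Suc j * vec_index u j = d ^ Suc j * vec_index v' j + nx d ^ Suc j * vec_index u' j" if "j < k" for j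
      using arg_cong[OF e2, of "\<lambda>w. vec_index w j"] that by (auto simp: dilate_def)
    let ?v = "\<sigma> * vec_index v 0" and ?u = "\<sigma> * vec_index u 0" and ?v' = "\<sigma> * vec_index v' 0" and ?u' = "\<sigma> * vec_index u' 0"
    have p: "0 < ?v" "0 < ?u" "0 < ?v'" "0 < ?u'" using pos c d by auto
    have z: "?v + ?u = ?v' + ?u'" using i1[OF k] by (simp flip: distrib_left)
    have y: "c * ?v + nx c * ?u = d * ?v' + nx d * ?u'"
    proof -
      have "c * ?v + nx c * ?u = \<sigma> * (c ^ Suc 0 * vec_index v 0 + nx c ^ Suc 0 * vec_index u 0)" by (simp add: algebra_simps)
      also have "\<dots> = d * ?v' + nx d * ?u'" unfolding i2[OF k] by (simp add: algebra_simps)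
      finally show ?thesis .
    qed
    have b1: "c * (?v + ?u) < c * ?v + nx c * ?u" "c * ?v + nx c * ?u < nx c * (?v + ?u)"
      using between[OF nx(2)[OF c(1)] p(1,2)] by auto
    have b2: "d * (?v' + ?u') < d * ?v' + nx d * ?u'" "d * ?v' + nx d * ?u' < nx d * (?v' + ?u')"
      using between[OF nx(2)[OF d(1)] p(3,4)] by auto
    have zp: "0 < ?v + ?u" using p by simp
    have "c * (?v + ?u) < nx d * (?v + ?u)" using b1(1) b2(2) y z by simp
    then have 1: "c < nx d" using zp by (simp only: mult_less_cancel_right_pos)
    have "d * (?v + ?u) < nx c * (?v + ?u)" using b1(2) b2(1) y z by simp
    then have 2: "d < nx c" using zp by (simp only: mult_less_cancel_right_pos)
    have cd: "c = d"
    proof (rule ccontr)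
      assume "c \<noteq> d"
      then consider "c < d" | "d < c" by linarith
      then show False
      proof cases
        case 1
        then have "nx c \<le> d" using nx(3)[OF c(1)] L'L d by blast
        then show False using 2 by simp
      next
        case 2
        then have "nx d \<le> c" using nx(3)[OF d(1)] L'L c by blast
        then show False using 1 by simp
      qed
    qed
    \<comment> \<open>Once \<open>c = d\<close>, each coordinate gives two linear equations for two
      unknowns, with determinant \<open>nx c ^ Suc j - c ^ Suc j\<close>, nonzero because
      \<open>0 < c < nx c\<close>.\<close>
    have uu: "vec_index u j = vec_index u' j" if j: "j < k" for j
    proof -
      let ?a = "c ^ Suc j" and ?b = "nx c ^ Suc j"
      have ab: "?a < ?b" using nx(2)[OF c(1)] L'L(2)[OF c(1)] by (intro power_strict_mono) auto
      have "?b * vec_index u j - ?b * vec_index u' j = ?a * (vec_index v' j - vec_index v j)"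
        using i2[OF j] unfolding cd[symmetric] right_diff_distrib by linarith
      also have "vec_index v' j - vec_index v j = vec_index u j - vec_index u' j" using i1[OF j] by linarith
      finally have "(?b - ?a) * (vec_index u j - vec_index u' j) = 0" by (simp only: left_diff_distrib right_diff_distrib)
      then show ?thesis using ab by simp
    qed
    have "u = u'" using carr[OF c(3)] carr[OF d(3)] uu by (intro eq_vecI) auto
    moreover have "v = v'" using carr[OF c(2)] carr[OF d(2)] uu i1 by (intro eq_vecI) auto
    ultimately show "x = y" using xy cd by simp
  qed
  then have "card D = card (\<Phi> ` D)" by (simp add: card_image)
  also have "\<dots> \<le> card (?W \<times> ?W)"
  proof (rule card_mono)
    show "finite (?W \<times> ?W)" using finite_tuples[OF B] by (intro finite_cartesian_product finite_set_plus) auto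
    show "\<Phi> ` D \<subseteq> ?W \<times> ?W"
      using SP dilP by (auto simp: \<Phi>_def D_def intro!: set_plus_intro)
  qed
  finally have cD: "real (card D) \<le> (real (card ?W))\<^sup>2"
    by (simp add: card_cartesian_product power2_eq_square flip: of_nat_mult)
  have "card L' = card L - 1" using L False by (simp add: L'_def)
  then have "real (card L - 1) * m\<^sup>2 = (\<Sum>c\<in>L'. m * m)" by (simp add: power2_eq_square)
  also have "\<dots> \<le> (\<Sum>c\<in>L'. real (card (S c)) * real (card (S (nx c))))"
    using m nx(1) L'L(1) by (intro sum_mono mult_mono) auto
  also have "\<dots> = real (card D)"
    unfolding D_def using L finS by (subst card_SigmaI) (auto simp: L'_def card_cartesian_product)
  finally show ?thesis using cD by (rule order_trans)
qed simp

section \<open>Popular slopes and the balance of exponents\<close>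

lemma harmonic_le:
  assumes "1 \<le> n"
  shows "(\<Sum>t=1..n. 1 / real t) \<le> 1 + ln (real n)"
  using assms
proof (induction n rule: nat_induct_at_least)
  case (Suc n)
  have "ln (real n / real (Suc n)) \<le> real n / real (Suc n) - 1" using Suc by (intro ln_le_minus_one) auto
  also have "\<dots> = - (1 / real (Suc n))" by (simp add: field_simps)
  finally have "1 / real (Suc n) \<le> ln (real (Suc n)) - ln (real n)" using Suc by (simp add: ln_div)
  then show ?case using Suc by simp
qed simp

text \<open>The total is the sum over \<open>t\<close> of the number of \<open>c\<close> with
  \<open>r c \<ge> t\<close>. If every level fell short, comparison with the harmonic sum would
  contradict this; so pigeonholing costs only a logarithm.\<close>

lemma popular_level:
  fixes r :: "'a \<Rightarrow> nat"
  assumes L: "finite L" and r: "\<And>c. c \<in> L \<Longrightarrow> r c \<le> n" and n: "1 \<le> n"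
  obtains t where "1 \<le> t" "t \<le> n" "real (\<Sum>c\<in>L. r c) \<le> real (t * card {c \<in> L. t \<le> r c}) * (1 + ln (real n))"
proof (rule ccontr)
  let ?H = "1 + ln (real n)" and ?M = "real (\<Sum>c\<in>L. r c)"
  have H: "0 < ?H" using n by (intro add_pos_nonneg) auto
  note found = that
  assume nt: "\<not> thesis"
  have lt: "real (t * card {c \<in> L. t \<le> r c}) * ?H < ?M" if t: "t \<in> {1..n}" for t
  proof (rule ccontr)
    assume "\<not> ?thesis"
    then have "?M \<le> real (t * card {c \<in> L. t \<le> r c}) * ?H" by (simp only: not_less)
    with t have thesis by (intro found[of t]) simp_all
    with nt show False by contradiction
  qed
  have "(\<Sum>c\<in>L. r c) = (\<Sum>c\<in>L. \<Sum>t=1..n. if t \<le> r c then 1 else 0)"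
  proof (intro sum.cong refl)
    fix c assume c: "c \<in> L"
    have "{t \<in> {1..n}. t \<le> r c} = {1..r c}" using r[OF c] by auto
    then show "r c = (\<Sum>t=1..n. if t \<le> r c then 1 else 0)" by (simp add: sum.If_cases Int_def)
  qed
  also have "\<dots> = (\<Sum>t=1..n. \<Sum>c\<in>L. if t \<le> r c then 1 else 0)" by (rule sum.swap)
  also have "\<dots> = (\<Sum>t=1..n. card {c \<in> L. t \<le> r c})" using L by (simp add: sum.If_cases Int_def)
  finally have "?M = (\<Sum>t=1..n. real (card {c \<in> L. t \<le> r c}))" by simp
  also have "\<dots> < (\<Sum>t=1..n. ?M / ?H * (1 / real t))"
  proof (rule sum_strict_mono)
    fix t assume t: "t \<in> {1..n}"
    then show "real (card {c \<in> L. t \<le> r c}) < ?M / ?H * (1 / real t)"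
      using lt[OF t] H by (simp add: less_divide_eq mult_ac)
  qed (use n in auto)
  also have "\<dots> = ?M / ?H * (\<Sum>t=1..n. 1 / real t)" by (rule sum_distrib_left[symmetric])
  also have "\<dots> \<le> ?M / ?H * ?H" using harmonic_le[OF n] by (rule mult_left_mono) (intro divide_nonneg_pos of_nat_0_le_iff H)
  finally show False using H by simp
qed

lemma sum_ratio_set:
  assumes B: "finite B" "0 \<notin> B"
  shows "finite (ratio_set B)" "(\<Sum>c\<in>ratio_set B. card {b \<in> B. c * b \<in> B}) = card B ^ 2"
proof -
  have img: "ratio_set B = (\<lambda>(a, b). b / a) ` (B \<times> B)" by (auto simp: ratio_set_def)
  then show "finite (ratio_set B)" using B by simp
  have "card {z \<in> B \<times> B. (\<lambda>(a, b). b / a) z = c} = card {b \<in> B. c * b \<in> B}" for c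
  proof (rule bij_betw_same_card[of fst], rule bij_betwI[of _ _ _ "\<lambda>b. (b, c * b)"])
    have nz: "b \<noteq> 0" if "b \<in> B" for b using that B by auto
    show "fst \<in> {z \<in> B \<times> B. (\<lambda>(a, b). b / a) z = c} \<rightarrow> {b \<in> B. c * b \<in> B}" using nz by auto
    show "(\<lambda>b. (b, c * b)) \<in> {b \<in> B. c * b \<in> B} \<rightarrow> {z \<in> B \<times> B. (\<lambda>(a, b). b / a) z = c}" using nz by auto
  qed (use B in auto)
  then have "(\<Sum>c\<in>ratio_set B. card {b \<in> B. c * b \<in> B}) = (\<Sum>c\<in>(\<lambda>(a, b). b / a) ` (B \<times> B). \<Sum>z\<in>{z \<in> B \<times> B. (\<lambda>(a, b). b / a) z = c}. 1)"
    unfolding img by simp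
  also have "\<dots> = (\<Sum>z\<in>B \<times> B. 1)" using sum.image_gen[of "B \<times> B" "\<lambda>_. 1::nat" "\<lambda>(a, b). b / a"] B by simp
  finally show "(\<Sum>c\<in>ratio_set B. card {b \<in> B. c * b \<in> B}) = card B ^ 2" by (simp add: card_cartesian_product power2_eq_square)
qed

text \<open>Provides the common sign that the slope argument relies on, at the cost of a factor
  2.\<close>

lemma same_sign_half:
  assumes "finite A" "(0::real) \<notin> A"
  obtains B \<sigma> where "B \<subseteq> A" "card A \<le> 2 * card B" "\<And>x. x \<in> B \<Longrightarrow> 0 < \<sigma> * (x :: real)"
proof -
  let ?p = "{x \<in> A. 0 < x}" and ?n = "{x \<in> A. x < 0}"
  have "x < 0 \<or> 0 < x" if "x \<in> A" for x
    using that assms(2) by (cases x "0::real" rule: linorder_cases) auto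
  then have "A = ?p \<union> ?n" by blast
  then have "card A \<le> card ?p + card ?n" by (metis card_Un_le)
  then consider "card A \<le> 2 * card ?p" | "card A \<le> 2 * card ?n" by linarith
  then show ?thesis
  proof cases
    case 1
    then show ?thesis using that[of ?p 1] by auto
  next
    case 2
    then show ?thesis using that[of ?n "-1"] by auto
  qed
qed

lemma sumset_card_ge:
  assumes "finite B" "B \<noteq> {}"
  shows "card (power_sums k ` tuples s B) \<le> card (power_sums k ` tuples s B + power_sums k ` tuples s B)"
proof -
  let ?P = "power_sums k ` tuples s B"
  obtain b where "b \<in> B" using assms by blast
  then have w: "power_sums k (replicate s b) \<in> ?P" by (auto simp: tuples_def)
  have sub: "?P \<subseteq> carrier_vec k" using power_sums_carrier by blast
  have "card ?P = card ((\<lambda>v. v + power_sums k (replicate s b)) ` ?P)"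
    by (rule card_image[symmetric, OF inj_on_subset[OF vec_plus_left_inj[OF power_sums_carrier] sub]])
  also have "\<dots> \<le> card (?P + ?P)"
    using w finite_tuples[OF assms(1)] by (intro card_mono finite_set_plus) (auto intro!: set_plus_intro)
  finally show ?thesis .
qed

text \<open>For \<open>l\<close> popular slopes of level \<open>t\<close>, and up to small powers of
  \<open>n = card A\<close>, the slope argument gives \<open>W\<^sup>2 \<ge> l * t ^ (2 * s)\<close>
  and popularity gives \<open>t * l \<ge> n\<^sup>2\<close>. Eliminating \<open>t\<close> and
  bounding \<open>l\<close> by the size \<open>r\<close> of the ratio set yields
  \<open>W\<^sup>2 * r ^ (2 * s - 1) \<ge> n ^ (4 * s)\<close>.\<close>

lemma sumset_ratio_bound:
  fixes m \<epsilon> :: real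
  assumes m: "0 < m" and \<epsilon>: "0 < \<epsilon>" "\<epsilon> < 1" and k: "2 \<le> k" and s: "k \<le> s" "s \<le> tri k"
  obtains N :: nat and C :: real where "0 < C"
    "\<And>A. finite A \<Longrightarrow> 0 \<notin> A \<Longrightarrow> well_spaced A \<Longrightarrow> N \<le> card A \<Longrightarrow> diam A \<le> real (card A) powr m \<Longrightarrow>
      real (card A) powr (2 * real s - 2 * \<epsilon>)
        \<le> C * (real (card (power_sums k ` tuples s A + power_sums k ` tuples s A)) * real (card (ratio_set A)) powr (real s - 1 / 2 - \<epsilon>))"
proof -
  \<comment> \<open>One loss of \<open>\<delta>\<close> comes from the mean value estimate and
    \<open>s\<close> losses from the logarithm, \<open>\<epsilon> / 2\<close> in all. This is what
    remains of \<open>2 * \<epsilon>\<close> after \<open>3 / 2 * \<epsilon>\<close> is traded for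
    the power of the ratio set.\<close>
  define \<delta> where "\<delta> = \<epsilon> / 2 / (1 + real s)"
  \<comment> \<open>As \<open>2 ^ n' \<le> 4 * card A powr m\<close>, a loss of
    \<open>2 powr (- \<epsilon>' * n')\<close> is worth \<open>card A powr (- \<delta>)\<close> up
    to a constant.\<close>
  define \<epsilon>' where "\<epsilon>' = \<delta> / m"
  have s2: "2 \<le> real s" using k s by simp
  have nz: "1 + real s \<noteq> 0" by linarith
  have \<delta>: "0 < \<delta>" "\<delta> * (1 + real s) = \<epsilon> / 2"
    using \<epsilon> nonzero_eq_divide_eq[THEN iffD1, OF nz \<delta>_def] by (simp_all add: \<delta>_def)
  have \<delta>s: "\<delta> * real s = \<epsilon> / 2 - \<delta>" using \<delta>(2) by (simp add: distrib_left)
  have "2 * \<delta> \<le> \<delta> * real s" using \<delta>(1) s2 by (simp add: mult.commute)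
  then have \<delta>6: "\<delta> \<le> \<epsilon> / 6" using \<delta>s by linarith
  have \<epsilon>': "0 < \<epsilon>'" "m * \<epsilon>' = \<delta>" using \<delta> m by (auto simp: \<epsilon>'_def)
  have k0: "0 < k" and s0: "0 < s" using k s by auto
  obtain c where c: "0 < c" and cb: "\<And>A a n. spread A a n \<Longrightarrow> A \<noteq> {} \<Longrightarrow>
      c * 2 powr (- \<epsilon>' * real n) * real (card A) ^ s \<le> real (card (power_sums k ` tuples s A))"
    using sumset_lower_bound[OF k0 \<epsilon>'(1) s(2)] by blast
  define c1 where "c1 = c * 4 powr (- \<epsilon>')"
  have c1: "0 < c1" using c by (simp add: c1_def)
  \<comment> \<open>Chosen so that \<open>1 + ln x \<le> h * x powr \<delta>\<close> for
    \<open>x \<ge> 1\<close>.\<close>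
  define h where "h = 1 + 1 / \<delta>"
  have h: "1 < h" using \<delta> by (simp add: h_def)
  define c3 where "c3 = c1 / 2 / (4 * h) ^ s"
  have c3: "0 < c3" using c1 h by (simp add: c3_def)
  define C where "C = 1 / c1 + 1 / c3"
  have C: "0 < C" using c1 c3 by (simp add: C_def add_pos_pos)
  \<comment> \<open>Makes \<open>sqrt (card A)\<close> exceed \<open>4 * h\<close>, which guarantees
    two popular slopes, so that consecutive ones exist.\<close>
  define N where "N = nat \<lceil>16 * h\<^sup>2\<rceil> + 1"
  show ?thesis
  proof (rule that[OF C])
    fix A assume A: "finite A" "0 \<notin> A" and ws: "well_spaced A" and NA: "N \<le> card A" and dA: "diam A \<le> real (card A) powr m"
    let ?n = "real (card A)" and ?P = "\<lambda>B. power_sums k ` tuples s B" and ?r = "real (card (ratio_set A))"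
    let ?W = "real (card (?P A + ?P A))"
    have n1: "1 \<le> ?n" using NA unfolding N_def by linarith
    have ne: "A \<noteq> {}" using n1 by auto
    obtain n' where n': "diam A < 2 ^ n'" "2 ^ n' \<le> 2 * (diam A + 1)"
      using dyadic_scale[of "diam A"] by (auto simp: diam_def)
    have lower: "c1 * ?n powr (- \<delta>) * real (card B) ^ s \<le> real (card (?P B))" if B: "B \<subseteq> A" "B \<noteq> {}" for B
    proof -
      have nm: "1 \<le> ?n powr m" using n1 m by (simp add: ge_one_powr_ge_zero)
      have "(2::real) ^ n' \<le> 4 * ?n powr m" using n'(2) dA nm by simp
      then have "(4 * ?n powr m) powr (- \<epsilon>') \<le> (2 ^ n') powr (- \<epsilon>')"
        using \<epsilon>' by (intro powr_mono2') auto
      also have "(2 ^ n') powr (- \<epsilon>') = 2 powr (- \<epsilon>' * real n')"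
        by (simp add: powr_powr mult.commute flip: powr_realpow)
      also have "(4 * ?n powr m) powr (- \<epsilon>') = 4 powr (- \<epsilon>') * ?n powr (- \<delta>)"
        using \<epsilon>' by (simp add: powr_mult powr_powr)
      finally have "c * (4 powr (- \<epsilon>') * ?n powr (- \<delta>)) * real (card B) ^ s \<le> c * 2 powr (- \<epsilon>' * real n') * real (card B) ^ s"
        using c by (intro mult_right_mono mult_left_mono) auto
      also have "\<dots> \<le> real (card (?P B))" by (rule cb[OF well_spaced_spread[OF A(1) ws n'(1) B(1)] B(2)])
      finally show ?thesis by (simp add: c1_def mult.assoc)
    qed
    have r1: "1 \<le> ?r"
    proof -
      obtain a where "a \<in> A" using ne by blast
      then have "ratio_set A \<noteq> {}" by (auto simp: ratio_set_def)
      then have "card (ratio_set A) \<noteq> 0" using sum_ratio_set(1)[OF A] by simp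
      then show ?thesis by linarith
    qed
    have e0: "0 < real s - 1 / 2 - \<epsilon>" using s2 \<epsilon> by linarith
    have concl: "?n powr (2 * real s - 2 * \<epsilon>) \<le> C * (?W * ?r powr (real s - 1 / 2 - \<epsilon>))"
      if c': "c' = c1 \<or> c' = c3" and b: "c' * ?n powr (2 * real s - 2 * \<epsilon>) \<le> ?W * ?r powr (real s - 1 / 2 - \<epsilon>)" for c'
    proof -
      have c'0: "0 < c'" and c'C: "1 / c' \<le> C" using c' c1 c3 by (auto simp: C_def)
      have "?n powr (2 * real s - 2 * \<epsilon>) = 1 / c' * (c' * ?n powr (2 * real s - 2 * \<epsilon>))" using c'0 by simp
      also have "\<dots> \<le> 1 / c' * (?W * ?r powr (real s - 1 / 2 - \<epsilon>))" using b c'0 by (intro mult_left_mono) auto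
      also have "\<dots> \<le> C * (?W * ?r powr (real s - 1 / 2 - \<epsilon>))" using c'C by (intro mult_right_mono) auto
      finally show ?thesis .
    qed
    show "?n powr (2 * real s - 2 * \<epsilon>) \<le> C * (?W * ?r powr (real s - 1 / 2 - \<epsilon>))"
      \<comment> \<open>For a large ratio set the trivial bound by the \<open>s\<close>-fold sumset suffices; otherwise
        the factor \<open>?r powr - \<epsilon>\<close> absorbs the losses of \<open>n powr \<delta>\<close>.\<close>
    proof (cases "?r \<le> ?n powr (3 / 2)")
      case False
      have W: "c1 * ?n powr (real s - \<delta>) \<le> ?W"
      proof -
        have "c1 * ?n powr (real s - \<delta>) = c1 * ?n powr (- \<delta>) * ?n ^ s"
          using n1 by (simp add: powr_diff powr_minus powr_realpow divide_inverse mult_ac)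
        also have "\<dots> \<le> real (card (?P A))" by (rule lower[OF order_refl ne])
        also have "\<dots> \<le> ?W" using sumset_card_ge[OF A(1) ne] by simp
        finally show ?thesis .
      qed
      have R: "?n powr (3 / 2 * (real s - 1 / 2 - \<epsilon>)) \<le> ?r powr (real s - 1 / 2 - \<epsilon>)"
        using False e0 by (subst powr_powr[symmetric], intro powr_mono2) auto
      have "c1 * ?n powr (2 * real s - 2 * \<epsilon>) \<le> c1 * ?n powr ((real s - \<delta>) + 3 / 2 * (real s - 1 / 2 - \<epsilon>))"
      proof (intro mult_left_mono powr_mono)
        have "3 / 2 * (real s - 1 / 2 - \<epsilon>) = 3 / 2 * real s - 3 / 4 - 3 / 2 * \<epsilon>" by (simp add: right_diff_distrib)
        then show "2 * real s - 2 * \<epsilon> \<le> (real s - \<delta>) + 3 / 2 * (real s - 1 / 2 - \<epsilon>)"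
          using s2 \<delta>6 \<epsilon> by linarith
      qed (use n1 c1 in auto)
      also have "\<dots> = c1 * ?n powr (real s - \<delta>) * ?n powr (3 / 2 * (real s - 1 / 2 - \<epsilon>))"
        by (simp only: powr_add mult.assoc)
      also have "\<dots> \<le> ?W * ?r powr (real s - 1 / 2 - \<epsilon>)" by (intro mult_mono W R) auto
      finally show ?thesis by (intro concl[of c1]) auto
    next
      case True
      obtain B \<sigma> where B: "B \<subseteq> A" "card A \<le> 2 * card B" and sg: "\<And>x. x \<in> B \<Longrightarrow> 0 < \<sigma> * x"
        using same_sign_half[OF A] by blast
      have Bf: "finite B" "0 \<notin> B" using A B finite_subset by auto
      let ?b = "card B" and ?f = "\<lambda>c. card {b \<in> B. c * b \<in> B}"
      have nb: "?n \<le> 2 * real ?b" using B(2) by linarith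
      then have b1: "1 \<le> ?b" using n1 by linarith
      have bn: "real ?b \<le> ?n" using card_mono[OF A(1) B(1)] by simp
      have fb: "?f c \<le> ?b" for c using Bf by (intro card_mono) auto
      obtain t where t: "1 \<le> t" "t \<le> ?b"
        and tt: "real (\<Sum>c\<in>ratio_set B. ?f c) \<le> real (t * card {c \<in> ratio_set B. t \<le> ?f c}) * (1 + ln (real ?b))"
        by (rule popular_level[OF sum_ratio_set(1)[OF Bf] fb b1])
      define L where "L = {c \<in> ratio_set B. t \<le> ?f c}"
      let ?l = "real (card L)"
      have Lf: "finite L" using sum_ratio_set(1)[OF Bf] by (simp add: L_def)
      have lr: "?l \<le> ?r"
      proof -
        have "L \<subseteq> ratio_set A" using B(1) by (auto simp: L_def ratio_set_def)
        then show ?thesis using sum_ratio_set(1)[OF A] card_mono by simp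
      qed
      have H: "1 + ln (real ?b) \<le> h * ?n powr \<delta>"
      proof -
        have "ln (real ?b) \<le> ln ?n" using b1 bn by simp
        also have "\<dots> \<le> ?n powr \<delta> / \<delta>" using n1 \<delta> by (intro ln_powr_bound) auto
        finally have "ln (real ?b) \<le> ?n powr \<delta> / \<delta>" .
        moreover have "1 \<le> ?n powr \<delta>" using n1 \<delta> by (simp add: ge_one_powr_ge_zero)
        ultimately show ?thesis by (simp add: h_def distrib_right)
      qed
      have tl: "?n\<^sup>2 / 4 \<le> real t * ?l * (h * ?n powr \<delta>)"
      proof -
        have "?n\<^sup>2 \<le> (2 * real ?b)\<^sup>2" using nb by (intro power_mono) auto
        then have "?n\<^sup>2 / 4 \<le> real (?b ^ 2)" by (simp add: power_mult_distrib)
        also have "\<dots> \<le> real t * ?l * (1 + ln (real ?b))"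
          using tt unfolding sum_ratio_set(2)[OF Bf] L_def by simp
        also have "\<dots> \<le> real t * ?l * (h * ?n powr \<delta>)" by (intro mult_left_mono H) auto
        finally show ?thesis .
      qed
      have l2: "2 \<le> ?l"
      proof -
        have "real t \<le> ?n" using t bn by linarith
        then have "real t * ?l * (h * ?n powr \<delta>) \<le> ?n * ?l * (h * ?n powr \<delta>)"
          using h by (intro mult_right_mono) auto
        then have "?n * (?n / 4) \<le> ?n * (?l * (h * ?n powr \<delta>))" using tl by (simp add: power2_eq_square mult_ac)
        then have "?n / 4 \<le> ?l * (h * ?n powr \<delta>)" using n1 by (subst (asm) mult_le_cancel_left_pos) auto
        also have "\<dots> \<le> ?l * (h * ?n powr (1 / 2))" using n1 h \<delta>6 \<epsilon> by (intro mult_left_mono powr_mono) auto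
        finally have "sqrt ?n * sqrt ?n \<le> (4 * ?l * h) * sqrt ?n" by (simp add: powr_half_sqrt)
        then have le: "sqrt ?n \<le> 4 * ?l * h" using n1 by (subst (asm) mult_le_cancel_right_pos) auto
        show ?thesis
        proof (rule ccontr)
          assume "\<not> 2 \<le> ?l"
          then have "card L \<le> 1" by simp
          have nN': "16 * h\<^sup>2 < ?n" using NA unfolding N_def by linarith
          then have "(4 * h)\<^sup>2 < (sqrt ?n)\<^sup>2" using n1 by (simp add: power_mult_distrib)
          then have "4 * h < sqrt ?n" by (rule power2_less_imp_less) simp
          moreover have "4 * ?l * h \<le> 4 * 1 * h" using \<open>card L \<le> 1\<close> h by (intro mult_right_mono) auto
          ultimately show False using le by linarith
        qed
      qed
      define M where "M = c1 * ?n powr (- \<delta>) * real t ^ s"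
      have M0: "0 \<le> M" using c1 by (simp add: M_def)
      have "real (card L - 1) * M\<^sup>2 \<le> (real (card (?P B + ?P B)))\<^sup>2"
      proof (rule consecutive_slopes[OF Bf(1) sg k0 s0 Lf _ M0])
        show "0 < c" if "c \<in> L" for c
        proof -
          have "1 \<le> ?f c" using that t by (auto simp: L_def)
          then obtain b where b: "b \<in> B" "c * b \<in> B" using card_gt_0_iff[of "{b \<in> B. c * b \<in> B}"] by auto
          have "0 < c * (\<sigma> * b)" using sg[OF b(2)] by (simp only: mult.left_commute)
          then show ?thesis by (rule zero_less_mult_pos2[OF _ sg[OF b(1)]])
        qed
        fix c assume cL: "c \<in> L"
        have "t \<le> ?f c" using cL by (simp add: L_def)
        then have "M \<le> c1 * ?n powr (- \<delta>) * real (?f c) ^ s"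
          unfolding M_def using c1 by (intro mult_left_mono power_mono) auto
        also have "\<dots> \<le> real (card (?P {b \<in> B. c * b \<in> B}))"
        proof (rule lower)
          have "?f c \<noteq> 0" using \<open>t \<le> ?f c\<close> t by linarith
          then show "{b \<in> B. c * b \<in> B} \<noteq> {}" by (metis card.empty)
        qed (use B(1) in blast)
        finally show "M \<le> real (card (?P {b \<in> B. c * b \<in> B}))" .
      qed
      also have "(real (card (?P B + ?P B)))\<^sup>2 \<le> ?W\<^sup>2"
      proof (intro power_mono of_nat_mono card_mono)
        show "finite (?P A + ?P A)" using finite_tuples[OF A(1)] by (intro finite_set_plus) auto
        show "?P B + ?P B \<subseteq> ?P A + ?P A" using B(1) by (intro set_plus_mono2 image_mono tuples_mono)
      qed auto
      finally have W: "real (card L - 1) * M\<^sup>2 \<le> ?W\<^sup>2" .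
      have l1: "?l / 2 \<le> real (card L - 1)" using l2 by (simp add: of_nat_diff)
      have "(c3 * ?n powr (2 * real s - \<epsilon> / 2))\<^sup>2 \<le> (?W * ?r powr (real s - 1 / 2))\<^sup>2"
      proof -
        let ?q = "2 * s - 1"
        have q: "2 * s = Suc ?q" using s0 by simp
        have rp: "(?r powr (real s - 1 / 2))\<^sup>2 = ?r ^ ?q"
        proof -
          have "(?r powr (real s - 1 / 2))\<^sup>2 = ?r powr ((real s - 1 / 2) * real 2)"
            using r1 by (simp add: powr_power mult.commute)
          also have "(real s - 1 / 2) * real 2 = real ?q" using s0 by (simp add: of_nat_diff)
          also have "?r powr real ?q = ?r ^ ?q" using r1 by (intro powr_realpow) auto
          finally show ?thesis .
        qed
        have x: "?n powr (2 - \<delta>) / (4 * h) \<le> real t * ?l"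
        proof -
          have "?n powr (2 - \<delta>) / (4 * h) = ?n\<^sup>2 / 4 / (h * ?n powr \<delta>)"
            using n1 by (simp add: powr_diff)
          also have "\<dots> \<le> real t * ?l"
          proof -
            have pos: "0 < h * ?n powr \<delta>" using h n1 by (intro mult_pos_pos) auto
            show ?thesis unfolding pos_divide_le_eq[OF pos] by (rule tl)
          qed
          finally show ?thesis .
        qed
        have "(?n powr (2 - \<delta>) / (4 * h)) ^ (2 * s) \<le> (real t * ?l) ^ (2 * s)"
          using h by (intro power_mono x) auto
        \<comment> \<open>One factor \<open>?l\<close> is kept to count the slopes; the other
          \<open>2 * s - 1\<close> are passed to the ratio set, which after the square root explains
          the exponent \<open>s - 1 / 2\<close>.\<close>
        also have "\<dots> = real t ^ (2 * s) * ?l * ?l ^ ?q" 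
          unfolding power_mult_distrib mult.assoc power_Suc[symmetric] q[symmetric] ..
        also have "\<dots> \<le> real t ^ (2 * s) * ?l * ?r ^ ?q" by (intro mult_left_mono power_mono lr) auto
        finally have y: "(?n powr (2 - \<delta>) / (4 * h)) ^ (2 * s) \<le> real t ^ (2 * s) * ?l * ?r ^ ?q" .
        have ex: "c3 * ?n powr (2 * real s - \<epsilon> / 2) = c1 / 2 * ?n powr (- \<delta>) * (?n powr (2 - \<delta>) / (4 * h)) ^ s"
        proof -
          have "(?n powr (2 - \<delta>)) ^ s = ?n powr (2 * real s - (\<epsilon> / 2 - \<delta>))"
          proof -
            have "(?n powr (2 - \<delta>)) ^ s = (?n powr (2 - \<delta>)) powr real s"
              by (rule powr_realpow[symmetric]) (use n1 in simp)
            also have "\<dots> = ?n powr ((2 - \<delta>) * real s)" by (rule powr_powr)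
            finally show ?thesis unfolding left_diff_distrib \<delta>s .
          qed
          then have "?n powr (- \<delta>) * (?n powr (2 - \<delta>)) ^ s = ?n powr (2 * real s - \<epsilon> / 2)"
            by (simp flip: powr_add)
          then show ?thesis by (simp add: c3_def power_divide)
        qed
        have "(c3 * ?n powr (2 * real s - \<epsilon> / 2))\<^sup>2 = (c1 / 2 * ?n powr (- \<delta>))\<^sup>2 * (?n powr (2 - \<delta>) / (4 * h)) ^ (2 * s)"
          unfolding ex by (simp only: power_mult_distrib power_mult[symmetric] mult.commute[of s 2])
        also have "\<dots> \<le> (c1 / 2 * ?n powr (- \<delta>))\<^sup>2 * (real t ^ (2 * s) * ?l * ?r ^ ?q)" by (intro mult_left_mono y) auto
        also have "\<dots> = (?l / 4 * M\<^sup>2) * ?r ^ ?q"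
          unfolding M_def by (simp add: power_mult_distrib power_divide power_mult[symmetric] mult.commute[of s 2])
        also have "\<dots> \<le> (real (card L - 1) * M\<^sup>2) * ?r ^ ?q"
          using l1 by (intro mult_right_mono) auto
        also have "\<dots> \<le> ?W\<^sup>2 * ?r ^ ?q" by (intro mult_right_mono W) auto
        also have "\<dots> = (?W * ?r powr (real s - 1 / 2))\<^sup>2" by (simp add: power_mult_distrib rp)
        finally show ?thesis .
      qed
      then have key: "c3 * ?n powr (2 * real s - \<epsilon> / 2) \<le> ?W * ?r powr (real s - 1 / 2)"
        by (rule power2_le_imp_le) simp
      have "c3 * ?n powr (2 * real s - 2 * \<epsilon>) = c3 * ?n powr (2 * real s - \<epsilon> / 2) * ?n powr (3 / 2 * (- \<epsilon>))"
        by (simp add: mult.assoc flip: powr_add)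
      also have "\<dots> \<le> (?W * ?r powr (real s - 1 / 2)) * ?r powr (- \<epsilon>)"
      proof (rule mult_mono[OF key])
        have "(?n powr (3 / 2)) powr (- \<epsilon>) \<le> ?r powr (- \<epsilon>)"
          using True r1 \<epsilon> by (intro powr_mono2') auto
        then show "?n powr (3 / 2 * (- \<epsilon>)) \<le> ?r powr (- \<epsilon>)" by (simp only: powr_powr)
      qed auto
      also have "\<dots> = ?W * ?r powr (real s - 1 / 2 - \<epsilon>)"
        unfolding mult.assoc powr_add[symmetric] by simp
      finally show ?thesis by (intro concl[of c3]) auto
    qed
  qed
qed

theorem theorem1p2:
  "\<exists>\<epsilon>\<^sub>0>0. \<forall>(m::real) (\<epsilon>::real) (s::nat) (k::nat).
     0 < m \<and> 0 < \<epsilon> \<and> \<epsilon> < \<epsilon>\<^sub>0 \<and> 2 \<le> k \<and> k \<le> s \<and> s \<le> k * (k + 1) div 2 \<longrightarrow>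
     (\<exists>(N::nat) (C::real). 0 < C \<and>
        (\<forall>A::real set. finite A \<and> 0 \<notin> A \<and> well_spaced A \<and> N \<le> card A \<and>
             diam A \<le> real (card A) powr m \<longrightarrow>
           real (card A) powr (2 * real s - 2 * \<epsilon>)
             \<le> C * (real (card (nfold_sumset k s (moment_curve k A) + nfold_sumset k s (moment_curve k A)))
                 * real (card (ratio_set A)) powr (real s - 1 / 2 - \<epsilon>))))"
proof (rule exI[of _ "1::real"], intro conjI allI impI)
  \<comment> \<open>The threshold 1 suffices: as \<open>s \<ge> 2\<close>, the exponent
    \<open>s - 1 / 2 - \<epsilon>\<close> stays positive.\<close>
  fix m \<epsilon> :: real and s k :: nat
  assume "0 < m \<and> 0 < \<epsilon> \<and> \<epsilon> < 1 \<and> 2 \<le> k \<and> k \<le> s \<and> s \<le> k * (k + 1) div 2"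
  then have h: "0 < m" "0 < \<epsilon>" "\<epsilon> < 1" "2 \<le> k" "k \<le> s" "s \<le> tri k" by (auto simp: tri_def)
  show "\<exists>(N::nat) (C::real). 0 < C \<and>
        (\<forall>A::real set. finite A \<and> 0 \<notin> A \<and> well_spaced A \<and> N \<le> card A \<and>
             diam A \<le> real (card A) powr m \<longrightarrow>
           real (card A) powr (2 * real s - 2 * \<epsilon>)
             \<le> C * (real (card (nfold_sumset k s (moment_curve k A) + nfold_sumset k s (moment_curve k A)))
                 * real (card (ratio_set A)) powr (real s - 1 / 2 - \<epsilon>)))"
    unfolding nfold_sumset_power_sums by (rule sumset_ratio_bound[OF h], intro exI conjI allI impI, assumption) blast
qed simp

end
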